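(* Let $G$ be a discrete group and let $\mathcal{F}$ be the family of finite subgroups of $G$. Then the nerve $\mathrm{N}(\mathbf{O}_{\mathcal{F}})$ of the orbit category is a model for $\mathrm{B}_{\mathcal{F}}G$.
   Context: A $G$-CW-complex $Y$ is a model for $\mathrm{E}_{\mathcal{F}}G$ if the isotropy group of each point of $Y$ belongs to $\mathcal{F}$ and for each $H\in\mathcal{F}$ the fixed-point space $Y^H$ is contractible; it is unique up to $G$-homotopy equivalence. $\mathrm{B}_{\mathcal{F}}G$ denotes the quotient $\mathrm{E}_{\mathcal{F}}G/G$, well defined up to homotopy equivalence; a model for $\mathrm{B}_{\mathcal{F}}G$ is a space of this homotopy type. The nerve is regarded as a space through its realization. The orbit category $\mathbf{O}_{\mathcal{F}}$ has as objects the homogeneous spaces $G/H$ with $H\in\mathcal{F}$, and as morphisms the $G$-maps. *)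

theory Defs
  imports
    "HOL-Analysis.Analysis"
    "HOL-Algebra.Group_Action"
    "HOL-Algebra.Left_Coset"
    "HOL-Homology.Simplices"
begin

section \<open>Quotient spaces\<close>

definition quotient_topology :: "'a topology \<Rightarrow> ('a \<Rightarrow> 'b) \<Rightarrow> 'b topology" where
  "quotient_topology X p =
     topology (\<lambda>U. U \<subseteq> p ` topspace X \<and> openin X {x \<in> topspace X. p x \<in> U})"

lemma openin_quotient_topology:
  "openin (quotient_topology X p) U \<longleftrightarrow>
     U \<subseteq> p ` topspace X \<and> openin X {x \<in> topspace X. p x \<in> U}"
proof -
  have 1: "{x \<in> topspace X. p x \<in> S \<inter> T} =
      {x \<in> topspace X. p x \<in> S} \<inter> {x \<in> topspace X. p x \<in> T}" for S T
    by auto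
  have 2: "{x \<in> topspace X. p x \<in> \<Union>K} = (\<Union>S\<in>K. {x \<in> topspace X. p x \<in> S})" for K
    by auto
  have "istopology (\<lambda>U. U \<subseteq> p ` topspace X \<and> openin X {x \<in> topspace X. p x \<in> U})"
    unfolding istopology_def 1 2 by blast
  then show ?thesis
    by (simp add: quotient_topology_def)
qed

lemma topspace_quotient_topology [simp]:
  "topspace (quotient_topology X p) = p ` topspace X"
proof
  have "{x \<in> topspace X. p x \<in> p ` topspace X} = topspace X"
    by auto
  then have "openin (quotient_topology X p) (p ` topspace X)"
    by (simp add: openin_quotient_topology)
  then show "p ` topspace X \<subseteq> topspace (quotient_topology X p)"
    by (rule openin_subset)
qed (use openin_quotient_topology[of X p "topspace (quotient_topology X p)"] in simp)

lemma quotient_map_quotient_topology: "quotient_map X (quotient_topology X p) p"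
  by (auto simp: quotient_map_def openin_quotient_topology)

definition orbit_space ::
  "('g, 'b) monoid_scheme \<Rightarrow> 'y topology \<Rightarrow> ('g \<Rightarrow> 'y \<Rightarrow> 'y) \<Rightarrow> 'y set topology" where
  "orbit_space G Y \<phi> = quotient_topology Y (orbit G \<phi>)"


section \<open>Simplicial sets and geometric realization\<close>

definition simplex_maps :: "nat \<Rightarrow> nat \<Rightarrow> (nat \<Rightarrow> nat) set" where
  "simplex_maps m n = {\<theta>. \<theta> \<in> {..m} \<rightarrow> {..n} \<and> mono_on {..m} \<theta>}"

text \<open>For \<open>\<theta> : [m] \<rightarrow> [n]\<close> the field \<open>Pull X m n \<theta>\<close> is the operator
  \<open>\<theta>\<^sup>* : X\<^sub>n \<rightarrow> X\<^sub>m\<close>.\<close>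

record 's simplicial_set =
  Simps :: "nat \<Rightarrow> 's set"
  Pull :: "nat \<Rightarrow> nat \<Rightarrow> (nat \<Rightarrow> nat) \<Rightarrow> 's \<Rightarrow> 's"

definition simplex_push :: "nat \<Rightarrow> (nat \<Rightarrow> nat) \<Rightarrow> (nat \<Rightarrow> real) \<Rightarrow> nat \<Rightarrow> real" where
  "simplex_push m \<theta> t = (\<lambda>j. \<Sum>i | i \<le> m \<and> \<theta> i = j. t i)"

definition simplex_sum :: "'s simplicial_set \<Rightarrow> ((nat \<times> 's) \<times> (nat \<Rightarrow> real)) topology" where
  "simplex_sum X =
     sum_topology (\<lambda>(n, \<sigma>). subtopology (powertop_real UNIV) (standard_simplex n))
       (SIGMA n : UNIV. Simps X n)"

definition simplex_glue ::
  "'s simplicial_set \<Rightarrow> (((nat \<times> 's) \<times> (nat \<Rightarrow> real)) \<times> ((nat \<times> 's) \<times> (nat \<Rightarrow> real))) set" where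
  "simplex_glue X =
     {(((m, Pull X m n \<theta> \<sigma>), t), ((n, \<sigma>), simplex_push m \<theta> t)) | m n \<theta> \<sigma> t.
        \<theta> \<in> simplex_maps m n \<and> \<sigma> \<in> Simps X n \<and> t \<in> standard_simplex m}"

definition geometric_realization ::
  "'s simplicial_set \<Rightarrow> ((nat \<times> 's) \<times> (nat \<Rightarrow> real)) set topology" where
  "geometric_realization X =
     quotient_topology (simplex_sum X)
       (\<lambda>p. (simplex_glue X \<union> (simplex_glue X)\<inverse>)\<^sup>* `` {p})"


section \<open>Small categories and nerves\<close>

record ('o, 'm) category =
  Obj :: "'o set"
  Hom :: "'o \<Rightarrow> 'o \<Rightarrow> 'm set"
  Ident :: "'o \<Rightarrow> 'm"
  Comp :: "'m \<Rightarrow> 'm \<Rightarrow> 'm"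

locale small_category =
  fixes C :: "('o, 'm) category"
  assumes Ident_in_Hom: "A \<in> Obj C \<Longrightarrow> Ident C A \<in> Hom C A A"
    and Comp_in_Hom: "\<lbrakk>A \<in> Obj C; B \<in> Obj C; D \<in> Obj C; f \<in> Hom C A B; g \<in> Hom C B D\<rbrakk>
      \<Longrightarrow> Comp C g f \<in> Hom C A D"
    and Comp_Ident: "\<lbrakk>A \<in> Obj C; B \<in> Obj C; f \<in> Hom C A B\<rbrakk> \<Longrightarrow> Comp C f (Ident C A) = f"
    and Ident_Comp: "\<lbrakk>A \<in> Obj C; B \<in> Obj C; f \<in> Hom C A B\<rbrakk> \<Longrightarrow> Comp C (Ident C B) f = f"
    and Comp_assoc: "\<lbrakk>A \<in> Obj C; B \<in> Obj C; D \<in> Obj C; E \<in> Obj C;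
        f \<in> Hom C A B; g \<in> Hom C B D; h \<in> Hom C D E\<rbrakk>
      \<Longrightarrow> Comp C h (Comp C g f) = Comp C (Comp C h g) f"

definition chain_arrows :: "nat \<Rightarrow> (nat \<times> nat) set" where
  "chain_arrows n = {(i, j). i \<le> j \<and> j \<le> n}"

text \<open>An \<open>n\<close>-simplex of the nerve is a functor \<open>(x, a)\<close> from the ordered set \<open>[n]\<close>, with
  \<open>a (i, j)\<close> the value on the arrow \<open>i \<le> j\<close>. Degenerate simplices are included.\<close>

definition nerve ::
  "('o, 'm) category \<Rightarrow> ((nat \<Rightarrow> 'o) \<times> (nat \<times> nat \<Rightarrow> 'm)) simplicial_set" where
  "nerve C =
     \<lparr>Simps = (\<lambda>n. {(x, a).
        x \<in> {..n} \<rightarrow>\<^sub>E Obj C \<and>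
        a \<in> (\<Pi>\<^sub>E p \<in> chain_arrows n. Hom C (x (fst p)) (x (snd p))) \<and>
        (\<forall>i\<le>n. a (i, i) = Ident C (x i)) \<and>
        (\<forall>i j k. i \<le> j \<and> j \<le> k \<and> k \<le> n \<longrightarrow> a (i, k) = Comp C (a (j, k)) (a (i, j)))}),
      Pull = (\<lambda>m n \<theta> (x, a).
        (restrict (\<lambda>i. x (\<theta> i)) {..m},
         restrict (\<lambda>(i, j). a (\<theta> i, \<theta> j)) (chain_arrows m)))\<rparr>"


section \<open>The orbit category\<close>

definition finite_subgroups :: "('g, 'b) monoid_scheme \<Rightarrow> 'g set set" where
  "finite_subgroups G = {H. subgroup H G \<and> finite H}"

text \<open>\<open>G\<close> acts on \<open>G/H\<close>, the set of left cosets, by left translation.\<close>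

definition coset_maps ::
  "('g, 'b) monoid_scheme \<Rightarrow> 'g set set \<Rightarrow> 'g set set \<Rightarrow> ('g set \<Rightarrow> 'g set) set" where
  "coset_maps G A B =
     {f \<in> A \<rightarrow>\<^sub>E B. \<forall>g \<in> carrier G. \<forall>c \<in> A. f (g <#\<^bsub>G\<^esub> c) = g <#\<^bsub>G\<^esub> f c}"

text \<open>A morphism carries its source and target.\<close>

definition orbit_category ::
  "('g, 'b) monoid_scheme \<Rightarrow> 'g set set \<Rightarrow>
   ('g set set, 'g set set \<times> 'g set set \<times> ('g set \<Rightarrow> 'g set)) category" where
  "orbit_category G \<F> =
     \<lparr>Obj = {lcosets\<^bsub>G\<^esub> H | H. H \<in> \<F>},
      Hom = (\<lambda>A B. {(A, B, f) | f. f \<in> coset_maps G A B}),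
      Ident = (\<lambda>A. (A, A, restrict id A)),
      Comp = (\<lambda>(B, D, g) (A, B', f). (A, D, compose A g f))\<rparr>"

lemma small_category_orbit_category:
  assumes G: "group G" and \<F>: "\<And>H. H \<in> \<F> \<Longrightarrow> subgroup H G"
  shows "small_category (orbit_category G \<F>)"
proof -
  interpret group G by (rule G)
  have tr: "g <#\<^bsub>G\<^esub> c \<in> lcosets\<^bsub>G\<^esub> H"
    if H: "H \<in> \<F>" and g: "g \<in> carrier G" and c: "c \<in> lcosets\<^bsub>G\<^esub> H" for g c H
  proof -
    obtain a where a: "a \<in> carrier G" "c = a <#\<^bsub>G\<^esub> H"
      using c by (auto simp: LCOSETS_def)
    have "g <#\<^bsub>G\<^esub> c = (g \<otimes>\<^bsub>G\<^esub> a) <#\<^bsub>G\<^esub> H"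
      using a g subgroup.subset[OF \<F>[OF H]] by (simp add: lcos_m_assoc)
    then show ?thesis
      using a g by (auto simp: LCOSETS_def)
  qed
  have tr': "\<And>A g c. A \<in> Obj (orbit_category G \<F>) \<Longrightarrow> g \<in> carrier G \<Longrightarrow> c \<in> A \<Longrightarrow> g <#\<^bsub>G\<^esub> c \<in> A"
    using tr by (auto simp: orbit_category_def)
  show ?thesis
  proof
    show "Ident (orbit_category G \<F>) A \<in> Hom (orbit_category G \<F>) A A"
      if "A \<in> Obj (orbit_category G \<F>)" for A
      using tr'[OF that] by (auto simp: orbit_category_def coset_maps_def)
  next
    fix A B D f g
    assume *: "A \<in> Obj (orbit_category G \<F>)"
      "f \<in> Hom (orbit_category G \<F>) A B" "g \<in> Hom (orbit_category G \<F>) B D"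
    then show "Comp (orbit_category G \<F>) g f \<in> Hom (orbit_category G \<F>) A D"
      using tr'[OF *(1)]
      by (auto simp: orbit_category_def coset_maps_def compose_def PiE_iff)
  next
    fix A B f
    assume "f \<in> Hom (orbit_category G \<F>) A B"
    then show "Comp (orbit_category G \<F>) f (Ident (orbit_category G \<F>) A) = f"
      by (auto simp: orbit_category_def coset_maps_def compose_def fun_eq_iff PiE_iff extensional_def)
  next
    fix A B f
    assume "f \<in> Hom (orbit_category G \<F>) A B"
    then obtain u where u: "f = (A, B, u)" "u \<in> A \<rightarrow>\<^sub>E B"
      by (auto simp: orbit_category_def coset_maps_def)
    have "compose A (restrict id B) u = u"
      using u(2) Id_compose[of u A B] by (simp add: PiE_iff Pi_iff id_def)
    then show "Comp (orbit_category G \<F>) (Ident (orbit_category G \<F>) B) f = f"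
      by (simp add: orbit_category_def u(1))
  next
    fix A B D E f g h
    assume "f \<in> Hom (orbit_category G \<F>) A B" "g \<in> Hom (orbit_category G \<F>) B D"
      "h \<in> Hom (orbit_category G \<F>) D E"
    then show "Comp (orbit_category G \<F>) h (Comp (orbit_category G \<F>) g f) =
        Comp (orbit_category G \<F>) (Comp (orbit_category G \<F>) h g) f"
      by (auto simp: orbit_category_def coset_maps_def compose_def fun_eq_iff PiE_iff)
  qed
qed


section \<open>\<open>G\<close>-CW-complexes for a discrete group\<close>

text \<open>As \<open>G\<close> is discrete, continuity of the action is continuity of each translation.\<close>

definition G_space ::
  "('g, 'b) monoid_scheme \<Rightarrow> 'y topology \<Rightarrow> ('g \<Rightarrow> 'y \<Rightarrow> 'y) \<Rightarrow> bool" where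
  "G_space G Y \<phi> \<longleftrightarrow>
     group_action G (topspace Y) \<phi> \<and> (\<forall>g \<in> carrier G. continuous_map Y Y (\<phi> g))"

definition disc :: "nat \<Rightarrow> (nat \<Rightarrow> real) topology" where
  "disc n = subtopology (Euclidean_space n) {x. (\<Sum>i<n. x i ^ 2) \<le> 1}"

definition G_cells ::
  "('g, 'b) monoid_scheme \<Rightarrow> nat \<Rightarrow> 'i set \<Rightarrow> ('i \<Rightarrow> 'g set) \<Rightarrow>
   ('i \<times> 'g set \<times> (nat \<Rightarrow> real)) topology" where
  "G_cells G n J H =
     sum_topology (\<lambda>j. prod_topology (discrete_topology (lcosets\<^bsub>G\<^esub> (H j))) (disc n)) J"

text \<open>\<open>B\<close> arises from the subspace \<open>A\<close> by a pushout along \<open>\<Coprod> G/H\<^sub>j \<times> S\<^bsup>n-1\<^esup> \<subseteq> \<Coprod> G/H\<^sub>j \<times> D\<^sup>n\<close>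
  with characteristic \<open>G\<close>-map \<open>q\<close>: the underlying set of that pushout is \<open>A\<close> together with the
  open cells, and its topology is the quotient topology from \<open>A\<close> and the closed cells. Indexing
  the cells by points of \<open>Y\<close> is no restriction, since the centres of distinct cells are
  distinct points.\<close>

definition attaches_G_cells ::
  "('g, 'b) monoid_scheme \<Rightarrow> 'y topology \<Rightarrow> ('g \<Rightarrow> 'y \<Rightarrow> 'y) \<Rightarrow> nat \<Rightarrow> 'y set \<Rightarrow> 'y set \<Rightarrow> bool" where
  "attaches_G_cells G Y \<phi> n A B \<longleftrightarrow>
     (\<exists>(J :: 'y set) H q.
        (\<forall>j \<in> J. subgroup (H j) G) \<and>
        continuous_map (G_cells G n J H) (subtopology Y B) q \<and>
        (\<forall>(j, c, x) \<in> topspace (G_cells G n J H). \<forall>g \<in> carrier G.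
           q (j, g <#\<^bsub>G\<^esub> c, x) = \<phi> g (q (j, c, x))) \<and>
        (\<forall>(j, c, x) \<in> topspace (G_cells G n J H). (\<Sum>i<n. x i ^ 2) = 1 \<longrightarrow> q (j, c, x) \<in> A) \<and>
        bij_betw q {(j, c, x) \<in> topspace (G_cells G n J H). (\<Sum>i<n. x i ^ 2) < 1} (B - A) \<and>
        (\<forall>U \<subseteq> B. openin (subtopology Y B) U \<longleftrightarrow>
           openin (subtopology Y A) (U \<inter> A) \<and>
           openin (G_cells G n J H) {p \<in> topspace (G_cells G n J H). q p \<in> U}))"

text \<open>The skeleta are shifted by one: \<open>sk 0 = \<emptyset>\<close> is the \<open>(-1)\<close>-skeleton and \<open>sk (Suc n)\<close> the
  \<open>n\<close>-skeleton.\<close>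

definition G_CW_complex ::
  "('g, 'b) monoid_scheme \<Rightarrow> 'y topology \<Rightarrow> ('g \<Rightarrow> 'y \<Rightarrow> 'y) \<Rightarrow> bool" where
  "G_CW_complex G Y \<phi> \<longleftrightarrow>
     G_space G Y \<phi> \<and>
     (\<exists>sk :: nat \<Rightarrow> 'y set.
        sk 0 = {} \<and>
        (\<forall>n. sk n \<subseteq> sk (Suc n) \<and> attaches_G_cells G Y \<phi> n (sk n) (sk (Suc n))) \<and>
        (\<Union>n. sk n) = topspace Y \<and>
        (\<forall>U \<subseteq> topspace Y. openin Y U \<longleftrightarrow> (\<forall>n. openin (subtopology Y (sk n)) (U \<inter> sk n))))"


section \<open>Classifying spaces for families\<close>

definition fixed_points ::
  "'y topology \<Rightarrow> ('g \<Rightarrow> 'y \<Rightarrow> 'y) \<Rightarrow> 'g set \<Rightarrow> 'y set" where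
  "fixed_points Y \<phi> H = {y \<in> topspace Y. \<forall>h \<in> H. \<phi> h y = y}"

text \<open>Nonemptiness is required separately because \<^const>\<open>contractible_space\<close> holds of the
  empty space.\<close>

definition classifying_G_space ::
  "('g, 'b) monoid_scheme \<Rightarrow> 'g set set \<Rightarrow> 'y topology \<Rightarrow> ('g \<Rightarrow> 'y \<Rightarrow> 'y) \<Rightarrow> bool" where
  "classifying_G_space G \<F> Y \<phi> \<longleftrightarrow>
     G_CW_complex G Y \<phi> \<and>
     (\<forall>y \<in> topspace Y. stabilizer G \<phi> y \<in> \<F>) \<and>
     (\<forall>H \<in> \<F>. fixed_points Y \<phi> H \<noteq> {} \<and>
        contractible_space (subtopology Y (fixed_points Y \<phi> H)))"

end

theory Submission
  imports Defs
begin

text \<open>The left cosets of finite subgroups of \<open>G\<close> form a \<open>G\<close>-set, preordered by inclusion of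
  stabilizers. The realization \<open>|E|\<close> of its nerve is another classifying space for the finite
  subgroups: its cells are indexed by the chains without repeated neighbours, a point is fixed by
  \<open>H\<close> if and only if its first coset is, and the \<open>H\<close>-fixed points are contracted by a cone on the
  coset \<open>H\<close>, which lies below every fixed coset. As there is at most one \<open>G\<close>-map of transitive
  \<open>G\<close>-sets with \<open>c \<mapsto> d\<close>, and it exists if and only if \<open>c\<close> is below \<open>d\<close>, the orbits of chains are
  the simplices of the nerve of the orbit category, whose realization is therefore \<open>|E|/G\<close>.
  Cell by cell, equivariant maps extend over cells into any \<open>G\<close>-space with contractible fixed
  points; hence \<open>Y\<close> and \<open>|E|\<close> are equivariantly homotopy equivalent, and so their orbit spaces are
  homotopy equivalent.\<close>

section \<open>Extension over gauged cells\<close>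

text \<open>A coset is an object \<open>G/H\<close> with a base point, and there is at most one base
  point preserving \<open>G\<close>-map between two such, so simplices reduce to words in cosets.
  The price is that inclusion of stabilizers is only a preorder: a word may return to an earlier
  coset, and cells cannot be read off from sets of vertices. Equality of points is decided by an
  invariant instead. Barycentric coordinates cut \<open>[0, 1)\<close> into intervals, the cosets
  label them, and the resulting step function is unchanged by faces and degeneracies and determines
  the point. The cone, defined on words, is seen through it to be independent of the word. In the
  comparison the cells of \<open>Y\<close> are discs, those of \<open>|E|\<close> are simplices, and
  homotopies need products of both with an interval. One interface covers them all, in which a cell
  carries only a radial coordinate. Every homotopy must also pass through quotient maps; it does
  because the parameter space, a point or \<open>[0, 1]\<close>, is locally compact Hausdorff, and
  the product with such a space preserves quotient maps.\<close>

lemma continuous_map_prod_sum_topology: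
  assumes "\<And>a. a \<in> A \<Longrightarrow> continuous_map (prod_topology T (Q a)) Z (\<lambda>(u, x). k (u, a, x))"
  shows "continuous_map (prod_topology T (sum_topology Q A)) Z k"
  unfolding continuous_map_def
proof (intro conjI allI impI)
  show "k \<in> topspace (prod_topology T (sum_topology Q A)) \<rightarrow> topspace Z"
    using continuous_map_image_subset_topspace[OF assms] by fastforce
next
  fix U assume U: "openin Z U"
  show "openin (prod_topology T (sum_topology Q A))
      {w \<in> topspace (prod_topology T (sum_topology Q A)). k w \<in> U}" (is "openin _ ?W")
    unfolding openin_prod_topology_alt
  proof (intro allI impI)
    fix u y assume "(u, y) \<in> ?W"
    then obtain a x where y: "y = (a, x)" "a \<in> A" "x \<in> topspace (Q a)" "u \<in> topspace T"
      "k (u, a, x) \<in> U"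
      by auto
    have "openin (prod_topology T (Q a))
        {w \<in> topspace (prod_topology T (Q a)). (\<lambda>(u, x). k (u, a, x)) w \<in> U}"
      using assms[OF y(2)] U by (auto simp: continuous_map_def)
    moreover have "(u, x) \<in> {w \<in> topspace (prod_topology T (Q a)). (\<lambda>(u, x). k (u, a, x)) w \<in> U}"
      using y by auto
    ultimately obtain V V' where V: "openin T V" "openin (Q a) V'" "u \<in> V" "x \<in> V'"
      "V \<times> V' \<subseteq> {w \<in> topspace (prod_topology T (Q a)). (\<lambda>(u, x). k (u, a, x)) w \<in> U}"
      unfolding openin_prod_topology_alt by meson
    \<comment> \<open>Injections into a sum are open maps, so a box in the summand of
      \<open>y\<close> is already a neighbourhood in the product with the whole sum.\<close>
    have "openin (sum_topology Q A) (Pair a ` V')"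
      using open_map_component_injection[OF y(2), of Q] V(2) unfolding open_map_def by blast
    moreover have "V \<times> Pair a ` V' \<subseteq> ?W"
      using V(5) y(2) by fastforce
    ultimately show "\<exists>V V'. openin T V \<and> openin (sum_topology Q A) V' \<and> u \<in> V \<and> y \<in> V' \<and>
        V \<times> V' \<subseteq> ?W"
      using V y(1) by (intro exI[of _ V] exI[of _ "Pair a ` V'"]) auto
  qed
qed

lemma continuous_map_from_sum_topology:
  assumes "\<And>a. a \<in> A \<Longrightarrow> continuous_map (Q a) Z (\<lambda>x. k (a, x))"
  shows "continuous_map (sum_topology Q A) Z k"
  unfolding continuous_map_def
proof (intro conjI allI impI)
  show "k \<in> topspace (sum_topology Q A) \<rightarrow> topspace Z"
    using continuous_map_image_subset_topspace[OF assms] by fastforce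
next
  fix U assume "openin Z U"
  then have "openin (Q a) {x \<in> topspace (Q a). k (a, x) \<in> U}" if "a \<in> A" for a
    using assms[OF that] by (auto simp: continuous_map_def)
  then show "openin (sum_topology Q A) {x \<in> topspace (sum_topology Q A). k x \<in> U}"
    by (auto simp: openin_sum_topology)
qed

lemma quotient_map_from_sum_topology:
  assumes "\<And>a. a \<in> A \<Longrightarrow> continuous_map (Q a) X (\<lambda>x. r (a, x))"
    and "\<And>p. p \<in> topspace X \<Longrightarrow> \<exists>a\<in>A. \<exists>x\<in>topspace (Q a). p = r (a, x)"
    and "\<And>V. \<lbrakk>V \<subseteq> topspace X; \<And>a. a \<in> A \<Longrightarrow> closedin (Q a) {x \<in> topspace (Q a). r (a, x) \<in> V}\<rbrakk>
      \<Longrightarrow> closedin X V"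
  shows "quotient_map (sum_topology Q A) X r"
  unfolding quotient_map_closedin
proof (intro conjI allI impI)
  have c: "continuous_map (sum_topology Q A) X r"
    by (rule continuous_map_from_sum_topology) (rule assms)
  show "r ` topspace (sum_topology Q A) = topspace X"
  proof
    show "r ` topspace (sum_topology Q A) \<subseteq> topspace X"
      by (rule continuous_map_image_subset_topspace[OF c])
    show "topspace X \<subseteq> r ` topspace (sum_topology Q A)"
      using assms(2) by fastforce
  qed
  fix V assume V: "V \<subseteq> topspace X"
  show "closedin (sum_topology Q A) {x \<in> topspace (sum_topology Q A). r x \<in> V} = closedin X V"
  proof
    assume "closedin (sum_topology Q A) {x \<in> topspace (sum_topology Q A). r x \<in> V}"
    then have "closedin (Q a) {x \<in> topspace (Q a). r (a, x) \<in> V}" if "a \<in> A" for a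
      using that by (auto simp: closedin_sum_topology)
    then show "closedin X V"
      by (intro assms(3)[OF V]) auto
  qed (rule closedin_continuous_map_preimage[OF c])
qed

text \<open>A product of a quotient map with an identity need not be a quotient map; it is one over
  a locally compact Hausdorff factor (Whitehead). Continuity on \<open>T \<times> X\<close> is
  thereby tested on the products of \<open>T\<close> with the closed cells.\<close>

lemma continuous_map_from_prod_quotient_sum:
  assumes q: "quotient_map (sum_topology Q A) X r"
    and T: "locally_compact_space T" "Hausdorff_space T"
    and k: "\<And>a. a \<in> A \<Longrightarrow> continuous_map (prod_topology T (Q a)) Z (\<lambda>(u, x). k (u, r (a, x)))"
  shows "continuous_map (prod_topology T X) Z k"
proof (rule continuous_compose_quotient_map)
  show "quotient_map (prod_topology T (sum_topology Q A)) (prod_topology T X) (\<lambda>(u, x). (u, r x))"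
    by (rule quotient_map_prod_right) (use assms in auto)
  show "continuous_map (prod_topology T (sum_topology Q A)) Z (k \<circ> (\<lambda>(u, x). (u, r x)))"
    by (rule continuous_map_prod_sum_topology) (use k in \<open>auto simp: case_prod_unfold\<close>)
qed

text \<open>\<open>N\<close> is a radial coordinate on the cell \<open>P\<close> with boundary \<open>N = 1\<close>, and \<open>S x l\<close> divides the
  radius of \<open>x\<close> by \<open>l\<close>. Unlike a homeomorphism with a disc, this structure passes to products.\<close>

definition gauged :: "'p topology \<Rightarrow> ('p \<Rightarrow> real) \<Rightarrow> ('p \<Rightarrow> real \<Rightarrow> 'p) \<Rightarrow> bool" where
  "gauged P N S \<longleftrightarrow>
     continuous_map P euclideanreal N \<and>
     (\<forall>x \<in> topspace P. 0 \<le> N x \<and> N x \<le> 1 \<and> S x 1 = x \<and>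
        (\<forall>l. N x \<le> l \<and> 0 < l \<and> l \<le> 1 \<longrightarrow> N (S x l) = N x / l)) \<and>
     continuous_map (subtopology (prod_topology P euclideanreal)
       {(x, l). N x \<le> l \<and> 0 < l \<and> l \<le> 1}) P (\<lambda>(x, l). S x l)"

text \<open>With the maximum, the boundary of the product is the set where \<open>M u = 1\<close> or
  \<open>N x = 1\<close>: the part over the boundary of \<open>T\<close> together with the part over
  the boundary of the cell. These are the two places where an extension has prescribed
  values.\<close>

lemma gauged_prod:
  assumes T: "gauged T M R" and P: "gauged P N S"
  shows "gauged (prod_topology T P) (\<lambda>(u, x). max (M u) (N x)) (\<lambda>(u, x) l. (R u l, S x l))"
proof -
  have "continuous_map (prod_topology T P) euclideanreal (\<lambda>w. M (fst w))"
    using continuous_map_compose[OF continuous_map_fst, of T euclideanreal M P] T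
    by (simp add: gauged_def o_def)
  moreover have "continuous_map (prod_topology T P) euclideanreal (\<lambda>w. N (snd w))"
    using continuous_map_compose[OF continuous_map_snd, of P euclideanreal N T] P
    by (simp add: gauged_def o_def)
  ultimately have 1: "continuous_map (prod_topology T P) euclideanreal (\<lambda>(u, x). max (M u) (N x))"
    unfolding case_prod_unfold by (rule continuous_map_real_max)
  let ?D = "subtopology (prod_topology (prod_topology T P) euclideanreal)
       {(w, l). (case w of (u, x) \<Rightarrow> max (M u) (N x)) \<le> l \<and> 0 < l \<and> l \<le> 1}"
  have fs: "continuous_map ?D T (\<lambda>w. fst (fst w))" "continuous_map ?D P (\<lambda>w. snd (fst w))"
    "continuous_map ?D euclideanreal (\<lambda>w. snd w)"
    by (intro continuous_map_from_subtopology continuous_map_fst_of continuous_map_snd_of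
        continuous_map_fst continuous_map_snd
        continuous_map_compose[OF continuous_map_fst continuous_map_fst, unfolded o_def]
        continuous_map_compose[OF continuous_map_fst continuous_map_snd, unfolded o_def])+
  have "continuous_map ?D (subtopology (prod_topology T euclideanreal)
       {(x, l). M x \<le> l \<and> 0 < l \<and> l \<le> 1}) (\<lambda>w. (fst (fst w), snd w))"
    using fs by (auto simp: continuous_map_in_subtopology continuous_map_pairwise o_def)
  then have 2: "continuous_map ?D T (\<lambda>w. R (fst (fst w)) (snd w))"
    using continuous_map_compose T unfolding gauged_def o_def by fastforce
  have "continuous_map ?D (subtopology (prod_topology P euclideanreal)
       {(x, l). N x \<le> l \<and> 0 < l \<and> l \<le> 1}) (\<lambda>w. (snd (fst w), snd w))"
    using fs by (auto simp: continuous_map_in_subtopology continuous_map_pairwise o_def)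
  then have 3: "continuous_map ?D P (\<lambda>w. S (snd (fst w)) (snd w))"
    using continuous_map_compose P unfolding gauged_def o_def by fastforce
  have "continuous_map ?D (prod_topology T P) (\<lambda>(w, l). (\<lambda>(u, x) l. (R u l, S x l)) w l)"
    using 2 3 by (simp add: continuous_map_pairwise o_def case_prod_unfold)
  moreover have "max (M u / l) (N x / l) = max (M u) (N x) / l" if "l > 0" for u x l
    using that by (simp add: max_def divide_le_cancel)
  ultimately show ?thesis
    using 1 T P unfolding gauged_def by (auto simp: le_max_iff_disj)
qed

text \<open>In the outer half of the cell a point is projected radially to the boundary and the
  contraction of \<open>Z\<close> is run as the radius shrinks. Radial projection degenerates at the
  centre, so the contraction is completed at radius \<open>1/2\<close> and the inner half is
  constant.\<close>

lemma gauged_extend: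
  assumes g: "gauged P N S" and Z: "contractible_space Z" "topspace Z \<noteq> {}"
    and f: "continuous_map (subtopology P {x. N x = 1}) Z f"
  obtains e where "continuous_map P Z e" "\<And>x. \<lbrakk>x \<in> topspace P; N x = 1\<rbrakk> \<Longrightarrow> e x = f x"
proof -
  obtain z0 h where h: "continuous_map (prod_topology (top_of_set {0..1::real}) Z) Z h"
    and h0: "\<And>z. h (0, z) = z" and h1: "\<And>z. h (1, z) = z0"
    using Z(1) unfolding contractible_space_def homotopic_with_def by auto
  obtain z1 where z1: "z1 \<in> topspace Z"
    using Z(2) by blast
  \<comment> \<open>The end point \<open>z0\<close> is known to lie in \<open>Z\<close> only because
    some point of \<open>Z\<close> is moved there; this is where nonemptiness enters.\<close>
  have z0: "z0 \<in> topspace Z"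
    using continuous_map_image_subset_topspace[OF h] z1 h1[of z1] by fastforce
  have N: "continuous_map P euclideanreal N"
    using g by (simp add: gauged_def)
  have N01: "\<And>x. x \<in> topspace P \<Longrightarrow> 0 \<le> N x \<and> N x \<le> 1"
    using g by (simp add: gauged_def)
  \<comment> \<open>The time \<open>2 - 2 * N x\<close> is \<open>0\<close> on the boundary and
    \<open>1\<close> at radius \<open>1/2\<close>, where both branches give
    \<open>z0\<close>.\<close>
  define e where "e x = (if 1/2 \<le> N x then h (2 - 2 * N x, f (S x (N x))) else z0)" for x
  let ?D = "subtopology P {x \<in> topspace P. 1/2 \<le> N x}"
  have ND: "continuous_map ?D euclideanreal N"
    by (rule continuous_map_from_subtopology[OF N])
  have "continuous_map ?D (subtopology (prod_topology P euclideanreal)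
       {(x, l). N x \<le> l \<and> 0 < l \<and> l \<le> 1}) (\<lambda>x. (x, N x))"
    using ND N01 by (auto simp: continuous_map_in_subtopology continuous_map_pairwise o_def)
  then have S1: "continuous_map ?D P (\<lambda>x. S x (N x))"
    using continuous_map_compose g unfolding gauged_def o_def by fastforce
  have "N (S x (N x)) = 1" if "x \<in> topspace P" "1/2 \<le> N x" for x
  proof -
    have "N (S x (N x)) = N x / N x"
      using g that unfolding gauged_def by auto
    then show ?thesis using that by simp
  qed
  then have "continuous_map ?D (subtopology P {x. N x = 1}) (\<lambda>x. S x (N x))"
    using S1 by (auto simp: continuous_map_in_subtopology)
  then have fS: "continuous_map ?D Z (\<lambda>x. f (S x (N x)))"
    using continuous_map_compose f unfolding o_def by fastforce
  have "continuous_map ?D (top_of_set {0..1}) (\<lambda>x. 2 - 2 * N x)"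
    using ND N01 by (auto simp: continuous_map_in_subtopology intro!: continuous_intros)
  then have "continuous_map ?D (prod_topology (top_of_set {0..1}) Z) (\<lambda>x. (2 - 2 * N x, f (S x (N x))))"
    using fS by (simp add: continuous_map_pairwise o_def)
  then have hD: "continuous_map ?D Z (\<lambda>x. h (2 - 2 * N x, f (S x (N x))))"
    using continuous_map_compose h unfolding o_def by fastforce
  have "continuous_map P Z e"
    unfolding e_def
  proof (rule continuous_map_cases_le)
    show "h (2 - 2 * N x, f (S x (N x))) = z0" if "1/2 = N x" for x
      using h1 by (simp flip: that)
  qed (use N hD z0 in auto)
  moreover have "e x = f x" if "x \<in> topspace P" "N x = 1" for x
    using that g h0 by (simp add: e_def gauged_def)
  ultimately show ?thesis
    by (rule that)
qed

section \<open>Equivariant extension over a cellular \<open>G\<close>-space\<close>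

text \<open>\<open>group_action\<close> makes every translation extensional on the set acted upon.
  Here the laws are required on \<open>topspace Y\<close> only, which also suits
  \<open>XE_act\<close>, a map defined by choosing representatives.\<close>

definition cts_action ::
  "('g, 'b) monoid_scheme \<Rightarrow> 'y topology \<Rightarrow> ('g \<Rightarrow> 'y \<Rightarrow> 'y) \<Rightarrow> bool" where
  "cts_action G Y \<phi> \<longleftrightarrow>
     (\<forall>g \<in> carrier G. continuous_map Y Y (\<phi> g)) \<and>
     (\<forall>y \<in> topspace Y. \<phi> \<one>\<^bsub>G\<^esub> y = y \<and>
        (\<forall>g \<in> carrier G. \<forall>h \<in> carrier G. \<phi> (g \<otimes>\<^bsub>G\<^esub> h) y = \<phi> g (\<phi> h y)))"

lemma cts_actionD:
  assumes "cts_action G Y \<phi>"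
  shows "\<And>g. g \<in> carrier G \<Longrightarrow> continuous_map Y Y (\<phi> g)"
    and "\<And>g y. \<lbrakk>g \<in> carrier G; y \<in> topspace Y\<rbrakk> \<Longrightarrow> \<phi> g y \<in> topspace Y"
    and "\<And>y. y \<in> topspace Y \<Longrightarrow> \<phi> \<one>\<^bsub>G\<^esub> y = y"
    and "\<And>g h y. \<lbrakk>g \<in> carrier G; h \<in> carrier G; y \<in> topspace Y\<rbrakk> \<Longrightarrow> \<phi> (g \<otimes>\<^bsub>G\<^esub> h) y = \<phi> g (\<phi> h y)"
  using assms continuous_map_image_subset_topspace unfolding cts_action_def by fastforce+

text \<open>The common interface for \<open>Y\<close> and \<open>|E|\<close>. An equivariant cell of
  type \<open>G/H\<close> is listed as one cell per coset, permuted by \<open>\<psi>\<close>; by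
  \<open>cell_equivariant\<close>, a group element that fixes an index fixes the image of that cell
  pointwise. Attaching maps are not recorded: \<open>cell_boundary\<close> only places boundary
  points in open cells of lower dimension, and the last two assumptions supply the topology.\<close>

locale cellular_G_space = group G for G :: "('g, 'b) monoid_scheme" (structure) +
  fixes X :: "'x topology" and \<phi> :: "'g \<Rightarrow> 'x \<Rightarrow> 'x"
    and I :: "nat \<Rightarrow> 'i set" and \<psi> :: "nat \<Rightarrow> 'g \<Rightarrow> 'i \<Rightarrow> 'i"
    and P :: "nat \<Rightarrow> 'p topology" and N :: "nat \<Rightarrow> 'p \<Rightarrow> real" and S :: "nat \<Rightarrow> 'p \<Rightarrow> real \<Rightarrow> 'p"
    and q :: "nat \<Rightarrow> 'i \<Rightarrow> 'p \<Rightarrow> 'x"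
  assumes action: "cts_action G X \<phi>"
    and index_closed: "\<lbrakk>i \<in> I n; g \<in> carrier G\<rbrakk> \<Longrightarrow> \<psi> n g i \<in> I n"
    and index_one: "i \<in> I n \<Longrightarrow> \<psi> n \<one> i = i"
    and index_mult: "\<lbrakk>i \<in> I n; g \<in> carrier G; h \<in> carrier G\<rbrakk> \<Longrightarrow> \<psi> n (g \<otimes> h) i = \<psi> n g (\<psi> n h i)"
    and gauged: "gauged (P n) (N n) (S n)"
    and cell_continuous: "i \<in> I n \<Longrightarrow> continuous_map (P n) X (q n i)"
    and cell_equivariant: "\<lbrakk>i \<in> I n; g \<in> carrier G; x \<in> topspace (P n)\<rbrakk>
      \<Longrightarrow> q n (\<psi> n g i) x = \<phi> g (q n i x)"
    and cell_cover: "p \<in> topspace X \<Longrightarrow> \<exists>n. \<exists>i\<in>I n. \<exists>x\<in>topspace (P n). N n x < 1 \<and> p = q n i x"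
    and cell_unique: "\<lbrakk>i \<in> I n; x \<in> topspace (P n); N n x < 1; j \<in> I m; y \<in> topspace (P m); N m y < 1;
      q n i x = q m j y\<rbrakk> \<Longrightarrow> (n, i, x) = (m, j, y)"
    and cell_boundary: "\<lbrakk>i \<in> I n; x \<in> topspace (P n); N n x = 1\<rbrakk>
      \<Longrightarrow> \<exists>m<n. \<exists>j\<in>I m. \<exists>y\<in>topspace (P m). N m y < 1 \<and> q n i x = q m j y"
    and closed_skeleton: "\<lbrakk>V \<subseteq> (\<Union>m<n. \<Union>i\<in>I m. q m i ` topspace (P m));
      \<And>m i. \<lbrakk>m < n; i \<in> I m\<rbrakk> \<Longrightarrow> closedin (P m) {x \<in> topspace (P m). q m i x \<in> V}\<rbrakk>
      \<Longrightarrow> closedin X V"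
    and closed_total: "\<lbrakk>V \<subseteq> topspace X;
      \<And>m i. i \<in> I m \<Longrightarrow> closedin (P m) {x \<in> topspace (P m). q m i x \<in> V}\<rbrakk>
      \<Longrightarrow> closedin X V"
begin

definition dim :: "'x \<Rightarrow> nat" where
  "dim p = (THE n. \<exists>i\<in>I n. \<exists>x\<in>topspace (P n). N n x < 1 \<and> p = q n i x)"

text \<open>The strict inequality shifts the index by one, so that \<open>sk 0\<close> is empty and
  the induction over skeleta starts from nothing.\<close>

definition sk :: "nat \<Rightarrow> 'x set" where
  "sk n = {p \<in> topspace X. dim p < n}"

lemma cell_in: "\<lbrakk>i \<in> I n; x \<in> topspace (P n)\<rbrakk> \<Longrightarrow> q n i x \<in> topspace X"
  using continuous_map_image_subset_topspace[OF cell_continuous] by blast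

lemma gauge_le_1: "x \<in> topspace (P n) \<Longrightarrow> N n x \<le> 1"
  using gauged[of n] by (simp add: gauged_def)

lemma dim_interior:
  assumes "i \<in> I n" "x \<in> topspace (P n)" "N n x < 1"
  shows "dim (q n i x) = n"
  unfolding dim_def
proof (rule the_equality)
  show "\<exists>j\<in>I n. \<exists>y\<in>topspace (P n). N n y < 1 \<and> q n i x = q n j y"
    using assms by blast
qed (use assms cell_unique in blast)

lemma sk_boundary: "\<lbrakk>i \<in> I n; x \<in> topspace (P n); N n x = 1\<rbrakk> \<Longrightarrow> q n i x \<in> sk n"
  using cell_boundary[of i n x] cell_in[of i n x] by (auto simp: sk_def dim_interior)

lemma sk_interior: "\<lbrakk>i \<in> I n; x \<in> topspace (P n); N n x < 1\<rbrakk> \<Longrightarrow> q n i x \<in> sk m \<longleftrightarrow> n < m"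
  using cell_in[of i n x] by (auto simp: sk_def dim_interior)

lemma sk_mono: "m \<le> n \<Longrightarrow> sk m \<subseteq> sk n"
  by (auto simp: sk_def)

lemma sk_cell: 
  assumes "i \<in> I n" "x \<in> topspace (P n)" "n < m"
  shows "q n i x \<in> sk m"
proof (cases "N n x < 1")
  case False
  then show ?thesis
    using assms sk_boundary[of i n x] gauge_le_1[of x n] sk_mono[of n m] by fastforce
qed (use assms sk_interior in blast)

lemma sk_cell_cover:
  assumes "p \<in> sk n"
  obtains m i x where "m < n" "i \<in> I m" "x \<in> topspace (P m)" "N m x < 1" "p = q m i x"
proof -
  have p: "p \<in> topspace X" "dim p < n"
    using assms by (auto simp: sk_def)
  obtain m i x where "i \<in> I m" "x \<in> topspace (P m)" "N m x < 1" "p = q m i x"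
    using cell_cover[OF p(1)] by blast
  then show ?thesis
    using that[of m i x] dim_interior[of i m x] p(2) by simp
qed

lemma sk_act:
  assumes "p \<in> sk n" "g \<in> carrier G"
  shows "\<phi> g p \<in> sk n"
proof -
  obtain m i x where m: "m < n" "i \<in> I m" "x \<in> topspace (P m)" "N m x < 1" "p = q m i x"
    using sk_cell_cover[OF assms(1)] .
  then show ?thesis
    using sk_interior[OF index_closed[of i m g], of x n] cell_equivariant[of i m g x] assms(2) by simp
qed

lemma quotient_map_skeleton:
  "quotient_map (sum_topology (\<lambda>(m, i). P m) (SIGMA m:{..<n}. I m)) (subtopology X (sk n))
     (\<lambda>((m, i), x). q m i x)"
proof (rule quotient_map_from_sum_topology)
  show "continuous_map ((\<lambda>(m, i). P m) a) (subtopology X (sk n)) (\<lambda>x. (\<lambda>((m, i), x). q m i x) (a, x))"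
    if "a \<in> (SIGMA m:{..<n}. I m)" for a
    using that cell_continuous sk_cell by (auto simp: continuous_map_in_subtopology)
  show "\<exists>a\<in>SIGMA m:{..<n}. I m. \<exists>x\<in>topspace ((\<lambda>(m, i). P m) a). p = (\<lambda>((m, i), x). q m i x) (a, x)"
    if "p \<in> topspace (subtopology X (sk n))" for p
  proof -
    have "p \<in> sk n" using that by simp
    then obtain m i x where "m < n" "i \<in> I m" "x \<in> topspace (P m)" "p = q m i x"
      by (rule sk_cell_cover)
    then show ?thesis
      by (intro bexI[of _ "(m, i)"] bexI[of _ x]) auto
  qed
next
  fix V
  assume V: "V \<subseteq> topspace (subtopology X (sk n))"
    and c: "\<And>a. a \<in> (SIGMA m:{..<n}. I m) \<Longrightarrow> closedin ((\<lambda>(m, i). P m) a)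
      {x \<in> topspace ((\<lambda>(m, i). P m) a). (\<lambda>((m, i), x). q m i x) (a, x) \<in> V}"
  have "V \<subseteq> (\<Union>m<n. \<Union>i\<in>I m. q m i ` topspace (P m))"
  proof
    fix p assume "p \<in> V"
    then have "p \<in> sk n" using V by auto
    then obtain m i x where "m < n" "i \<in> I m" "x \<in> topspace (P m)" "p = q m i x"
      by (rule sk_cell_cover)
    then show "p \<in> (\<Union>m<n. \<Union>i\<in>I m. q m i ` topspace (P m))"
      by blast
  qed
  moreover have "closedin (P m) {x \<in> topspace (P m). q m i x \<in> V}" if "m < n" "i \<in> I m" for m i
    using c[of "(m, i)"] that by simp
  ultimately have "closedin X V"
    by (rule closed_skeleton)
  then show "closedin (subtopology X (sk n)) V"
    using V by (auto simp: closedin_subtopology)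
qed

lemma quotient_map_cells:
  "quotient_map (sum_topology (\<lambda>(m, i). P m) (SIGMA m:UNIV. I m)) X (\<lambda>((m, i), x). q m i x)"
proof (rule quotient_map_from_sum_topology)
  show "\<exists>a\<in>SIGMA m:UNIV. I m. \<exists>x\<in>topspace ((\<lambda>(m, i). P m) a). p = (\<lambda>((m, i), x). q m i x) (a, x)"
    if p: "p \<in> topspace X" for p
  proof -
    obtain m i x where "i \<in> I m" "x \<in> topspace (P m)" "p = q m i x"
      using cell_cover[OF p] by blast
    then show ?thesis
      by (intro bexI[of _ "(m, i)"] bexI[of _ x]) auto
  qed
  show "closedin X V" if "V \<subseteq> topspace X" "\<And>a. a \<in> (SIGMA m:UNIV. I m) \<Longrightarrow> closedin ((\<lambda>(m, i). P m) a)
      {x \<in> topspace ((\<lambda>(m, i). P m) a). (\<lambda>((m, i), x). q m i x) (a, x) \<in> V}" for V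
    using that(2)[of "(m, i)" for m i] by (intro closed_total[OF that(1)]) auto
qed (use cell_continuous in auto)

end

text \<open>The parameter space \<open>T\<close> allows one theorem to serve twice: a point, with
  nothing prescribed, gives existence of equivariant maps; the interval, with \<open>M u = 1\<close>
  at its ends, gives equivariant homotopies between any two of them.\<close>

locale G_extension = cellular_G_space G X \<phi> I \<psi> P N S q
  for G :: "('g, 'b) monoid_scheme" (structure) and X :: "'x topology" and \<phi> I \<psi>
    and P :: "nat \<Rightarrow> 'p topology" and N S q +
  fixes T :: "'t topology" and M :: "'t \<Rightarrow> real" and R :: "'t \<Rightarrow> real \<Rightarrow> 't"
    and Z :: "'z topology" and \<zeta> :: "'g \<Rightarrow> 'z \<Rightarrow> 'z" and f :: "'t \<times> 'x \<Rightarrow> 'z"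
  assumes target_action: "cts_action G Z \<zeta>"
    and fixed: "i \<in> I n \<Longrightarrow> fixed_points Z \<zeta> {g \<in> carrier G. \<psi> n g i = i} \<noteq> {} \<and>
      contractible_space (subtopology Z (fixed_points Z \<zeta> {g \<in> carrier G. \<psi> n g i = i}))"
    and gauged_T: "gauged T M R"
    and lc_T: "locally_compact_space T" and haus_T: "Hausdorff_space T"
    and f_continuous: "continuous_map (prod_topology (subtopology T {u. M u = 1}) X) Z f"
    and f_equivariant: "\<lbrakk>u \<in> topspace T; M u = 1; p \<in> topspace X; g \<in> carrier G\<rbrakk>
      \<Longrightarrow> f (u, \<phi> g p) = \<zeta> g (f (u, p))"
begin

lemmas targetD = cts_actionD[OF target_action]

definition partial_ext :: "nat \<Rightarrow> ('t \<times> 'x \<Rightarrow> 'z) \<Rightarrow> bool" where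
  "partial_ext n h \<longleftrightarrow>
     continuous_map (prod_topology T (subtopology X (sk n))) Z h \<and>
     (\<forall>u\<in>topspace T. \<forall>p\<in>sk n.
        (\<forall>g\<in>carrier G. h (u, \<phi> g p) = \<zeta> g (h (u, p))) \<and> (M u = 1 \<longrightarrow> h (u, p) = f (u, p)))"

text \<open>Group elements that fix the index fix the points of the cell, so by equivariance the
  prescribed boundary values are fixed by them. The extension problem thus takes place in a fixed
  set of \<open>Z\<close>, which is contractible.\<close>

lemma cell_extension:
  assumes h: "partial_ext n h" and i: "i \<in> I n"
  shows "\<exists>e. continuous_map (prod_topology T (P n))
      (subtopology Z (fixed_points Z \<zeta> {g \<in> carrier G. \<psi> n g i = i})) e \<and>
    (\<forall>u\<in>topspace T. \<forall>x\<in>topspace (P n).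
       (N n x = 1 \<longrightarrow> e (u, x) = h (u, q n i x)) \<and> (M u = 1 \<longrightarrow> e (u, x) = f (u, q n i x)))"
proof -
  let ?F = "fixed_points Z \<zeta> {g \<in> carrier G. \<psi> n g i = i}"
  let ?TP = "prod_topology T (P n)"
  let ?D = "subtopology ?TP {w. (\<lambda>(u, x). max (M u) (N n x)) w = 1}"
  \<comment> \<open>On \<open>?D\<close> the larger of the two gauges is \<open>1\<close>. If it is
    \<open>M\<close>, then \<open>f\<close> is prescribed; otherwise the cell coordinate is on the
    boundary, where \<open>h\<close> is defined. On the overlap \<open>M = N = 1\<close> the two
    agree.\<close>
  define b where "b w = (if N n (snd w) \<le> M (fst w)
    then f (fst w, q n i (snd w)) else h (fst w, q n i (snd w)))" for w
  have M: "continuous_map T euclideanreal M" and N: "continuous_map (P n) euclideanreal (N n)"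
    using gauged_T gauged[of n] by (auto simp: gauged_def)
  have le1: "\<And>u. u \<in> topspace T \<Longrightarrow> M u \<le> 1" 
    using gauged_T by (auto simp: gauged_def)
  have cfst: "continuous_map ?D T fst" and csnd: "continuous_map ?D (P n) snd"
    by (intro continuous_map_from_subtopology continuous_map_fst continuous_map_snd)+
  have cq: "continuous_map ?D X (\<lambda>w. q n i (snd w))"
    using continuous_map_compose[OF csnd cell_continuous[OF i]] by (simp add: o_def)
  have hf: "h (fst w, q n i (snd w)) = f (fst w, q n i (snd w))"
    if "w \<in> topspace ?D" "N n (snd w) = M (fst w)" for w
    using that h sk_boundary[OF i, of "snd w"] by (auto simp: partial_ext_def)
  have "continuous_map ?D Z b"
    unfolding b_def
  proof (rule continuous_map_cases_le)
    show "continuous_map ?D euclideanreal (\<lambda>w. N n (snd w))"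
      using continuous_map_compose[OF csnd N] by (simp add: o_def)
    show "continuous_map ?D euclideanreal (\<lambda>w. M (fst w))"
      using continuous_map_compose[OF cfst M] by (simp add: o_def)
    have "continuous_map (subtopology ?D {w \<in> topspace ?D. N n (snd w) \<le> M (fst w)})
       (prod_topology (subtopology T {u. M u = 1}) X) (\<lambda>w. (fst w, q n i (snd w)))"
      using cq cfst by (auto simp: continuous_map_pairwise o_def continuous_map_in_subtopology
          intro!: continuous_map_from_subtopology split: prod.splits)
    then show "continuous_map (subtopology ?D {w \<in> topspace ?D. N n (snd w) \<le> M (fst w)}) Z
       (\<lambda>w. f (fst w, q n i (snd w)))"
      using continuous_map_compose[OF _ f_continuous] by (fastforce simp: o_def)
    have "continuous_map (subtopology ?D {w \<in> topspace ?D. M (fst w) \<le> N n (snd w)})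
       (prod_topology T (subtopology X (sk n))) (\<lambda>w. (fst w, q n i (snd w)))"
      using cq cfst sk_boundary[OF i] by (auto simp: continuous_map_pairwise o_def continuous_map_in_subtopology
          intro!: continuous_map_from_subtopology split: prod.splits)
    then show "continuous_map (subtopology ?D {w \<in> topspace ?D. M (fst w) \<le> N n (snd w)}) Z
       (\<lambda>w. h (fst w, q n i (snd w)))"
      using continuous_map_compose h by (fastforce simp: o_def partial_ext_def)
  qed (use hf in auto)
  moreover have "b w \<in> ?F" if w: "w \<in> topspace ?D" for w
  proof -
    obtain u x where ux: "w = (u, x)" "u \<in> topspace T" "x \<in> topspace (P n)" "max (M u) (N n x) = 1"
      using w by auto
    have bZ: "b w \<in> topspace Z"
      using continuous_map_image_subset_topspace[OF \<open>continuous_map ?D Z b\<close>] w by blast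
    have "\<zeta> g (b w) = b w" if g: "g \<in> carrier G" "\<psi> n g i = i" for g
    proof -
      have qg: "\<phi> g (q n i x) = q n i x"
        using cell_equivariant[OF i g(1) ux(3)] g(2) by simp
      show ?thesis
      proof (cases "N n x \<le> M u")
        case True
        then show ?thesis
          using f_equivariant[OF ux(2) _ cell_in[OF i ux(3)] g(1)] ux(1,4) qg by (simp add: b_def)
      next
        case False
        then have "q n i x \<in> sk n"
          using ux sk_boundary[OF i] by (auto simp: max_def split: if_splits)
        then have "h (u, \<phi> g (q n i x)) = \<zeta> g (h (u, q n i x))"
          using h ux(2) g(1) unfolding partial_ext_def by blast
        then show ?thesis
          using False ux(1) qg by (simp add: b_def)
      qed
    qed
    then show ?thesis
      using bZ by (simp add: fixed_points_def)
  qed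
  ultimately have b: "continuous_map ?D (subtopology Z ?F) b"
    by (auto simp: continuous_map_in_subtopology)
  have "?F \<subseteq> topspace Z" by (auto simp: fixed_points_def)
  then have F: "contractible_space (subtopology Z ?F)" "topspace (subtopology Z ?F) \<noteq> {}"
    using fixed[OF i] by auto
  obtain e where e: "continuous_map ?TP (subtopology Z ?F) e"
    "\<And>w. \<lbrakk>w \<in> topspace ?TP; (\<lambda>(u, x). max (M u) (N n x)) w = 1\<rbrakk> \<Longrightarrow> e w = b w"
    using gauged_extend[OF gauged_prod[OF gauged_T gauged] F b] by blast
  have "e (u, x) = h (u, q n i x)" if "u \<in> topspace T" "x \<in> topspace (P n)" "N n x = 1" for u x
    using e(2)[of "(u, x)"] hf[of "(u, x)"] that le1[of u] by (auto simp: b_def)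
  moreover have "e (u, x) = f (u, q n i x)" if "u \<in> topspace T" "x \<in> topspace (P n)" "M u = 1" for u x
    using e(2)[of "(u, x)"] that gauge_le_1[of x n] by (auto simp: b_def)
  ultimately show ?thesis
    using e(1) by blast
qed

text \<open>An extension is chosen on one cell of each orbit and transported to the others. The
  transport is consistent because the chosen extension takes values fixed by the stabilizer of its
  cell.\<close>

lemma partial_ext_Suc:
  assumes h: "partial_ext n h"
  shows "\<exists>h'. partial_ext (Suc n) h' \<and> (\<forall>u\<in>topspace T. \<forall>p\<in>sk n. h' (u, p) = h (u, p))"
proof -
  let ?TP = "prod_topology T (P n)"
  let ?Q = "\<lambda>i e. continuous_map ?TP
      (subtopology Z (fixed_points Z \<zeta> {g \<in> carrier G. \<psi> n g i = i})) e \<and>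
    (\<forall>u\<in>topspace T. \<forall>x\<in>topspace (P n).
       (N n x = 1 \<longrightarrow> e (u, x) = h (u, q n i x)) \<and> (M u = 1 \<longrightarrow> e (u, x) = f (u, q n i x)))"
  have "\<forall>i\<in>I n. \<exists>e. ?Q i e"
    using cell_extension[OF h] by blast
  then obtain E where E0: "\<forall>i\<in>I n. ?Q i (E i)"
    by (rule bchoice[THEN exE])
  have E: "\<And>i. i \<in> I n \<Longrightarrow> continuous_map ?TP
      (subtopology Z (fixed_points Z \<zeta> {g \<in> carrier G. \<psi> n g i = i})) (E i)"
    "\<And>i u x. \<lbrakk>i \<in> I n; u \<in> topspace T; x \<in> topspace (P n); N n x = 1\<rbrakk> \<Longrightarrow> E i (u, x) = h (u, q n i x)"
    "\<And>i u x. \<lbrakk>i \<in> I n; u \<in> topspace T; x \<in> topspace (P n); M u = 1\<rbrakk> \<Longrightarrow> E i (u, x) = f (u, q n i x)"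
    using E0 by simp_all
  \<comment> \<open>The predicate under \<open>SOME\<close> depends only on the orbit of
    \<open>i\<close>, hence so does \<open>rep\<close>; \<open>rep_act\<close> records this.\<close>
  define rep where "rep i = (SOME j. \<exists>g\<in>carrier G. j = \<psi> n g i)" for i
  have rep: "\<exists>g\<in>carrier G. rep i = \<psi> n g i" for i
    unfolding rep_def by (rule someI[of _ "\<psi> n \<one> i"]) auto
  have rep_in: "rep i \<in> I n" if "i \<in> I n" for i
    using rep[of i] index_closed[OF that] by auto
  have rep_act: "rep (\<psi> n g i) = rep i" if i: "i \<in> I n" and g: "g \<in> carrier G" for g i
  proof -
    have "(\<exists>k\<in>carrier G. j = \<psi> n k (\<psi> n g i)) \<longleftrightarrow> (\<exists>k\<in>carrier G. j = \<psi> n k i)" for j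
    proof
      assume "\<exists>k\<in>carrier G. j = \<psi> n k (\<psi> n g i)"
      then show "\<exists>k\<in>carrier G. j = \<psi> n k i"
        using index_mult[OF i _ g] g by (metis m_closed)
    next
      assume "\<exists>k\<in>carrier G. j = \<psi> n k i"
      then obtain k where k: "k \<in> carrier G" "j = \<psi> n k i" by blast
      have "\<psi> n (k \<otimes> inv g) (\<psi> n g i) = \<psi> n (k \<otimes> inv g \<otimes> g) i"
        using k g by (simp add: index_mult[OF i])
      then have "j = \<psi> n (k \<otimes> inv g) (\<psi> n g i)"
        using k g by (simp add: m_assoc)
      then show "\<exists>k\<in>carrier G. j = \<psi> n k (\<psi> n g i)"
        using k g by blast
    qed
    then show ?thesis by (simp add: rep_def)
  qed
  have "\<exists>g\<in>carrier G. i = \<psi> n g (rep i)" if i: "i \<in> I n" for i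
  proof -
    obtain g where g: "g \<in> carrier G" "rep i = \<psi> n g i" using rep by blast
    then have "\<psi> n (inv g) (rep i) = i"
      using index_mult[OF i, of "inv g" g] index_one[OF i] by simp
    then show ?thesis
      using inv_closed[OF g(1)] by metis
  qed
  then obtain \<gamma> where \<gamma>: "\<And>i. i \<in> I n \<Longrightarrow> \<gamma> i \<in> carrier G \<and> i = \<psi> n (\<gamma> i) (rep i)"
    by metis
  define e where "e i w = \<zeta> (\<gamma> i) (E (rep i) w)" for i w
  have E_in: "E j w \<in> fixed_points Z \<zeta> {g \<in> carrier G. \<psi> n g j = j}"
    if "j \<in> I n" "w \<in> topspace ?TP" for j w
    using continuous_map_image_subset_topspace[OF E(1)[OF that(1)]] that(2) by auto
  have E_inZ: "E j w \<in> topspace Z" if "j \<in> I n" "w \<in> topspace ?TP" for j w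
    using E_in[OF that] by (simp add: fixed_points_def)
  have e_cont: "continuous_map ?TP Z (e i)" if i: "i \<in> I n" for i
    using continuous_map_compose[OF _ targetD(1)] E(1)[OF rep_in[OF i]] \<gamma>[OF i]
    by (fastforce simp: e_def[abs_def] o_def continuous_map_in_subtopology)
  have q_rep: "q n i x = \<phi> (\<gamma> i) (q n (rep i) x)" if "i \<in> I n" "x \<in> topspace (P n)" for i x
    using cell_equivariant[OF rep_in[OF that(1)], of "\<gamma> i" x] \<gamma>[OF that(1)] that by simp
  have e_bd: "e i (u, x) = h (u, q n i x)"
    if "i \<in> I n" "u \<in> topspace T" "x \<in> topspace (P n)" "N n x = 1" for i u x
    using that E(2)[OF rep_in] q_rep h \<gamma>[OF that(1)] sk_boundary[OF rep_in]
    by (auto simp: e_def partial_ext_def)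
  have e_f: "e i (u, x) = f (u, q n i x)"
    if "i \<in> I n" "u \<in> topspace T" "x \<in> topspace (P n)" "M u = 1" for i u x
    using that E(3)[OF rep_in] q_rep \<gamma>[OF that(1)] f_equivariant cell_in[OF rep_in]
    by (auto simp: e_def)
  have e_act: "e (\<psi> n g i) w = \<zeta> g (e i w)"
    if i: "i \<in> I n" and g: "g \<in> carrier G" and w: "w \<in> topspace ?TP" for g i w
  proof -
    let ?j = "rep i" and ?i' = "\<psi> n g i"
    \<comment> \<open>\<open>k\<close> measures the difference between the two translations from
      \<open>rep i\<close> to the cell \<open>\<psi> n g i\<close>. It stabilizes
      \<open>rep i\<close>, so it acts trivially on the values of \<open>E (rep i)\<close>, and the
      arbitrary choice of \<open>\<gamma>\<close> does no harm.\<close>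
    define k where "k = inv (\<gamma> ?i') \<otimes> (g \<otimes> \<gamma> i)"
    have i': "?i' \<in> I n" and j: "?j \<in> I n"
      using index_closed[OF i g] rep_in[OF i] by auto
    have c: "\<gamma> i \<in> carrier G" "\<gamma> ?i' \<in> carrier G"
      using \<gamma>[OF i] \<gamma>[OF i'] by auto
    have kc: "k \<in> carrier G" and k: "\<gamma> ?i' \<otimes> k = g \<otimes> \<gamma> i"
      using c g by (auto simp: k_def m_assoc[symmetric])
    have "\<psi> n (g \<otimes> \<gamma> i) ?j = ?i'"
      using index_mult[OF j g c(1)] \<gamma>[OF i] by simp
    moreover have "\<psi> n (\<gamma> ?i') ?j = ?i'"
      using \<gamma>[OF i'] rep_act[OF i g] by simp
    moreover have "\<psi> n k ?j = \<psi> n (inv (\<gamma> ?i')) (\<psi> n (g \<otimes> \<gamma> i) ?j)"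
      unfolding k_def using c g by (simp add: index_mult[OF j])
    moreover have "\<psi> n (inv (\<gamma> ?i')) (\<psi> n (\<gamma> ?i') ?j) = ?j"
      using index_mult[OF j, of "inv (\<gamma> ?i')" "\<gamma> ?i'"] c index_one[OF j] by simp
    ultimately have "\<psi> n k ?j = ?j" by simp
    then have "\<zeta> k (E ?j w) = E ?j w"
      using E_in[OF j w] kc by (simp add: fixed_points_def)
    then have "\<zeta> (\<gamma> ?i') (E ?j w) = \<zeta> (g \<otimes> \<gamma> i) (E ?j w)"
      using targetD(4)[OF c(2) kc E_inZ[OF j w]] by (simp add: k)
    then show ?thesis
      using targetD(4)[OF g c(1) E_inZ[OF j w]] rep_act[OF i g] by (simp add: e_def)
  qed
  \<comment> \<open>For a new point, the pair under \<open>SOME\<close> is unique by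
    \<open>cell_unique\<close>. On the boundary of a new cell the first branch applies, and
    \<open>e_bd\<close> makes it agree with \<open>e i\<close>.\<close>
  define h' where "h' = (\<lambda>(u, p). if p \<in> sk n then h (u, p) else
    (case SOME (i, x). i \<in> I n \<and> x \<in> topspace (P n) \<and> N n x < 1 \<and> p = q n i x of (i, x) \<Rightarrow> e i (u, x)))"
  have h'_old: "h' (u, p) = h (u, p)" if "p \<in> sk n" for u p
    using that by (simp add: h'_def)
  have h'_new: "h' (u, q n i x) = e i (u, x)"
    if "u \<in> topspace T" "i \<in> I n" "x \<in> topspace (P n)" for u i x
  proof (cases "N n x < 1")
    case True
    have "(SOME (j, y). j \<in> I n \<and> y \<in> topspace (P n) \<and> N n y < 1 \<and> q n i x = q n j y) = (i, x)"
      by (rule some_equality) (use True that cell_unique in \<open>auto split: prod.splits\<close>)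
    moreover have "q n i x \<notin> sk n"
      using True sk_interior that by blast
    ultimately show ?thesis by (simp add: h'_def)
  next
    case False
    then have "N n x = 1" using gauge_le_1[OF that(3)] by simp
    then show ?thesis
      using h'_old[OF sk_boundary[OF that(2,3)]] e_bd[OF that(2,1,3)] by simp
  qed
  have "partial_ext (Suc n) h'"
    unfolding partial_ext_def
  proof (intro conjI ballI impI)
    show "continuous_map (prod_topology T (subtopology X (sk (Suc n)))) Z h'"
    proof (rule continuous_map_from_prod_quotient_sum[OF quotient_map_skeleton lc_T haus_T])
      fix a assume "a \<in> (SIGMA m:{..<Suc n}. I m)"
      then obtain m i where a: "a = (m, i)" "m \<le> n" "i \<in> I m"
        by (auto simp: less_Suc_eq_le)
      have "continuous_map (prod_topology T (P m)) Z (\<lambda>(u, x). h' (u, q m i x))"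
      proof (cases "m = n")
        case True
        then show ?thesis
          using e_cont[of i] h'_new a by (auto intro: continuous_map_eq)
      next
        case False
        then have m: "m < n" using a by simp
        have "continuous_map (prod_topology T (P m)) X (\<lambda>w. q m i (snd w))"
          using continuous_map_compose[OF continuous_map_snd cell_continuous[OF a(3)]] by (simp add: o_def)
        then have "continuous_map (prod_topology T (P m)) (prod_topology T (subtopology X (sk n)))
            (\<lambda>w. (fst w, q m i (snd w)))"
          using sk_cell[OF a(3) _ m]
          by (auto simp: continuous_map_pairwise o_def continuous_map_in_subtopology continuous_map_fst)
        moreover have "continuous_map (prod_topology T (subtopology X (sk n))) Z h"
          using h by (simp add: partial_ext_def)
        ultimately have "continuous_map (prod_topology T (P m)) Z (h \<circ> (\<lambda>w. (fst w, q m i (snd w))))"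
          by (rule continuous_map_compose)
        then show ?thesis
          using h'_old[OF sk_cell[OF a(3) _ m]] by (auto intro: continuous_map_eq)
      qed
      then show "continuous_map (prod_topology T ((\<lambda>(m, i). P m) a)) Z
          (\<lambda>(u, x). h' (u, (\<lambda>((m, i), x). q m i x) (a, x)))"
        using a by simp
    qed
  next
    fix u p g assume u: "u \<in> topspace T" and p: "p \<in> sk (Suc n)" and g: "g \<in> carrier G"
    show "h' (u, \<phi> g p) = \<zeta> g (h' (u, p))"
    proof (cases "p \<in> sk n")
      case True
      then show ?thesis
        using h'_old sk_act[OF True g] h u g by (auto simp: partial_ext_def)
    next
      case False
      obtain m i x where mix: "m < Suc n" "i \<in> I m" "x \<in> topspace (P m)" "N m x < 1" "p = q m i x"
        by (rule sk_cell_cover[OF p])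
      with False have "m = n" using sk_cell[of i m x n] by (cases "m < n") auto
      then show ?thesis
        using mix h'_new[OF u] cell_equivariant[of i n g x, symmetric] index_closed[of i n g] g
          e_act[of i g "(u, x)"] u by auto
    qed
  next
    fix u p assume u: "u \<in> topspace T" and p: "p \<in> sk (Suc n)" and M: "M u = 1"
    show "h' (u, p) = f (u, p)"
    proof (cases "p \<in> sk n")
      case True
      then show ?thesis
        using h'_old h u M by (auto simp: partial_ext_def)
    next
      case False
      obtain m i x where mix: "m < Suc n" "i \<in> I m" "x \<in> topspace (P m)" "N m x < 1" "p = q m i x"
        by (rule sk_cell_cover[OF p])
      with False have "m = n" using sk_cell[of i m x n] by (cases "m < n") auto
      then show ?thesis
        using mix h'_new[OF u] e_f[OF _ u _ M] by auto
    qed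
  qed
  then show ?thesis using h'_old by blast
qed

lemma equivariant_extension:
  "\<exists>F. continuous_map (prod_topology T X) Z F \<and>
    (\<forall>u\<in>topspace T. \<forall>p\<in>topspace X. (\<forall>g\<in>carrier G. F (u, \<phi> g p) = \<zeta> g (F (u, p))) \<and>
      (M u = 1 \<longrightarrow> F (u, p) = f (u, p)))"
proof -
  have "sk 0 = {}" by (auto simp: sk_def)
  \<comment> \<open>Over the empty skeleton any function will do; \<open>f\<close> merely has the
    right type.\<close>
  then have "partial_ext 0 f"
    by (auto simp: partial_ext_def continuous_map_def)
  then have "\<exists>H. \<forall>n. partial_ext n (H n) \<and> (\<forall>u\<in>topspace T. \<forall>p\<in>sk n. H (Suc n) (u, p) = H n (u, p))"
    using partial_ext_Suc
    by (intro dependent_nat_choice[of partial_ext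
          "\<lambda>n h h'. \<forall>u\<in>topspace T. \<forall>p\<in>sk n. h' (u, p) = h (u, p)"]) blast+
  then obtain H where H: "\<And>n. partial_ext n (H n)"
    and H_Suc: "\<And>n u p. \<lbrakk>u \<in> topspace T; p \<in> sk n\<rbrakk> \<Longrightarrow> H (Suc n) (u, p) = H n (u, p)"
    by blast
  have H_le: "H n (u, p) = H m (u, p)" if "m \<le> n" "u \<in> topspace T" "p \<in> sk m" for m n u p
    using that(1)
  proof (induction n rule: dec_induct)
    case (step k)
    then show ?case using H_Suc[OF that(2), of p k] sk_mono[of m k] that(3) by auto
  qed simp
  \<comment> \<open>\<open>Suc (dim p)\<close> is the first stage whose skeleton contains
    \<open>p\<close>, and all later stages agree with it there.\<close>
  define F where "F = (\<lambda>(u, p). H (Suc (dim p)) (u, p))"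
  have F: "F (u, p) = H n (u, p)" if "u \<in> topspace T" "p \<in> sk n" for n u p
    using that H_le[of "Suc (dim p)" n u p] by (auto simp: F_def sk_def)
  show ?thesis
  proof (intro exI[of _ F] conjI ballI impI)
    show "continuous_map (prod_topology T X) Z F"
    proof (rule continuous_map_from_prod_quotient_sum[OF quotient_map_cells lc_T haus_T])
      fix a assume "a \<in> (SIGMA m:UNIV. I m)"
      then obtain m i where a: "a = (m, i)" "i \<in> I m" by auto
      have "continuous_map (prod_topology T (P m)) X (\<lambda>w. q m i (snd w))"
        using continuous_map_compose[OF continuous_map_snd cell_continuous[OF a(2)]] by (simp add: o_def)
      then have "continuous_map (prod_topology T (P m)) (prod_topology T (subtopology X (sk (Suc m))))
            (\<lambda>w. (fst w, q m i (snd w)))"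
        using sk_cell[OF a(2)]
        by (auto simp: continuous_map_pairwise o_def continuous_map_in_subtopology continuous_map_fst)
      moreover have "continuous_map (prod_topology T (subtopology X (sk (Suc m)))) Z (H (Suc m))"
        using H[of "Suc m"] by (simp add: partial_ext_def)
      ultimately have "continuous_map (prod_topology T (P m)) Z (H (Suc m) \<circ> (\<lambda>w. (fst w, q m i (snd w))))"
        by (rule continuous_map_compose)
      then have "continuous_map (prod_topology T (P m)) Z (\<lambda>(u, x). F (u, q m i x))"
        by (rule continuous_map_eq) (use F[OF _ sk_cell[OF a(2) _ lessI]] in auto)
      then show "continuous_map (prod_topology T ((\<lambda>(m, i). P m) a)) Z
          (\<lambda>(u, x). F (u, (\<lambda>((m, i), x). q m i x) (a, x)))"
        using a by simp
    qed
  next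
    fix u p g assume u: "u \<in> topspace T" and p: "p \<in> topspace X" and g: "g \<in> carrier G"
    have p': "p \<in> sk (Suc (dim p))" using p by (simp add: sk_def)
    then show "F (u, \<phi> g p) = \<zeta> g (F (u, p))"
      using F[OF u p'] F[OF u sk_act[OF p' g]] H u g by (auto simp: partial_ext_def)
  next
    fix u p assume u: "u \<in> topspace T" and M: "M u = 1" and p: "p \<in> topspace X"
    have p': "p \<in> sk (Suc (dim p))" using p by (simp add: sk_def)
    then show "F (u, p) = f (u, p)"
      using F[OF u p'] H u M by (auto simp: partial_ext_def)
  qed
qed

end

section \<open>The point and the interval as parameter spaces: equivariant maps and
  homotopies\<close>

lemma gauged_point: "gauged (discrete_topology {()}) (\<lambda>_. 0) (\<lambda>u _. u)"
  by (auto simp: gauged_def case_prod_unfold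
      intro!: continuous_map_from_subtopology continuous_map_fst continuous_map_of_fst)

text \<open>The radius is measured from the midpoint \<open>1/2\<close> and normalized so that
  exactly the two ends form the boundary.\<close>

lemma gauged_interval:
  "gauged (top_of_set {0..1::real}) (\<lambda>u. \<bar>2 * u - 1\<bar>) (\<lambda>u l. 1 / 2 + (u - 1 / 2) / l)"
proof -
  let ?D = "subtopology (prod_topology (top_of_set {0..1::real}) euclideanreal)
       {(u, l). \<bar>2 * u - 1\<bar> \<le> l \<and> 0 < l \<and> l \<le> 1}"
  have bd: "0 \<le> 1 / 2 + (u - 1 / 2) / l \<and> 1 / 2 + (u - 1 / 2) / l \<le> 1"
    if "\<bar>2 * u - 1\<bar> \<le> l" "0 < l" for u l :: real
    using that by (auto simp: field_simps)
  have ab: "\<bar>2 * (1 / 2 + (u - 1 / 2) / l) - 1\<bar> = \<bar>2 * u - 1\<bar> / l" if "0 < l" for u l :: real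
  proof -
    have "2 * (1 / 2 + (u - 1 / 2) / l) - 1 = (2 * u - 1) / l"
      using that by (simp add: field_simps)
    then show ?thesis using that by simp
  qed
  have f: "continuous_map ?D euclideanreal fst"
    using continuous_map_into_fulltopology[OF continuous_map_fst]
    by (intro continuous_map_from_subtopology) auto
  have s: "continuous_map ?D euclideanreal snd"
    by (intro continuous_map_from_subtopology continuous_map_snd)
  have "continuous_map ?D euclideanreal (\<lambda>w. 1 / 2 + (fst w - 1 / 2) / snd w)"
    by (intro continuous_intros f s) auto
  then have "continuous_map ?D (top_of_set {0..1}) (\<lambda>(u, l). 1 / 2 + (u - 1 / 2) / l)"
    using bd by (auto simp: continuous_map_in_subtopology case_prod_unfold)
  moreover have "continuous_map (top_of_set {0..1::real}) euclideanreal (\<lambda>u. \<bar>2 * u - 1\<bar>)"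
    by (auto intro!: continuous_intros)
  ultimately show ?thesis
    using ab by (auto simp: gauged_def)
qed

context cellular_G_space
begin

lemma equivariant_map_exists:
  assumes Z: "cts_action G Z \<zeta>"
    and fixed: "\<And>n i. i \<in> I n \<Longrightarrow> fixed_points Z \<zeta> {g \<in> carrier G. \<psi> n g i = i} \<noteq> {} \<and>
      contractible_space (subtopology Z (fixed_points Z \<zeta> {g \<in> carrier G. \<psi> n g i = i}))"
  obtains f where "continuous_map X Z f"
    "\<And>p g. \<lbrakk>p \<in> topspace X; g \<in> carrier G\<rbrakk> \<Longrightarrow> f (\<phi> g p) = \<zeta> g (f p)"
proof -
  \<comment> \<open>As \<open>M\<close> is constantly \<open>0\<close>, nothing is prescribed: the
    space on which \<open>f\<close> must be continuous is empty, and \<open>undefined\<close>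
    serves.\<close>
  interpret G_extension G X \<phi> I \<psi> P N S q "discrete_topology {()}" "\<lambda>_. 0" "\<lambda>u _. u" Z \<zeta> "\<lambda>_. undefined"
    by unfold_locales (use Z fixed gauged_point in \<open>auto simp: continuous_map_def locally_compact_space_discrete_topology\<close>)
  obtain F where F: "continuous_map (prod_topology (discrete_topology {()}) X) Z F"
    "\<forall>u\<in>{()}. \<forall>p\<in>topspace X. \<forall>g\<in>carrier G. F (u, \<phi> g p) = \<zeta> g (F (u, p))"
    using equivariant_extension by force
  have "continuous_map X (prod_topology (discrete_topology {()}) X) (\<lambda>p. ((), p))"
    by (simp add: continuous_map_pairwise o_def)
  then have "continuous_map X Z (\<lambda>p. F ((), p))"
    using continuous_map_compose F(1) by (fastforce simp: o_def)
  then show ?thesis using F(2) by (intro that) auto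
qed

lemma equivariant_homotopy_exists:
  assumes Z: "cts_action G Z \<zeta>"
    and fixed: "\<And>n i. i \<in> I n \<Longrightarrow> fixed_points Z \<zeta> {g \<in> carrier G. \<psi> n g i = i} \<noteq> {} \<and>
      contractible_space (subtopology Z (fixed_points Z \<zeta> {g \<in> carrier G. \<psi> n g i = i}))"
    and f: "\<And>u. u \<in> {0, 1::nat} \<Longrightarrow> continuous_map X Z (f u)"
      "\<And>u p g. \<lbrakk>u \<in> {0, 1}; p \<in> topspace X; g \<in> carrier G\<rbrakk> \<Longrightarrow> f u (\<phi> g p) = \<zeta> g (f u p)"
  obtains h where "continuous_map (prod_topology (top_of_set {0..1::real}) X) Z h"
    "\<And>u p g. \<lbrakk>u \<in> {0..1}; p \<in> topspace X; g \<in> carrier G\<rbrakk> \<Longrightarrow> h (u, \<phi> g p) = \<zeta> g (h (u, p))"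
    "\<And>p. p \<in> topspace X \<Longrightarrow> h (0, p) = f 0 p"
    "\<And>p. p \<in> topspace X \<Longrightarrow> h (1, p) = f 1 p"
proof -
  let ?M = "\<lambda>u::real. \<bar>2 * u - 1\<bar>"
  let ?T = "top_of_set {0..1::real}"
  let ?D = "prod_topology (subtopology ?T {u. ?M u = 1}) X"
  \<comment> \<open>On \<open>?D\<close> the parameter is \<open>0\<close> or \<open>1\<close>, so
    the threshold \<open>1 / 2\<close> is never met and the two pieces have no common points on
    which to agree.\<close>
  define k where "k w = (if fst w \<le> 1 / 2 then f 0 (snd w) else f 1 (snd w))" for w :: "real \<times> 'x"
  have M1: "u = 0 \<or> u = 1" if "?M u = 1" for u
    using that by linarith
  have cf: "continuous_map ?D euclideanreal fst"
    using continuous_map_into_fulltopology[OF continuous_map_into_fulltopology[OF continuous_map_fst]] .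
  have k: "continuous_map ?D Z k"
    unfolding k_def
  proof (rule continuous_map_cases_le)
    show "continuous_map (subtopology ?D {x \<in> topspace ?D. fst x \<le> 1 / 2}) Z (\<lambda>w. f 0 (snd w))"
      "continuous_map (subtopology ?D {x \<in> topspace ?D. 1 / 2 \<le> fst x}) Z (\<lambda>w. f 1 (snd w))"
      using continuous_map_compose[OF continuous_map_snd f(1)]
      by (auto simp: o_def intro!: continuous_map_from_subtopology)
  qed (use cf M1 in \<open>auto simp: field_simps\<close>)
  interpret G_extension G X \<phi> I \<psi> P N S q ?T ?M "\<lambda>u l. 1 / 2 + (u - 1 / 2) / l" Z \<zeta> k
  proof unfold_locales
    show "locally_compact_space ?T"
      by (intro compact_imp_locally_compact_space) (auto simp: compact_space_subtopology)
    show "k (u, \<phi> g p) = \<zeta> g (k (u, p))" if "u \<in> topspace ?T" "p \<in> topspace X" "g \<in> carrier G" for u p g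
      using that f(2) by (auto simp: k_def)
  qed (use Z fixed gauged_interval k in \<open>auto simp: Hausdorff_space_subtopology\<close>)
  obtain h where h: "continuous_map (prod_topology ?T X) Z h"
    "\<forall>u\<in>topspace ?T. \<forall>p\<in>topspace X. (\<forall>g\<in>carrier G. h (u, \<phi> g p) = \<zeta> g (h (u, p))) \<and>
      (?M u = 1 \<longrightarrow> h (u, p) = k (u, p))"
    using equivariant_extension by blast
  show ?thesis
  proof (rule that[OF h(1)])
    show "h (0, p) = f 0 p" "h (1, p) = f 1 p" if "p \<in> topspace X" for p
      using h(2) that by (auto simp: k_def)
  qed (use h(2) in auto)
qed

end

section \<open>Orbit maps\<close>

text \<open>Characterizes an orbit space by its projection. The realized nerve of the orbit category
  can then play the part of \<open>|E|/G\<close> as it stands, without a homeomorphism to a set of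
  orbits.\<close>

definition orbit_map ::
  "('g, 'b) monoid_scheme \<Rightarrow> 'x topology \<Rightarrow> ('g \<Rightarrow> 'x \<Rightarrow> 'x) \<Rightarrow> 'c topology \<Rightarrow> ('x \<Rightarrow> 'c) \<Rightarrow> bool" where
  "orbit_map G X \<phi> B r \<longleftrightarrow> quotient_map X B r \<and>
     (\<forall>x\<in>topspace X. \<forall>y\<in>topspace X. r x = r y \<longleftrightarrow> (\<exists>g\<in>carrier G. y = \<phi> g x))"

lemma orbit_map_descend:
  assumes r: "orbit_map G X \<phi> B r" and r': "orbit_map G X' \<phi>' B' r'"
    and f: "continuous_map X X' f"
    and eq: "\<And>p g. \<lbrakk>p \<in> topspace X; g \<in> carrier G\<rbrakk> \<Longrightarrow> f (\<phi> g p) = \<phi>' g (f p)"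
  obtains b where "continuous_map B B' b" "\<And>p. p \<in> topspace X \<Longrightarrow> b (r p) = r' (f p)"
proof (rule quotient_map_lift_exists)
  show "quotient_map X B r"
    using r by (simp add: orbit_map_def)
  show "continuous_map X B' (r' \<circ> f)"
    using r' f by (auto simp: orbit_map_def intro: continuous_map_compose quotient_imp_continuous_map)
  show "(r' \<circ> f) x = (r' \<circ> f) y" if xy: "x \<in> topspace X" "y \<in> topspace X" "r x = r y" for x y
  proof -
    obtain g where "g \<in> carrier G" "y = \<phi> g x"
      using r xy unfolding orbit_map_def by blast
    moreover have "f x \<in> topspace X'" "f y \<in> topspace X'"
      using continuous_map_image_subset_topspace[OF f] xy by auto
    ultimately show ?thesis
      using r' eq xy unfolding orbit_map_def o_def by metis
  qed
qed (use that in auto)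

lemma orbit_map_homotopic:
  assumes r: "orbit_map G X \<phi> B r" and r': "orbit_map G X' \<phi>' B' r'"
    and h: "continuous_map (prod_topology (top_of_set {0..1::real}) X) X' h"
    and eq: "\<And>u p g. \<lbrakk>u \<in> {0..1}; p \<in> topspace X; g \<in> carrier G\<rbrakk> \<Longrightarrow> h (u, \<phi> g p) = \<phi>' g (h (u, p))"
    and b: "\<And>p. p \<in> topspace X \<Longrightarrow> b (r p) = r' (h (0, p))" "\<And>p. p \<in> topspace X \<Longrightarrow> c (r p) = r' (h (1, p))"
  shows "homotopic_with (\<lambda>x. True) B B' b c"
proof -
  let ?T = "top_of_set {0..1::real}"
  have qr: "quotient_map X B r"
    using r by (simp add: orbit_map_def)
  \<comment> \<open>The interval is compact Hausdorff, so the product with it keeps \<open>r\<close>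
    a quotient map and the homotopy can descend.\<close>
  have A: "quotient_map (prod_topology ?T X) (prod_topology ?T B) (\<lambda>(u, p). (u, r p))"
    by (intro quotient_map_prod_right qr compact_imp_locally_compact_space disjI1)
      (auto simp: compact_space_subtopology Hausdorff_space_subtopology)
  have C: "continuous_map (prod_topology ?T X) B' (r' \<circ> h)"
    using r' h by (auto simp: orbit_map_def intro: continuous_map_compose quotient_imp_continuous_map)
  have E: "(r' \<circ> h) x = (r' \<circ> h) y"
    if x: "x \<in> topspace (prod_topology ?T X)" and y: "y \<in> topspace (prod_topology ?T X)"
      and xy: "(\<lambda>(u, p). (u, r p)) x = (\<lambda>(u, p). (u, r p)) y" for x y
  proof -
    obtain u p p' where up: "x = (u, p)" "y = (u, p')" "u \<in> {0..1}" "p \<in> topspace X" "p' \<in> topspace X" "r p = r p'"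
      using x y xy by (cases x; cases y) auto
    obtain g where g: "g \<in> carrier G" "p' = \<phi> g p"
      using r up unfolding orbit_map_def by blast
    have "h x \<in> topspace X'" "h y \<in> topspace X'"
      using continuous_map_image_subset_topspace[OF h] x y by auto
    moreover have "h y = \<phi>' g (h x)"
      using eq up g by simp
    ultimately show ?thesis
      using r' g(1) unfolding orbit_map_def o_def by blast
  qed
  have "\<exists>k. continuous_map (prod_topology ?T B) B' k \<and>
    (\<forall>x\<in>topspace (prod_topology ?T X). k ((\<lambda>(u, p). (u, r p)) x) = (r' \<circ> h) x)"
  proof (rule quotient_map_lift_exists[OF A C E])
    fix k
    assume 1: "continuous_map (prod_topology ?T B) B' k"
      and 2: "\<And>x. x \<in> topspace (prod_topology ?T X) \<Longrightarrow> k ((\<lambda>(u, p). (u, r p)) x) = (r' \<circ> h) x"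
    show ?thesis
      by (intro exI[of _ k] conjI ballI) (fact 1, rule 2)
  qed
  then obtain k where k: "continuous_map (prod_topology ?T B) B' k"
    "\<forall>x\<in>topspace (prod_topology ?T X). k ((\<lambda>(u, p). (u, r p)) x) = (r' \<circ> h) x"
    by blast
  have k': "k (u, r p) = r' (h (u, p))" if "u \<in> {0..1}" "p \<in> topspace X" for u p
    using k(2) that by simp
  have "k (0, y) = b y \<and> k (1, y) = c y" if "y \<in> topspace B" for y
  proof -
    obtain p where "p \<in> topspace X" "y = r p"
      using quotient_imp_surjective_map[OF qr] \<open>y \<in> topspace B\<close> by blast
    then show ?thesis using b k' by simp
  qed
  then show ?thesis
    using k(1) by (subst homotopic_with) auto
qed

text \<open>Four extension problems are solved: a map in each direction and, on each side, a
  homotopy from the round trip to the identity. Each pairs the cell stabilizers of its source with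
  the fixed points of its target, and \<open>\<F>\<close> is what links the two.\<close>

lemma orbit_spaces_homotopy_equivalent:
  assumes X: "cellular_G_space G X \<phi> I \<psi> P N S q" and X': "cellular_G_space G X' \<phi>' I' \<psi>' P' N' S' q'"
    and st: "\<And>n i. i \<in> I n \<Longrightarrow> {g \<in> carrier G. \<psi> n g i = i} \<in> \<F>"
    and st': "\<And>n i. i \<in> I' n \<Longrightarrow> {g \<in> carrier G. \<psi>' n g i = i} \<in> \<F>"
    and fx: "\<And>H. H \<in> \<F> \<Longrightarrow> fixed_points X \<phi> H \<noteq> {} \<and> contractible_space (subtopology X (fixed_points X \<phi> H))"
    and fx': "\<And>H. H \<in> \<F> \<Longrightarrow> fixed_points X' \<phi>' H \<noteq> {} \<and> contractible_space (subtopology X' (fixed_points X' \<phi>' H))"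
    and r: "orbit_map G X \<phi> B r" and r': "orbit_map G X' \<phi>' B' r'"
  shows "B homotopy_equivalent_space B'"
proof -
  interpret X: cellular_G_space G X \<phi> I \<psi> P N S q by (rule X)
  interpret X': cellular_G_space G X' \<phi>' I' \<psi>' P' N' S' q' by (rule X')
  obtain f where f: "continuous_map X X' f"
    "\<And>p g. \<lbrakk>p \<in> topspace X; g \<in> carrier G\<rbrakk> \<Longrightarrow> f (\<phi> g p) = \<phi>' g (f p)"
    using X.equivariant_map_exists[OF X'.action fx'[OF st]] by blast
  obtain f' where f': "continuous_map X' X f'"
    "\<And>p g. \<lbrakk>p \<in> topspace X'; g \<in> carrier G\<rbrakk> \<Longrightarrow> f' (\<phi>' g p) = \<phi> g (f' p)"
    using X'.equivariant_map_exists[OF X.action fx[OF st']] by blast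
  have f_in: "\<And>p. p \<in> topspace X \<Longrightarrow> f p \<in> topspace X'" and f'_in: "\<And>p. p \<in> topspace X' \<Longrightarrow> f' p \<in> topspace X"
    using continuous_map_image_subset_topspace f(1) f'(1) by blast+
  obtain b where b: "continuous_map B B' b" "\<And>p. p \<in> topspace X \<Longrightarrow> b (r p) = r' (f p)"
    using orbit_map_descend[OF r r' f] by blast
  obtain b' where b': "continuous_map B' B b'" "\<And>p. p \<in> topspace X' \<Longrightarrow> b' (r' p) = r (f' p)"
    using orbit_map_descend[OF r' r f'] by blast
  obtain h where h: "continuous_map (prod_topology (top_of_set {0..1::real}) X) X h"
    "\<And>u p g. \<lbrakk>u \<in> {0..1}; p \<in> topspace X; g \<in> carrier G\<rbrakk> \<Longrightarrow> h (u, \<phi> g p) = \<phi> g (h (u, p))"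
    "\<And>p. p \<in> topspace X \<Longrightarrow> h (0, p) = f' (f p)" "\<And>p. p \<in> topspace X \<Longrightarrow> h (1, p) = p"
    by (rule X.equivariant_homotopy_exists[OF X.action fx[OF st], of "\<lambda>u. if u = 0 then f' \<circ> f else id"])
      (use f f' f_in continuous_map_compose[OF f(1) f'(1)] in auto)
  obtain h' where h': "continuous_map (prod_topology (top_of_set {0..1::real}) X') X' h'"
    "\<And>u p g. \<lbrakk>u \<in> {0..1}; p \<in> topspace X'; g \<in> carrier G\<rbrakk> \<Longrightarrow> h' (u, \<phi>' g p) = \<phi>' g (h' (u, p))"
    "\<And>p. p \<in> topspace X' \<Longrightarrow> h' (0, p) = f (f' p)" "\<And>p. p \<in> topspace X' \<Longrightarrow> h' (1, p) = p"
    by (rule X'.equivariant_homotopy_exists[OF X'.action fx'[OF st'], of "\<lambda>u. if u = 0 then f \<circ> f' else id"])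
      (use f f' f'_in continuous_map_compose[OF f'(1) f(1)] in auto)
  have "homotopic_with (\<lambda>x. True) B B (b' \<circ> b) id"
    by (rule orbit_map_homotopic[OF r r h(1,2)]) (use h b b' f_in in auto)
  moreover have "homotopic_with (\<lambda>x. True) B' B' (b \<circ> b') id"
    by (rule orbit_map_homotopic[OF r' r' h'(1,2)]) (use h' b b' f'_in in auto)
  ultimately show ?thesis
    using b(1) b'(1) unfolding homotopy_equivalent_space_def by blast
qed

section \<open>\<open>G\<close>-CW-complexes as cellular \<open>G\<close>-spaces\<close>

lemma cts_action_G_space:
  assumes "group G" "G_space G Y \<phi>"
  shows "cts_action G Y \<phi>"
proof -
  interpret group_action G "topspace Y" \<phi>
    using assms by (simp add: G_space_def)
  show ?thesis
    using assms(2) composition_rule id_eq_one unfolding cts_action_def G_space_def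
    by (metis restrict_apply')
qed

lemma (in cellular_G_space) cell_stabilizer_subgroup:
  assumes i: "i \<in> I n"
  shows "subgroup {g \<in> carrier G. \<psi> n g i = i} G"
proof (rule subgroupI)
  show "{g \<in> carrier G. \<psi> n g i = i} \<noteq> {}"
    using index_one[OF i] by auto
  show "inv g \<in> {g \<in> carrier G. \<psi> n g i = i}" if g: "g \<in> {g \<in> carrier G. \<psi> n g i = i}" for g
    using g index_mult[OF i, of "inv g" g] index_one[OF i] by auto
qed (use index_mult[OF i] in auto)

section \<open>Discs and equivariant cells\<close>

lemma topspace_disc: "topspace (disc n) = {x. (\<forall>i\<ge>n. x i = 0) \<and> (\<Sum>i<n. x i ^ 2) \<le> 1}"
  by (auto simp: disc_def topspace_Euclidean_space)

lemma continuous_map_disc_component: "continuous_map (disc n) euclideanreal (\<lambda>x. x i)"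
  unfolding disc_def Euclidean_space_def
  by (intro continuous_map_from_subtopology continuous_map_product_projection UNIV_I)

lemma continuous_map_into_disc:
  "continuous_map X (disc n) f \<longleftrightarrow>
     (\<forall>i. continuous_map X euclideanreal (\<lambda>x. f x i)) \<and> f ` topspace X \<subseteq> topspace (disc n)"
  unfolding topspace_disc
  by (auto simp: disc_def Euclidean_space_def continuous_map_in_subtopology
      continuous_map_componentwise_UNIV)

lemma gauged_disc: "gauged (disc n) (\<lambda>x. sqrt (\<Sum>i<n. x i ^ 2)) (\<lambda>x l i. x i / l)"
proof -
  let ?D = "subtopology (prod_topology (disc n) euclideanreal)
       {(x, l). sqrt (\<Sum>i<n. x i ^ 2) \<le> l \<and> 0 < l \<and> l \<le> 1}"
  have sc: "sqrt (\<Sum>i<n. (x i / l) ^ 2) = sqrt (\<Sum>i<n. x i ^ 2) / l" if "0 < l" for x :: "nat \<Rightarrow> real" and l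
  proof -
    have "(\<Sum>i<n. (x i / l) ^ 2) = (\<Sum>i<n. x i ^ 2) / l ^ 2"
      by (simp add: power_divide sum_divide_distrib)
    then show ?thesis using that by (simp add: real_sqrt_divide)
  qed
  have "continuous_map ?D euclideanreal (\<lambda>w. fst w i / snd w)" for i
  proof (rule continuous_map_real_divide)
    show "continuous_map ?D euclideanreal (\<lambda>w. fst w i)"
      using continuous_map_compose[OF continuous_map_fst continuous_map_disc_component]
      by (intro continuous_map_from_subtopology) (simp add: o_def)
    show "continuous_map ?D euclideanreal snd"
      by (intro continuous_map_from_subtopology continuous_map_snd)
  qed auto
  moreover have "(\<lambda>i. x i / l) \<in> topspace (disc n)"
    if "x \<in> topspace (disc n)" "sqrt (\<Sum>i<n. x i ^ 2) \<le> l" "0 < l" for x l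
  proof -
    have "sqrt (\<Sum>i<n. (x i / l) ^ 2) \<le> 1"
      using that by (simp only: sc) simp
    then show ?thesis using that(1) by (simp add: topspace_disc)
  qed
  ultimately have "continuous_map ?D (disc n) (\<lambda>(x, l) i. x i / l)"
    by (auto simp: continuous_map_into_disc case_prod_unfold)
  moreover have "continuous_map (disc n) euclideanreal (\<lambda>x. sqrt (\<Sum>i<n. x i ^ 2))"
  proof -
    have "continuous_map (disc n) euclideanreal (\<lambda>x. \<Sum>i<n. x i ^ 2)"
      by (intro continuous_map_sum continuous_map_real_pow continuous_map_disc_component) auto
    moreover have "continuous_map euclideanreal euclideanreal sqrt"
      by (auto intro: continuous_intros)
    ultimately show ?thesis
      by (rule continuous_map_compose[unfolded o_def])
  qed
  ultimately show ?thesis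
    using sc by (auto simp: gauged_def topspace_disc sum_nonneg)
qed

lemma topspace_G_cells:
  "topspace (G_cells G n J H) = {(j, c, x). j \<in> J \<and> c \<in> lcosets\<^bsub>G\<^esub> (H j) \<and> x \<in> topspace (disc n)}"
  by (auto simp: G_cells_def)

lemma continuous_map_G_cell:
  assumes "j \<in> J" "c \<in> lcosets\<^bsub>G\<^esub> (H j)"
  shows "continuous_map (disc n) (G_cells G n J H) (\<lambda>x. (j, c, x))"
proof -
  have "continuous_map (disc n) (prod_topology (discrete_topology (lcosets\<^bsub>G\<^esub> (H j))) (disc n)) (Pair c)"
    using assms by (simp add: continuous_map_pairwise o_def)
  then show ?thesis
    using continuous_map_compose[OF _ continuous_map_component_injection[OF assms(1)]]
    unfolding G_cells_def by (fastforce simp: o_def)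
qed

text \<open>The coset factor is discrete, so \<open>G/H \<times> D\<close> is a sum of discs and
  openness is tested on each disc separately.\<close>

lemma openin_G_cells:
  assumes "W \<subseteq> topspace (G_cells G n J H)"
    and op: "\<And>j c. \<lbrakk>j \<in> J; c \<in> lcosets\<^bsub>G\<^esub> (H j)\<rbrakk> \<Longrightarrow> openin (disc n) {x \<in> topspace (disc n). (j, c, x) \<in> W}"
  shows "openin (G_cells G n J H) W"
proof -
  have "openin (prod_topology (discrete_topology (lcosets\<^bsub>G\<^esub> (H j))) (disc n)) {w. (j, w) \<in> W}"
    if j: "j \<in> J" for j
    unfolding openin_prod_topology_alt
  proof (intro allI impI)
    fix c x assume "(c, x) \<in> {w. (j, w) \<in> W}"
    then have cx: "(j, c, x) \<in> W" "c \<in> lcosets\<^bsub>G\<^esub> (H j)" "x \<in> topspace (disc n)"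
      using assms(1) by (auto simp: topspace_G_cells)
    show "\<exists>U V. openin (discrete_topology (lcosets\<^bsub>G\<^esub> (H j))) U \<and> openin (disc n) V \<and> c \<in> U \<and> x \<in> V \<and>
      U \<times> V \<subseteq> {w. (j, w) \<in> W}"
      by (intro exI[of _ "{c}"] exI[of _ "{x \<in> topspace (disc n). (j, c, x) \<in> W}"])
        (use cx op[OF j cx(2)] in auto)
  qed
  then show ?thesis
    using assms(1) by (auto simp: G_cells_def openin_sum_topology)
qed

text \<open>Each equivariant cell is split into its discs: an index is a pair of an equivariant cell
  \<open>j\<close> and a coset \<open>c\<close> of \<open>H j\<close>, and \<open>G\<close>
  translates the coset. The work lies in converting the pushout topologies of the skeleta into the
  closedness conditions.\<close>

lemma cellular_G_space_of_G_CW_complex: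
  fixes G :: "('g, 'b) monoid_scheme" (structure) and Y :: "'y topology"
  assumes G: "group G" and Y: "G_CW_complex G Y \<phi>"
  obtains I :: "nat \<Rightarrow> ('y \<times> 'g set) set" and \<psi> q where
    "cellular_G_space G Y \<phi> I \<psi> disc (\<lambda>n x. sqrt (\<Sum>i<n. x i ^ 2)) (\<lambda>_ x l i. x i / l) q"
proof -
  interpret group G by (rule G)
  have act: "cts_action G Y \<phi>"
    by (rule cts_action_G_space[OF G]) (use Y in \<open>simp add: G_CW_complex_def\<close>)
  obtain sk where sk: "sk 0 = {}" "\<And>n. sk n \<subseteq> sk (Suc n)"
    "\<And>n. attaches_G_cells G Y \<phi> n (sk n) (sk (Suc n))" "(\<Union>n. sk n) = topspace Y"
    "\<And>U. U \<subseteq> topspace Y \<Longrightarrow> (\<And>n. openin (subtopology Y (sk n)) (U \<inter> sk n)) \<Longrightarrow> openin Y U"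
    using Y unfolding G_CW_complex_def by metis
  \<comment> \<open>The attaching data of one dimension are bundled into a triple, so that a single
    choice over \<open>n\<close> yields them for all dimensions.\<close>
  let ?Q = "\<lambda>n (J, H, q). (\<forall>j \<in> J. subgroup (H j) G) \<and>
        continuous_map (G_cells G n J H) (subtopology Y (sk (Suc n))) q \<and>
        (\<forall>(j, c, x) \<in> topspace (G_cells G n J H). \<forall>g \<in> carrier G.
           q (j, g <#\<^bsub>G\<^esub> c, x) = \<phi> g (q (j, c, x))) \<and>
        (\<forall>(j, c, x) \<in> topspace (G_cells G n J H). (\<Sum>i<n. x i ^ 2) = 1 \<longrightarrow> q (j, c, x) \<in> sk n) \<and>
        bij_betw q {(j, c, x) \<in> topspace (G_cells G n J H). (\<Sum>i<n. x i ^ 2) < 1} (sk (Suc n) - sk n) \<and>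
        (\<forall>U \<subseteq> sk (Suc n). openin (subtopology Y (sk (Suc n))) U \<longleftrightarrow>
           openin (subtopology Y (sk n)) (U \<inter> sk n) \<and>
           openin (G_cells G n J H) {p \<in> topspace (G_cells G n J H). q p \<in> U})"
  define Q :: "nat \<Rightarrow> 'y set \<times> ('y \<Rightarrow> 'g set) \<times> ('y \<times> 'g set \<times> (nat \<Rightarrow> real) \<Rightarrow> 'y) \<Rightarrow> bool"
    where "Q = ?Q"
  have "\<exists>d. Q n d" for n
    using sk(3)[of n] unfolding attaches_G_cells_def Q_def by simp
  then obtain D where QD: "\<And>n. Q n (D n)"
    by metis
  have D: "?Q n (D n)" for n
    using QD[of n] unfolding Q_def .
  define J where "J n = fst (D n)" for n
  define H where "H n = fst (snd (D n))" for n
  define r where "r n = snd (snd (D n))" for n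
  have D': "?Q n (J n, H n, r n)" for n
    using D[of n] by (simp add: J_def H_def r_def)
  let ?C = "\<lambda>n. G_cells G n (J n) (H n)"
  have sub: "subgroup (H n j) G" if "j \<in> J n" for n j
    using D'[of n] that by simp
  have r_cont: "continuous_map (?C n) (subtopology Y (sk (Suc n))) (r n)" for n
    using D'[of n] by simp
  have r_eq: "r n (j, g <# c, x) = \<phi> g (r n (j, c, x))"
    if "(j, c, x) \<in> topspace (?C n)" "g \<in> carrier G" for n j c x g
    using D'[of n] that by auto
  have r_bd: "r n (j, c, x) \<in> sk n" if "(j, c, x) \<in> topspace (?C n)" "(\<Sum>i<n. x i ^ 2) = 1" for n j c x
    using D'[of n] that by auto
  have r_bij: "bij_betw (r n) {(j, c, x) \<in> topspace (?C n). (\<Sum>i<n. x i ^ 2) < 1} (sk (Suc n) - sk n)" for n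
    using D'[of n] by simp
  have r_op: "openin (subtopology Y (sk (Suc n))) U"
    if "U \<subseteq> sk (Suc n)" "openin (subtopology Y (sk n)) (U \<inter> sk n)"
      "openin (?C n) {p \<in> topspace (?C n). r n p \<in> U}" for n U
    using D'[of n] that by simp
  have sk_mono: "sk m \<subseteq> sk n" if "m \<le> n" for m n
    using lift_Suc_mono_le[of sk, OF sk(2) that] .
  define I where "I n = {(j, c). j \<in> J n \<and> c \<in> lcosets\<^bsub>G\<^esub> (H n j)}" for n
  define \<psi> :: "nat \<Rightarrow> 'g \<Rightarrow> 'y \<times> 'g set \<Rightarrow> 'y \<times> 'g set" where "\<psi> n g = (\<lambda>(j, c). (j, g <# c))" for n g
  define q where "q n = (\<lambda>(j, c) x. r n (j, c, x))" for n
  have top: "(j, c, x) \<in> topspace (?C n) \<longleftrightarrow> (j, c) \<in> I n \<and> x \<in> topspace (disc n)" for n j c x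
    by (simp add: topspace_G_cells I_def)
  have Csub: "c \<subseteq> carrier G" if "(j, c) \<in> I n" for n j c
    using that l_coset_subset_G[OF subgroup.subset[OF sub]] by (fastforce simp: I_def LCOSETS_def)
  have q_cont: "continuous_map (disc n) (subtopology Y (sk (Suc n))) (q n i)" if i: "i \<in> I n" for n i
  proof -
    obtain j c where jc: "i = (j, c)" "j \<in> J n" "c \<in> lcosets\<^bsub>G\<^esub> (H n j)"
      using i by (auto simp: I_def)
    show ?thesis
      using continuous_map_compose[OF continuous_map_G_cell[where n = n and H = "H n", OF jc(2,3)] r_cont[of n]]
      by (simp add: q_def jc(1) o_def)
  qed
  have q_sk: "q n i x \<in> sk (Suc n)" if "i \<in> I n" "x \<in> topspace (disc n)" for n i x
    using continuous_map_image_subset_topspace[OF q_cont[OF that(1)]] that(2) by auto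
  have q_int: "q n i x \<in> sk (Suc n) - sk n"
    if "i \<in> I n" "x \<in> topspace (disc n)" "sqrt (\<Sum>i<n. x i ^ 2) < 1" for n i x
    using bij_betwE[OF r_bij[of n]] that by (cases i) (auto simp: q_def top)
  have cover: "\<exists>n<m. \<exists>i\<in>I n. \<exists>x\<in>topspace (disc n). sqrt (\<Sum>i<n. x i ^ 2) < 1 \<and> p = q n i x"
    if "p \<in> sk m" for p m
    using that
  proof (induction m)
    case (Suc m)
    show ?case
    proof (cases "p \<in> sk m")
      case False
      then have "p \<in> r m ` {(j, c, x) \<in> topspace (?C m). (\<Sum>i<m. x i ^ 2) < 1}"
        using Suc.prems r_bij[of m] by (simp add: bij_betw_def)
      then obtain j c x where "p = r m (j, c, x)" "(j, c, x) \<in> topspace (?C m)" "(\<Sum>i<m. x i ^ 2) < 1"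
        by auto
      then show ?thesis
        by (intro exI[of _ m] conjI bexI[of _ "(j, c)"] bexI[of _ x]) (auto simp: top q_def)
    qed (use Suc.IH less_Suc_eq in blast)
  qed (use sk(1) in simp)
  \<comment> \<open>Serves both closedness conditions at once. In dimension \<open>n\<close> either
    the closed cells test \<open>V\<close>, or \<open>V\<close> lies in \<open>sk n\<close>, below
    the \<open>n\<close>-cells. A subset of one skeleton satisfies the second alternative in all
    high dimensions.\<close>
  have closed: "closedin Y V"
    if V: "V \<subseteq> topspace Y" and c: "\<And>n. (\<forall>i\<in>I n. closedin (disc n) {x \<in> topspace (disc n). q n i x \<in> V}) \<or> V \<subseteq> sk n" for V
  proof -
    have skt: "sk n \<subseteq> topspace Y" for n
      using sk(4) by blast
    \<comment> \<open>\<open>attaches_G_cells\<close> describes open sets, hence the passage to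
      complements. The step from \<open>sk n\<close> to \<open>sk (Suc n)\<close> attaches the
      \<open>n\<close>-cells.\<close>
    have op: "openin (subtopology Y (sk n)) (sk n - V)" for n
    proof (induction n)
      case (Suc n)
      show ?case
      proof (rule r_op)
        have "(sk (Suc n) - V) \<inter> sk n = sk n - V"
          using sk(2)[of n] by auto
        then show "openin (subtopology Y (sk n)) ((sk (Suc n) - V) \<inter> sk n)"
          using Suc by simp
        show "openin (?C n) {p \<in> topspace (?C n). r n p \<in> sk (Suc n) - V}"
        proof (rule openin_G_cells)
          fix j c assume jc: "j \<in> J n" "c \<in> lcosets\<^bsub>G\<^esub> (H n j)"
          then have i: "(j, c) \<in> I n" by (simp add: I_def)
          have "closedin (disc n) {x \<in> topspace (disc n). q n (j, c) x \<in> V}"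
          proof (cases "V \<subseteq> sk n")
            \<comment> \<open>Open \<open>n\<close>-cells avoid \<open>sk n\<close>, so
              \<open>V\<close> meets the closed cell in its boundary only. There \<open>q\<close>
              maps into \<open>sk n\<close>, where \<open>V\<close> is closed by the induction
              hypothesis.\<close>
            case True
            let ?B = "{x \<in> topspace (disc n). sqrt (\<Sum>i<n. x i ^ 2) = 1}"
            have cN: "continuous_map (disc n) euclideanreal (\<lambda>x. sqrt (\<Sum>i<n. x i ^ 2))"
              using gauged_disc[of n] by (simp add: gauged_def)
            have B: "closedin (disc n) ?B"
              using closedin_continuous_map_preimage[OF cN, of "{1}"] by simp
            have "continuous_map (subtopology (disc n) ?B) (subtopology Y (sk n)) (q n (j, c))"
              using continuous_map_from_subtopology[OF continuous_map_into_fulltopology[OF q_cont[OF i]]]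
                r_bd[of j c _ n] i
              by (auto simp: continuous_map_in_subtopology q_def top)
            moreover have "closedin (subtopology Y (sk n)) V"
            proof -
              have "topspace (subtopology Y (sk n)) = sk n"
                using skt by auto
              moreover have "sk n - (sk n - V) = V"
                using True by auto
              ultimately show ?thesis
                using closedin_diff[OF closedin_topspace Suc] by simp
            qed
            ultimately have "closedin (subtopology (disc n) ?B)
                {x \<in> topspace (subtopology (disc n) ?B). q n (j, c) x \<in> V}"
              by (rule closedin_continuous_map_preimage)
            then have "closedin (disc n) {x \<in> topspace (subtopology (disc n) ?B). q n (j, c) x \<in> V}"
              using B closedin_trans_full by blast
            moreover have "{x \<in> topspace (subtopology (disc n) ?B). q n (j, c) x \<in> V} =
                {x \<in> topspace (disc n). q n (j, c) x \<in> V}"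
            proof -
              have "sqrt (\<Sum>i<n. x i ^ 2) = 1" if "x \<in> topspace (disc n)" "q n (j, c) x \<in> V" for x
              proof (rule ccontr)
                assume "sqrt (\<Sum>i<n. x i ^ 2) \<noteq> 1"
                then have "sqrt (\<Sum>i<n. x i ^ 2) < 1"
                  using that(1) by (auto simp: topspace_disc)
                then show False
                  using q_int[OF i that(1)] that(2) True by auto
              qed
              then show ?thesis by auto
            qed
            ultimately show ?thesis by simp
          qed (use c i in blast)
          then have "openin (disc n) (topspace (disc n) - {x \<in> topspace (disc n). q n (j, c) x \<in> V})"
            by blast
          moreover have "topspace (disc n) - {x \<in> topspace (disc n). q n (j, c) x \<in> V} =
              {x \<in> topspace (disc n). (j, c, x) \<in> {p \<in> topspace (?C n). r n p \<in> sk (Suc n) - V}}"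
            using q_sk[OF i] i by (auto simp: top q_def)
          ultimately show "openin (disc n) {x \<in> topspace (disc n). (j, c, x) \<in> {p \<in> topspace (?C n). r n p \<in> sk (Suc n) - V}}"
            by simp
        qed auto
      qed auto
    qed (simp add: sk(1))
    have "openin Y (topspace Y - V)"
    proof (rule sk(5))
      have "(topspace Y - V) \<inter> sk n = sk n - V" for n
        using skt by blast
      then show "openin (subtopology Y (sk n)) ((topspace Y - V) \<inter> sk n)" for n
        using op by simp
    qed auto
    then show ?thesis using V by (simp add: closedin_def)
  qed
  have "cellular_G_space G Y \<phi> I \<psi> disc (\<lambda>n x. sqrt (\<Sum>i<n. x i ^ 2)) (\<lambda>_ x l i. x i / l) q"
  proof (unfold_locales)
    show "cts_action G Y \<phi>" by (rule act)
    show "\<psi> n g i \<in> I n" if ig: "i \<in> I n" "g \<in> carrier G" for i n g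
    proof -
      obtain j a where ja: "i = (j, a <# H n j)" "j \<in> J n" "a \<in> carrier G"
        using ig by (auto simp: I_def LCOSETS_def)
      then have "g <# (a <# H n j) = (g \<otimes> a) <# H n j"
        using subgroup.subset[OF sub] ig(2) by (simp add: lcos_m_assoc)
      then show ?thesis
        using ja ig(2) by (auto simp: I_def \<psi>_def LCOSETS_def)
    qed
    show "\<psi> n \<one> i = i" if "i \<in> I n" for i n
      using that Csub lcos_mult_one by (cases i) (auto simp: \<psi>_def)
    show "\<psi> n (g \<otimes> h) i = \<psi> n g (\<psi> n h i)" if "i \<in> I n" "g \<in> carrier G" "h \<in> carrier G" for i n g h
      using that Csub lcos_m_assoc by (cases i) (auto simp: \<psi>_def)
    show "gauged (disc n) (\<lambda>x. sqrt (\<Sum>i<n. x i ^ 2)) (\<lambda>x l i. x i / l)" for n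
      by (rule gauged_disc)
    show "continuous_map (disc n) Y (q n i)" if "i \<in> I n" for i n
      using continuous_map_into_fulltopology[OF q_cont[OF that]] .
    show "q n (\<psi> n g i) x = \<phi> g (q n i x)" if "i \<in> I n" "g \<in> carrier G" "x \<in> topspace (disc n)" for i n g x
      using r_eq[of "fst i" "snd i" x n g] that by (cases i) (auto simp: \<psi>_def q_def top)
    show "\<exists>n. \<exists>i\<in>I n. \<exists>x\<in>topspace (disc n). sqrt (\<Sum>i<n. x i ^ 2) < 1 \<and> p = q n i x"
      if p: "p \<in> topspace Y" for p
    proof -
      obtain m where "p \<in> sk m" using p sk(4) by blast
      then show ?thesis using cover[of p m] by blast
    qed
    show "(n, i, x) = (m, j, y)"
      if i: "i \<in> I n" and x: "x \<in> topspace (disc n)" and x1: "sqrt (\<Sum>i<n. x i ^ 2) < 1"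
        and j: "j \<in> I m" and y: "y \<in> topspace (disc m)" and y1: "sqrt (\<Sum>i<m. y i ^ 2) < 1"
        and e: "q n i x = q m j y" for i n x j m y
    proof -
      have "n = m"
      proof (rule ccontr)
        assume "n \<noteq> m"
        then have "Suc n \<le> m \<or> Suc m \<le> n" by linarith
        then show False
          using q_int[OF i x x1] q_int[OF j y y1] e sk_mono[of "Suc n" m] sk_mono[of "Suc m" n] by auto
      qed
      moreover have "(fst i, snd i, x) = (fst j, snd j, y)"
        using bij_betw_imp_inj_on[OF r_bij[of n]]
      proof (rule inj_onD)
        show "r n (fst i, snd i, x) = r n (fst j, snd j, y)"
          using e \<open>n = m\<close> by (simp add: q_def case_prod_unfold)
      qed (use i j x y x1 y1 \<open>n = m\<close> in \<open>auto simp: top\<close>)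
      ultimately show ?thesis by (simp add: prod_eq_iff)
    qed
    show "\<exists>m<n. \<exists>j\<in>I m. \<exists>y\<in>topspace (disc m). sqrt (\<Sum>i<m. y i ^ 2) < 1 \<and> q n i x = q m j y"
      if "i \<in> I n" "x \<in> topspace (disc n)" "sqrt (\<Sum>i<n. x i ^ 2) = 1" for i n x
      by (rule cover) (use that r_bd[of "fst i" "snd i" x n] in \<open>auto simp: q_def top case_prod_unfold\<close>)
    show "closedin Y V"
      if V: "V \<subseteq> (\<Union>m<n. \<Union>i\<in>I m. q m i ` topspace (disc m))"
        and c: "\<And>m i. \<lbrakk>m < n; i \<in> I m\<rbrakk> \<Longrightarrow> closedin (disc m) {x \<in> topspace (disc m). q m i x \<in> V}" for V n
    proof (rule closed)
      have Vn: "V \<subseteq> sk n"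
      proof
        fix p assume "p \<in> V"
        then obtain m i x where "m < n" "i \<in> I m" "x \<in> topspace (disc m)" "p = q m i x"
          using V by blast
        then show "p \<in> sk n"
          using q_sk[of i m x] sk_mono[of "Suc m" n] by auto
      qed
      then show "V \<subseteq> topspace Y" using sk(4) by blast
      show "(\<forall>i\<in>I m. closedin (disc m) {x \<in> topspace (disc m). q m i x \<in> V}) \<or> V \<subseteq> sk m" for m
        using c[of m] Vn sk_mono[of n m] by (cases "m < n") auto
    qed
    show "closedin Y V"
      if V: "V \<subseteq> topspace Y"
        and c: "\<And>m i. i \<in> I m \<Longrightarrow> closedin (disc m) {x \<in> topspace (disc m). q m i x \<in> V}" for V
      by (rule closed[OF V]) (use c in blast)
  qed
  then show ?thesis by (rule that)
qed

section \<open>Points of a geometric realization\<close>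

abbreviation simplex_top :: "nat \<Rightarrow> (nat \<Rightarrow> real) topology" where
  "simplex_top n \<equiv> subtopology (powertop_real UNIV) (standard_simplex n)"

definition real_class ::
  "'s simplicial_set \<Rightarrow> (nat \<times> 's) \<times> (nat \<Rightarrow> real) \<Rightarrow> ((nat \<times> 's) \<times> (nat \<Rightarrow> real)) set" where
  "real_class X p = (simplex_glue X \<union> (simplex_glue X)\<inverse>)\<^sup>* `` {p}"

lemma geometric_realization_real_class:
  "geometric_realization X = quotient_topology (simplex_sum X) (real_class X)"
  by (simp add: geometric_realization_def real_class_def[abs_def])

lemma quotient_map_real_class: "quotient_map (simplex_sum X) (geometric_realization X) (real_class X)"
  by (simp add: geometric_realization_real_class quotient_map_quotient_topology)

lemma topspace_simplex_sum:
  "topspace (simplex_sum X) = {((n, \<sigma>), t). \<sigma> \<in> Simps X n \<and> t \<in> standard_simplex n}"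
  by (auto simp: simplex_sum_def)

lemma simplex_sum_alt:
  "simplex_sum X = sum_topology (\<lambda>(n, \<sigma>). simplex_top n) (SIGMA n:UNIV. Simps X n)"
  by (simp add: simplex_sum_def)

lemma topspace_geometric_realization:
  "topspace (geometric_realization X) =
     {real_class X ((n, \<sigma>), t) | n \<sigma> t. \<sigma> \<in> Simps X n \<and> t \<in> standard_simplex n}"
  by (auto simp: geometric_realization_real_class topspace_simplex_sum)

lemma real_class_in:
  "\<lbrakk>\<sigma> \<in> Simps X n; t \<in> standard_simplex n\<rbrakk> \<Longrightarrow> real_class X ((n, \<sigma>), t) \<in> topspace (geometric_realization X)"
  by (auto simp: topspace_geometric_realization)

lemma real_class_eq_iff:
  "real_class X p = real_class X p' \<longleftrightarrow> (p, p') \<in> (simplex_glue X \<union> (simplex_glue X)\<inverse>)\<^sup>*"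
proof -
  let ?R = "(simplex_glue X \<union> (simplex_glue X)\<inverse>)\<^sup>*"
  have "sym ?R"
    by (intro sym_rtrancl) (auto simp: sym_def)
  then have "equiv UNIV ?R"
    by (auto simp: equiv_def refl_on_def intro: trans_rtrancl)
  then show ?thesis
    unfolding real_class_def using eq_equiv_class_iff[of UNIV ?R p p'] by simp
qed

lemma self_in_real_class: "p \<in> real_class X p"
  by (simp add: real_class_def)

lemma in_real_class_iff: "p' \<in> real_class X p \<longleftrightarrow> real_class X p = real_class X p'"
  unfolding real_class_eq_iff by (simp add: real_class_def)

lemma real_class_pull:
  assumes "\<theta> \<in> simplex_maps m n" "\<sigma> \<in> Simps X n" "t \<in> standard_simplex m"
  shows "real_class X ((m, Pull X m n \<theta> \<sigma>), t) = real_class X ((n, \<sigma>), simplex_push m \<theta> t)"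
  unfolding real_class_eq_iff using assms by (intro r_into_rtrancl) (auto simp: simplex_glue_def)

text \<open>Induction along a zigzag of simplicial operators. The codomain of \<open>v\<close> is
  arbitrary: step functions, points of another realization and sets of lifts all occur.\<close>

lemma real_class_invariant:
  assumes v: "\<And>m n \<theta> \<sigma> t. \<lbrakk>\<theta> \<in> simplex_maps m n; \<sigma> \<in> Simps X n; t \<in> standard_simplex m\<rbrakk>
      \<Longrightarrow> v ((m, Pull X m n \<theta> \<sigma>), t) = v ((n, \<sigma>), simplex_push m \<theta> t)"
    and "real_class X p = real_class X p'"
  shows "v p = v p'"
proof -
  have "(p, p') \<in> (simplex_glue X \<union> (simplex_glue X)\<inverse>)\<^sup>*"
    using assms(2) by (simp add: real_class_eq_iff)
  then show ?thesis
  proof induction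
    case (step y z)
    then have "v y = v z"
      using v by (auto simp: simplex_glue_def)
    then show ?case using step.IH by simp
  qed simp
qed

lemma continuous_map_real_class:
  assumes "\<sigma> \<in> Simps X n"
  shows "continuous_map (simplex_top n) (geometric_realization X) (\<lambda>t. real_class X ((n, \<sigma>), t))"
proof -
  have "continuous_map (simplex_top n) (simplex_sum X) (\<lambda>t. ((n, \<sigma>), t))"
    using continuous_map_component_injection[of "(n, \<sigma>)" "SIGMA n:UNIV. Simps X n" "\<lambda>(n, \<sigma>). simplex_top n"] assms
    by (simp add: simplex_sum_alt)
  then show ?thesis
    using continuous_map_compose[OF _ quotient_imp_continuous_map[OF quotient_map_real_class]]
    by (fastforce simp: o_def)
qed

lemma closedin_geometric_realization:
  assumes "V \<subseteq> topspace (geometric_realization X)"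
    and "\<And>n \<sigma>. \<sigma> \<in> Simps X n \<Longrightarrow> closedin (simplex_top n) {t \<in> standard_simplex n. real_class X ((n, \<sigma>), t) \<in> V}"
  shows "closedin (geometric_realization X) V"
proof -
  have "closedin (simplex_sum X) {p \<in> topspace (simplex_sum X). real_class X p \<in> V}"
    unfolding simplex_sum_alt closedin_sum_topology using assms(2) by auto
  then show ?thesis
    using quotient_map_real_class[of X] assms(1) unfolding quotient_map_closedin by blast
qed

subsection \<open>Simplex coordinates\<close>

lemma continuous_map_simplex_component: "continuous_map (simplex_top n) euclideanreal (\<lambda>x. x i)"
  by (intro continuous_map_from_subtopology continuous_map_product_projection UNIV_I)

lemma continuous_map_into_simplex:
  "continuous_map X (simplex_top n) f \<longleftrightarrow>
     (\<forall>i. continuous_map X euclideanreal (\<lambda>x. f x i)) \<and> f ` topspace X \<subseteq> standard_simplex n"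
  by (auto simp: continuous_map_in_subtopology continuous_map_componentwise_UNIV)

lemma standard_simplexI:
  assumes "\<And>i. 0 \<le> t i" "\<And>i. n < i \<Longrightarrow> t i = 0" "sum t {..n} = 1"
  shows "t \<in> standard_simplex n"
proof -
  have "t i \<le> 1" for i
  proof (cases "i \<le> n")
    case True
    then have "t i \<le> sum t {..n}"
      using assms(1) by (intro member_le_sum) auto
    then show ?thesis using assms(3) by simp
  qed (use assms(2) in simp)
  then show ?thesis using assms by (auto simp: standard_simplex_def)
qed

lemma standard_simplexD:
  assumes "t \<in> standard_simplex n"
  shows "\<And>i. 0 \<le> t i" "\<And>i. n < i \<Longrightarrow> t i = 0" "sum t {..n} = 1"
  using assms by (auto simp: standard_simplex_def)

lemma sum_simplex_push:
  assumes "finite J"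
  shows "sum (simplex_push m \<theta> t) J = sum t {i. i \<le> m \<and> \<theta> i \<in> J}"
proof -
  have "sum (simplex_push m \<theta> t) J = (\<Sum>j\<in>J. sum t {i \<in> {i. i \<le> m \<and> \<theta> i \<in> J}. \<theta> i = j})"
    unfolding simplex_push_def by (intro sum.cong) auto
  also have "\<dots> = sum t {i. i \<le> m \<and> \<theta> i \<in> J}"
    using assms by (intro sum.group) auto
  finally show ?thesis .
qed

lemma simplex_push_in:
  assumes "\<theta> \<in> simplex_maps m n" "t \<in> standard_simplex m"
  shows "simplex_push m \<theta> t \<in> standard_simplex n"
proof (rule standard_simplexI)
  show "0 \<le> simplex_push m \<theta> t i" for i
    using standard_simplexD(1)[OF assms(2)] by (auto simp: simplex_push_def intro: sum_nonneg)
  show "simplex_push m \<theta> t i = 0" if "n < i" for i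
  proof -
    have "{k. k \<le> m \<and> \<theta> k = i} = {}"
      using assms(1) that by (force simp: simplex_maps_def)
    then show ?thesis by (simp only: simplex_push_def sum.empty)
  qed
  have "{k. k \<le> m \<and> \<theta> k \<in> {..n}} = {..m}"
    using assms(1) by (auto simp: simplex_maps_def)
  then show "sum (simplex_push m \<theta> t) {..n} = 1"
    using standard_simplexD(3)[OF assms(2)] by (simp only: sum_simplex_push finite_atMost)
qed

lemma continuous_map_simplex_push:
  assumes "\<theta> \<in> simplex_maps m n"
  shows "continuous_map (simplex_top m) (simplex_top n) (simplex_push m \<theta>)"
  using simplex_push_in[OF assms]
  by (auto simp: continuous_map_into_simplex simplex_push_def
      intro!: continuous_map_sum continuous_map_simplex_component)

text \<open>A point \<open>t\<close> of the simplex partitions \<open>[0, 1)\<close> into consecutive half-open intervals of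
  lengths \<open>t 0, t 1, \<dots>\<close>; \<open>step_index t s\<close> is the index of the interval containing \<open>s\<close>.\<close>

definition step_index :: "(nat \<Rightarrow> real) \<Rightarrow> real \<Rightarrow> nat" where
  "step_index t s = (LEAST i. s < sum t {..i})"

lemma step_index:
  assumes t: "t \<in> standard_simplex n" and s: "s < 1"
  shows "s < sum t {..step_index t s}" "step_index t s \<le> n"
    "\<And>i. i < step_index t s \<Longrightarrow> sum t {..i} \<le> s"
proof -
  have *: "s < sum t {..n}"
    using standard_simplexD(3)[OF t] s by simp
  then show "s < sum t {..step_index t s}" "step_index t s \<le> n"
    unfolding step_index_def by (rule LeastI, intro Least_le)
  show "sum t {..i} \<le> s" if "i < step_index t s" for i
    using not_less_Least[OF that[unfolded step_index_def]] by simp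
qed

lemma step_index_eqI:
  assumes t: "t \<in> standard_simplex n" and "sum t {..<i} \<le> s" "s < sum t {..i}"
  shows "step_index t s = i"
  unfolding step_index_def
proof (rule Least_equality)
  fix j assume j: "s < sum t {..j}"
  show "i \<le> j"
  proof (rule ccontr)
    assume "\<not> i \<le> j"
    then have "sum t {..j} \<le> sum t {..<i}"
      using standard_simplexD(1)[OF t] by (intro sum_mono2) auto
    then show False using j assms(2) by simp
  qed
qed (rule assms(3))

text \<open>A monotone \<open>\<theta>\<close> glues consecutive intervals together and gives those
  outside its image length \<open>0\<close>. The interval around \<open>s\<close> is only
  relabelled, which is why labelled intervals are an invariant of points.\<close>

lemma step_index_push:
  assumes \<theta>: "\<theta> \<in> simplex_maps m n" and t: "t \<in> standard_simplex m" and s: "0 \<le> s" "s < 1"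
  shows "step_index (simplex_push m \<theta> t) s = \<theta> (step_index t s)"
proof -
  let ?i = "step_index t s"
  note i = step_index[OF t s(2)]
  have mono: "\<theta> a \<le> \<theta> b" if "a \<le> b" "b \<le> m" for a b
    using \<theta> that by (auto simp: simplex_maps_def intro: mono_onD)
  show ?thesis
  proof (rule step_index_eqI[OF simplex_push_in[OF \<theta> t]])
    have "sum t {k. k \<le> m \<and> \<theta> k \<in> {..<\<theta> ?i}} \<le> sum t {..<?i}"
    proof (rule sum_mono2)
      have "k < ?i" if "k \<le> m" "\<theta> k < \<theta> ?i" for k
      proof (rule ccontr)
        assume "\<not> k < ?i"
        then show False using mono[of ?i k] that by simp
      qed
      then show "{k. k \<le> m \<and> \<theta> k \<in> {..<\<theta> ?i}} \<subseteq> {..<?i}" by auto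
    qed (use standard_simplexD(1)[OF t] in auto)
    \<comment> \<open>For \<open>?i = 0\<close> the sum is empty and the claim is
      \<open>0 \<le> s\<close>; otherwise \<open>?i - 1\<close> lies below the least index whose
      partial sum exceeds \<open>s\<close>.\<close>
    also have "\<dots> \<le> s"
      using i(3)[of "?i - 1"] s(1) by (cases ?i) (auto simp: lessThan_Suc_atMost)
    finally show "sum (simplex_push m \<theta> t) {..<\<theta> ?i} \<le> s"
      by (simp only: sum_simplex_push finite_lessThan)
    have "s < sum t {..?i}" by (rule i)
    also have "\<dots> \<le> sum t {k. k \<le> m \<and> \<theta> k \<in> {..\<theta> ?i}}"
      using mono i(2) standard_simplexD(1)[OF t] by (intro sum_mono2) auto
    finally show "s < sum (simplex_push m \<theta> t) {..\<theta> ?i}"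
      by (simp only: sum_simplex_push finite_atMost)
  qed
qed

lemma continuous_map_Min:
  fixes f :: "'a \<Rightarrow> 'b \<Rightarrow> real"
  assumes "finite A" "A \<noteq> {}" "\<And>a. a \<in> A \<Longrightarrow> continuous_map X euclideanreal (\<lambda>x. f x a)"
  shows "continuous_map X euclideanreal (\<lambda>x. Min (f x ` A))"
  using assms
proof (induction A rule: finite_ne_induct)
  case (insert a A)
  then have "continuous_map X euclideanreal (\<lambda>x. min (f x a) (Min (f x ` A)))"
    by (intro continuous_map_real_min) auto
  then show ?case using insert by simp
qed simp

text \<open>Scaling about the barycentre, whose coordinates are all \<open>1 / (n + 1)\<close>.\<close>

lemma gauged_simplex:
  "gauged (simplex_top n) (\<lambda>t. 1 - (real n + 1) * Min (t ` {..n}))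
     (\<lambda>t l i. if i \<le> n then 1 / (real n + 1) + (t i - 1 / (real n + 1)) / l else 0)"
  (is "gauged _ ?N ?S")
proof -
  let ?D = "subtopology (prod_topology (simplex_top n) euclideanreal) {(t, l). ?N t \<le> l \<and> 0 < l \<and> l \<le> 1}"
  let ?b = "1 / (real n + 1)"
  have le: "Min (t ` {..n}) \<le> t i" if "i \<le> n" for t :: "nat \<Rightarrow> real" and i
    using that by (intro Min_le) auto
  have N01: "0 \<le> ?N t \<and> ?N t \<le> 1" if t: "t \<in> standard_simplex n" for t
  proof -
    have "(real n + 1) * Min (t ` {..n}) = (\<Sum>i\<le>n. Min (t ` {..n}))"
      by simp
    also have "\<dots> \<le> sum t {..n}"
      using le by (intro sum_mono) auto
    finally have "(real n + 1) * Min (t ` {..n}) \<le> 1"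
      using standard_simplexD(3)[OF t] by simp
    moreover have "0 \<le> Min (t ` {..n})"
      using standard_simplexD(1)[OF t] by (subst Min_ge_iff) auto
    ultimately show ?thesis by simp
  qed
  have S_in: "?S t l \<in> standard_simplex n"
    if t: "t \<in> standard_simplex n" and l: "?N t \<le> l" "0 < l" for t l
  proof (rule standard_simplexI)
    show "0 \<le> ?S t l i" for i
    proof (cases "i \<le> n")
      case True
      \<comment> \<open>The gauge is the greatest of the relative shortfalls
        \<open>1 - (real n + 1) * t i\<close> from the barycentric value. If all are at most
        \<open>l\<close>, division by \<open>l\<close> leaves them at most \<open>1\<close>, so the
        scaled coordinates stay nonnegative.\<close>
      have "1 - (real n + 1) * t i \<le> ?N t"
        using le[OF True, of t] by (simp add: mult_left_mono)
      then have "1 - (real n + 1) * t i \<le> l" using l(1) by linarith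
      then have "(1 - (real n + 1) * t i) / (real n + 1) \<le> l / (real n + 1)"
        by (rule divide_right_mono) simp
      then have "- ?b * l \<le> t i - ?b"
        by (simp add: diff_divide_distrib)
      then have "- ?b \<le> (t i - ?b) / l"
        using l(2) by (simp add: pos_le_divide_eq)
      then show ?thesis using True by simp
    qed simp
    have "sum (?S t l) {..n} = (\<Sum>i\<le>n. ?b + (t i - ?b) / l)"
      by (intro sum.cong) auto
    also have "\<dots> = (\<Sum>i\<le>n. ?b) + (\<Sum>i\<le>n. t i - ?b) / l"
      by (simp add: sum.distrib sum_divide_distrib)
    also have "\<dots> = 1"
    proof -
      have "(\<Sum>i\<le>n. ?b) = 1"
        by (simp add: add.commute)
      then show ?thesis
        using standard_simplexD(3)[OF t] by (simp only: sum_subtractf) simp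
    qed
    finally show "sum (?S t l) {..n} = 1" .
  qed auto
  have N_S: "?N (?S t l) = ?N t / l" if "0 < l" for t l
  proof -
    \<comment> \<open>The scaling acts on every coordinate by the same increasing function, which
      commutes with the minimum.\<close>
    have mono: "mono (\<lambda>x. ?b + (x - ?b) / l)"
      using that by (intro monoI) (simp add: divide_right_mono)
    have "Min (?S t l ` {..n}) = Min ((\<lambda>x. ?b + (x - ?b) / l) ` (t ` {..n}))"
      unfolding image_image by (intro arg_cong[of _ _ Min] image_cong) auto
    also have "\<dots> = ?b + (Min (t ` {..n}) - ?b) / l"
      by (rule mono_Min_commute[OF mono, symmetric]) auto
    finally have *: "Min (?S t l ` {..n}) = ?b + (Min (t ` {..n}) - ?b) / l" .
    have "1 - c * (1 / c + (\<mu> - 1 / c) / l) = (1 - c * \<mu>) / l" if "0 < c" for c \<mu> :: real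
      using that \<open>0 < l\<close> by (simp add: field_simps)
    then show ?thesis
      unfolding * by simp
  qed
  have "continuous_map ?D euclideanreal (\<lambda>w. ?S (fst w) (snd w) i)" for i
  proof (cases "i \<le> n")
    case True
    have "continuous_map ?D euclideanreal (\<lambda>w. fst w i)"
      using continuous_map_compose[OF continuous_map_fst continuous_map_simplex_component]
      by (intro continuous_map_from_subtopology) (simp add: o_def)
    moreover have "continuous_map ?D euclideanreal snd"
      by (intro continuous_map_from_subtopology continuous_map_snd)
    ultimately have "continuous_map ?D euclideanreal (\<lambda>w. ?b + (fst w i - ?b) / snd w)"
      by (intro continuous_intros) auto
    then show ?thesis using True by simp
  qed simp
  then have "continuous_map ?D (simplex_top n) (\<lambda>(t, l). ?S t l)"
    using S_in by (auto simp: continuous_map_into_simplex case_prod_unfold)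
  moreover have "continuous_map (simplex_top n) euclideanreal ?N"
    by (intro continuous_intros continuous_map_Min continuous_map_simplex_component) auto
  moreover have "?S t 1 = t" if "t \<in> standard_simplex n" for t
    using standard_simplexD(2)[OF that] by auto
  ultimately show ?thesis
    using N01 N_S unfolding gauged_def by simp
qed

lemma simplex_gauge_lt_1_iff:
  "1 - (real n + 1) * Min (t ` {..n}) < 1 \<longleftrightarrow> (\<forall>i\<le>n. 0 < t i)"
proof -
  have "1 - (real n + 1) * Min (t ` {..n}) < 1 \<longleftrightarrow> 0 < Min (t ` {..n})"
    by (simp add: zero_less_mult_iff)
  also have "\<dots> \<longleftrightarrow> (\<forall>i\<le>n. 0 < t i)"
    by (subst Min_gr_iff) auto
  finally show ?thesis .
qed

text \<open>The coface map that omits the vertex \<open>i\<close>. Its companion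
  \<open>merge i\<close> is the codegeneracy that takes the value \<open>i\<close> twice.\<close>

definition skip :: "nat \<Rightarrow> nat \<Rightarrow> nat" where
  "skip i k = (if k < i then k else Suc k)"

definition merge :: "nat \<Rightarrow> nat \<Rightarrow> nat" where
  "merge i k = (if k \<le> i then k else k - 1)"

lemma skip_in: "i \<le> Suc m \<Longrightarrow> skip i \<in> simplex_maps m (Suc m)"
  by (auto simp: simplex_maps_def skip_def intro!: mono_onI)

lemma merge_in: "i \<le> m \<Longrightarrow> merge i \<in> simplex_maps (Suc m) m"
  by (auto simp: simplex_maps_def merge_def intro!: mono_onI)

lemma skip_face:
  assumes t: "t \<in> standard_simplex (Suc m)" and i: "i \<le> Suc m" "t i = 0"
  shows "t \<circ> skip i \<in> standard_simplex m" "simplex_push m (skip i) (t \<circ> skip i) = t"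
proof -
  have inj: "inj_on (skip i) A" for A
    by (auto simp: inj_on_def skip_def split: if_splits)
  have im: "skip i ` {..m} = {..Suc m} - {i}"
  proof
    show "skip i ` {..m} \<subseteq> {..Suc m} - {i}"
      by (auto simp: skip_def)
    show "{..Suc m} - {i} \<subseteq> skip i ` {..m}"
    proof
      fix j assume j: "j \<in> {..Suc m} - {i}"
      show "j \<in> skip i ` {..m}"
      proof (cases "j < i")
        case True
        then show ?thesis using j i(1) by (intro image_eqI[of _ _ j]) (auto simp: skip_def)
      next
        case False
        then show ?thesis using j by (intro image_eqI[of _ _ "j - 1"]) (auto simp: skip_def)
      qed
    qed
  qed
  show "t \<circ> skip i \<in> standard_simplex m"
  proof (rule standard_simplexI)
    have "sum (t \<circ> skip i) {..m} = sum t ({..Suc m} - {i})"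
      unfolding im[symmetric] by (simp add: sum.reindex[OF inj])
    also have "\<dots> = 1"
      using standard_simplexD(3)[OF t] i by (simp add: sum_diff1)
    finally show "sum (t \<circ> skip i) {..m} = 1" .
  qed (use standard_simplexD[OF t] i in \<open>auto simp: skip_def\<close>)
  have "simplex_push m (skip i) (t \<circ> skip i) j = t j" for j
  proof (cases "j \<in> {..Suc m} - {i}")
    case True
    then obtain k where k: "k \<le> m" "j = skip i k"
      using im by blast
    then have "{k. k \<le> m \<and> skip i k = j} = {k}"
      using inj[of UNIV] by (auto dest: injD)
    then show ?thesis using k by (simp add: simplex_push_def)
  next
    case False
    then have e: "{k. k \<le> m \<and> skip i k = j} = {}"
      using im by auto
    show ?thesis
      unfolding simplex_push_def e using False i standard_simplexD(2)[OF t] by auto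
  qed
  then show "simplex_push m (skip i) (t \<circ> skip i) = t" by blast
qed

section \<open>The nerve of a \<open>G\<close>-set preordered by stabilizers\<close>

locale stabilizer_nerve = group G for G :: "('g, 'b) monoid_scheme" (structure) +
  fixes P :: "'p set" and act :: "'g \<Rightarrow> 'p \<Rightarrow> 'p"
  assumes act_closed: "\<lbrakk>g \<in> carrier G; c \<in> P\<rbrakk> \<Longrightarrow> act g c \<in> P"
    and act_one: "c \<in> P \<Longrightarrow> act \<one> c = c"
    and act_mult: "\<lbrakk>g \<in> carrier G; h \<in> carrier G; c \<in> P\<rbrakk> \<Longrightarrow> act (g \<otimes> h) c = act g (act h c)"
begin

definition stab :: "'p \<Rightarrow> 'g set" where
  "stab c = {g \<in> carrier G. act g c = c}"

text \<open>A preorder has at most one arrow between two objects. The values on arrows, which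
  \<open>nerve\<close> records, are therefore left out and a simplex is its word of
  vertices.\<close>

definition E :: "(nat \<Rightarrow> 'p) simplicial_set" where
  "E = \<lparr>Simps = (\<lambda>n. {c \<in> {..n} \<rightarrow>\<^sub>E P. \<forall>i j. i \<le> j \<and> j \<le> n \<longrightarrow> stab (c i) \<subseteq> stab (c j)}),
        Pull = (\<lambda>m n \<theta> c. restrict (\<lambda>i. c (\<theta> i)) {..m})\<rparr>"

abbreviation W :: "nat \<Rightarrow> (nat \<Rightarrow> 'p) set" where
  "W \<equiv> Simps E"

abbreviation XE :: "((nat \<times> (nat \<Rightarrow> 'p)) \<times> (nat \<Rightarrow> real)) set topology" where
  "XE \<equiv> geometric_realization E"

definition cell :: "nat \<Rightarrow> (nat \<Rightarrow> 'p) \<Rightarrow> (nat \<Rightarrow> real) \<Rightarrow> ((nat \<times> (nat \<Rightarrow> 'p)) \<times> (nat \<Rightarrow> real)) set" where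
  "cell n c t = real_class E ((n, c), t)"

lemma W_iff: "c \<in> W n \<longleftrightarrow> c \<in> {..n} \<rightarrow>\<^sub>E P \<and> (\<forall>i j. i \<le> j \<and> j \<le> n \<longrightarrow> stab (c i) \<subseteq> stab (c j))"
  by (simp add: E_def)

lemma W_in: "\<lbrakk>c \<in> W n; i \<le> n\<rbrakk> \<Longrightarrow> c i \<in> P"
  by (auto simp: W_iff PiE_iff)

lemma W_mono: "\<lbrakk>c \<in> W n; i \<le> j; j \<le> n\<rbrakk> \<Longrightarrow> stab (c i) \<subseteq> stab (c j)"
  by (simp add: W_iff)

lemma Pull_E: "Pull E m n \<theta> c = restrict (\<lambda>i. c (\<theta> i)) {..m}"
  by (simp add: E_def)

lemma Pull_in: "\<lbrakk>\<theta> \<in> simplex_maps m n; c \<in> W n\<rbrakk> \<Longrightarrow> restrict (\<lambda>i. c (\<theta> i)) {..m} \<in> W m"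
  by (auto simp: W_iff simplex_maps_def Pi_iff PiE_iff mono_on_def)

lemma cell_pull:
  "\<lbrakk>\<theta> \<in> simplex_maps m n; c \<in> W n; t \<in> standard_simplex m\<rbrakk>
    \<Longrightarrow> cell m (restrict (\<lambda>i. c (\<theta> i)) {..m}) t = cell n c (simplex_push m \<theta> t)"
  using real_class_pull[of \<theta> m n c E t] by (simp add: cell_def Pull_E)

lemma cell_cases:
  assumes "p \<in> topspace XE"
  obtains n c t where "c \<in> W n" "t \<in> standard_simplex n" "p = cell n c t"
  using assms by (auto simp: topspace_geometric_realization cell_def)

lemma cell_in_XE: "\<lbrakk>c \<in> W n; t \<in> standard_simplex n\<rbrakk> \<Longrightarrow> cell n c t \<in> topspace XE"
  by (simp add: cell_def real_class_in)

text \<open>The invariant of points: the letters of the word label the intervals cut out by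
  \<open>t\<close>. Restriction to \<open>[0, 1)\<close> makes equality of functions the right
  notion, since \<open>step_index\<close> has no meaning from \<open>1\<close> onwards.\<close>

definition step_function :: "(nat \<Rightarrow> 'p) \<Rightarrow> (nat \<Rightarrow> real) \<Rightarrow> real \<Rightarrow> 'p" where
  "step_function c t = restrict (\<lambda>s. c (step_index t s)) {0..<1}"

lemma step_function_cell:
  assumes "cell n c t = cell m d u"
  shows "step_function c t = step_function d u"
proof -
  have "(\<lambda>((n, c), t). step_function c t) ((n, c), t) = (\<lambda>((n, c), t). step_function c t) ((m, d), u)"
  proof (rule real_class_invariant[where X = E])
    fix m n \<theta> c t
    assume *: "\<theta> \<in> simplex_maps m n" "c \<in> W n" "t \<in> standard_simplex m"
    have "restrict (\<lambda>i. c (\<theta> i)) {..m} (step_index t s) = c (step_index (simplex_push m \<theta> t) s)"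
      if "s \<in> {0..<1}" for s
      using that step_index_push[OF *(1,3), of s] step_index(2)[OF *(3), of s] by simp
    then show "(\<lambda>((n, c), t). step_function c t) ((m, Pull E m n \<theta> c), t) =
        (\<lambda>((n, c), t). step_function c t) ((n, c), simplex_push m \<theta> t)"
      by (auto simp: step_function_def Pull_E)
  qed (use assms in \<open>simp add: cell_def\<close>)
  then show ?thesis by simp
qed

text \<open>The nondegenerate simplices. Only neighbours are compared, because in a preorder a word
  may come back to an earlier letter.\<close>

definition reduced :: "nat \<Rightarrow> (nat \<Rightarrow> 'p) set" where
  "reduced n = {c \<in> W n. \<forall>i<n. c i \<noteq> c (Suc i)}"

lemma cell_skip:
  assumes c: "c \<in> W (Suc m)" and t: "t \<in> standard_simplex (Suc m)" and i: "i \<le> Suc m" "t i = 0"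
  shows "cell (Suc m) c t = cell m (restrict (\<lambda>k. c (skip i k)) {..m}) (t \<circ> skip i)"
  using cell_pull[OF skip_in[OF i(1)] c skip_face(1)[OF t i]] skip_face(2)[OF t i] by simp

lemma cell_merge:
  assumes c: "c \<in> W (Suc m)" and t: "t \<in> standard_simplex (Suc m)" and i: "i \<le> m" "c i = c (Suc i)"
  shows "cell (Suc m) c t =
    cell m (restrict (\<lambda>k. c (skip i k)) {..m}) (simplex_push (Suc m) (merge i) t)"
proof -
  let ?d = "restrict (\<lambda>k. c (skip i k)) {..m}"
  have d: "?d \<in> W m"
    using Pull_in[OF skip_in c] i by simp
  have "c k = ?d (merge i k)" if "k \<le> Suc m" for k
    using that i by (cases "k = Suc i") (auto simp: merge_def skip_def)
  moreover have "c k = undefined" if "\<not> k \<le> Suc m" for k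
    using c that by (auto simp: W_iff PiE_iff extensional_def)
  ultimately have "restrict (\<lambda>k. ?d (merge i k)) {..Suc m} = c"
    by (auto simp del: restrict_apply simp: fun_eq_iff restrict_def)
  then show ?thesis
    using cell_pull[OF merge_in[OF i(1)] d t] by simp
qed

text \<open>A repeated neighbour is merged, a vertex of weight \<open>0\<close> is dropped, and each
  lowers the dimension. The last clause, that the dimension really falls, is what places boundary
  points in lower cells.\<close>

lemma cell_reduce:
  assumes "c \<in> W n" "t \<in> standard_simplex n"
  shows "\<exists>m\<le>n. \<exists>d\<in>reduced m. \<exists>u\<in>standard_simplex m. (\<forall>i\<le>m. 0 < u i) \<and> cell n c t = cell m d u \<and>
    (c \<notin> reduced n \<or> \<not> (\<forall>i\<le>n. 0 < t i) \<longrightarrow> m < n)"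
  using assms
proof (induction n arbitrary: c t rule: less_induct)
  case (less n)
  have step: ?case if n: "n = Suc n'" and d: "d \<in> W n'" "u \<in> standard_simplex n'" "cell n c t = cell n' d u"
    for n' d u
  proof -
    obtain m e v where "m \<le> n'" "e \<in> reduced m" "v \<in> standard_simplex m" "\<forall>i\<le>m. 0 < v i" "cell n' d u = cell m e v"
      using less.IH[of n' d u] d(1,2) n by blast
    then show ?thesis using d(3) n by (intro exI[of _ m]) auto
  qed
  consider "c \<in> reduced n" "\<forall>i\<le>n. 0 < t i" | "c \<notin> reduced n" | i where "i \<le> n" "t i = 0"
    using standard_simplexD(1)[OF less.prems(2)] by (metis less_eq_real_def)
  then show ?case
  proof cases
    case 1
    then show ?thesis using less.prems by blast
  next
    case 2
    then obtain i where i: "i < n" "c i = c (Suc i)"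
      using less.prems by (auto simp: reduced_def)
    obtain n' where n: "n = Suc n'"
      using i by (cases n) auto
    show ?thesis
      using cell_merge[of c n' t i] Pull_in[OF skip_in, of i n' c] simplex_push_in[OF merge_in, of i n' t]
        less.prems i n by (intro step[OF n]) auto
  next
    case 3
    have "n \<noteq> 0"
    proof
      assume "n = 0"
      then show False using standard_simplexD(3)[OF less.prems(2)] 3 by simp
    qed
    then obtain n' where n: "n = Suc n'"
      by (cases n) auto
    show ?thesis
      using cell_skip[of c n' t i] Pull_in[OF skip_in, of i n' c] skip_face(1)[of t n' i]
        less.prems 3 n by (intro step[OF n]) auto
  qed
qed

lemma step_function_value:
  assumes "t \<in> standard_simplex n" "sum t {..<k} \<le> s" "s < sum t {..k}" "0 \<le> s" "s < 1"
  shows "step_function c t s = c k"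
  using step_index_eqI[OF assms(1-3)] assms(4,5) by (simp add: step_function_def)

text \<open>With positive weights and distinct neighbours the step function jumps at every
  breakpoint, so word and weights can be recovered from left to right. The induction carries the
  left end of the \<open>k\<close>-th interval and its label.\<close>

lemma reduced_breakpoints:
  assumes c: "c \<in> reduced n" and t: "t \<in> standard_simplex n" "\<forall>i\<le>n. 0 < t i"
    and d: "d \<in> reduced m" and u: "u \<in> standard_simplex m" "\<forall>i\<le>m. 0 < u i"
    and eq: "step_function c t = step_function d u"
  shows "k \<le> n \<Longrightarrow> k \<le> m \<and> sum t {..<k} = sum u {..<k} \<and> c k = d k"
proof (induction k)
  have lt1: "sum t {..<k} < 1" if "k \<le> n" for k
  proof -
    have "sum t {..<k} < sum t {..k}"
      using t(2) that by (simp flip: lessThan_Suc_atMost)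
    also have "\<dots> \<le> sum t {..n}"
      using that standard_simplexD(1)[OF t(1)] by (intro sum_mono2) auto
    finally show ?thesis using standard_simplexD(3)[OF t(1)] by simp
  qed
  have lt1': "sum u {..<k} < 1" if "k \<le> m" for k
  proof -
    have "sum u {..<k} < sum u {..k}"
      using u(2) that by (simp flip: lessThan_Suc_atMost)
    also have "\<dots> \<le> sum u {..m}"
      using that standard_simplexD(1)[OF u(1)] by (intro sum_mono2) auto
    finally show ?thesis using standard_simplexD(3)[OF u(1)] by simp
  qed
  have nn: "0 \<le> sum t A" "0 \<le> sum u A" for A
    using standard_simplexD(1)[OF t(1)] standard_simplexD(1)[OF u(1)] by (auto intro: sum_nonneg)
  have val: "step_function c t s = c k" if "k \<le> n" "sum t {..<k} \<le> s" "s < sum t {..<Suc k}" "s < 1" for k s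
    using step_function_value[OF t(1) that(2), of c] that nn(1)[of "{..<k}"] by (simp add: lessThan_Suc_atMost)
  have val': "step_function d u s = d k" if "k \<le> m" "sum u {..<k} \<le> s" "s < sum u {..<Suc k}" "s < 1" for k s
    using step_function_value[OF u(1) that(2), of d] that nn(2)[of "{..<k}"] by (simp add: lessThan_Suc_atMost)
  {
    case 0
    have "step_function c t 0 = c 0" "step_function d u 0 = d 0"
      using val[of 0 0] val'[of 0 0] t(2) u(2) by auto
    then show ?case using eq by simp
  next
    case (Suc k)
    then have k: "k < n" "k \<le> m" "sum t {..<k} = sum u {..<k}" "c k = d k"
      by auto
    let ?b = "sum t {..<Suc k}" and ?b' = "sum u {..<Suc k}"
    have b1: "?b < 1" using lt1[OF Suc.prems] .
    have cb: "step_function c t ?b = c (Suc k)"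
      using val[of "Suc k" ?b] t(2) b1 Suc.prems by simp
    have ab: "sum t {..<k} < ?b" "sum u {..<k} < ?b'"
      using t(2) u(2) k by auto
    have ck: "c k \<noteq> c (Suc k)"
      using c k(1) by (simp add: reduced_def)
    \<comment> \<open>At \<open>?b\<close> the function has jumped to \<open>c (Suc k)\<close>; if
      the interval of \<open>u\<close> lasted longer, its value would still be
      \<open>d k = c k\<close>. The reverse inequality is excluded below in the same way.\<close>
    have "\<not> ?b < ?b'"
    proof
      assume "?b < ?b'"
      then have "step_function d u ?b = d k"
        using val'[OF k(2), of ?b] ab(1) b1 k(3) by simp
      then show False using cb eq k(4) ck by simp
    qed
    then have b': "?b' \<le> ?b" by simp
    \<comment> \<open>If \<open>k\<close> were the last index of \<open>d\<close>, its interval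
      would extend to \<open>1\<close>, past \<open>?b\<close>.\<close>
    have km: "k < m"
    proof (rule ccontr)
      assume "\<not> k < m"
      then have "?b' = 1"
        using k(2) standard_simplexD(3)[OF u(1)] by (simp add: lessThan_Suc_atMost)
      then show False using b' b1 by simp
    qed
    then have db: "step_function d u ?b' = d (Suc k)"
      using val'[of "Suc k" ?b'] u(2) b' b1 by simp
    have "\<not> ?b' < ?b"
    proof
      assume "?b' < ?b"
      then have "step_function c t ?b' = c k"
        using val[of k ?b'] ab(2) b1 k by simp
      moreover have "d k \<noteq> d (Suc k)"
        using d km by (simp add: reduced_def)
      ultimately show False using db eq k(4) by simp
    qed
    then have "?b = ?b'" using b' by simp
    then show ?case using km cb db eq by simp
  }
qed

lemma reduced_unique:
  assumes c: "c \<in> reduced n" and t: "t \<in> standard_simplex n" "\<forall>i\<le>n. 0 < t i"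
    and d: "d \<in> reduced m" and u: "u \<in> standard_simplex m" "\<forall>i\<le>m. 0 < u i"
    and eq: "step_function c t = step_function d u"
  shows "(n, c, t) = (m, d, u)"
proof -
  note B = reduced_breakpoints[OF c t d u eq]
  have nm: "n = m"
    using B[of n] reduced_breakpoints[OF d u c t eq[symmetric], of m] by simp
  have "c k = d k" for k
    using B[of k] c d nm by (cases "k \<le> n") (auto simp: reduced_def W_iff PiE_iff extensional_def)
  moreover have "t k = u k" for k
  proof -
    have S: "sum t {..<Suc k} = sum u {..<Suc k}" if "k \<le> n"
    proof (cases "k = n")
      case True
      then show ?thesis
        using standard_simplexD(3)[OF t(1)] standard_simplexD(3)[OF u(1)] nm by (simp add: lessThan_Suc_atMost)
    next
      case False
      then show ?thesis using B[of "Suc k"] that by simp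
    qed
    show ?thesis
      using S B[of k] standard_simplexD(2)[OF t(1), of k] standard_simplexD(2)[OF u(1), of k] nm
      by (cases "k \<le> n") auto
  qed
  ultimately show ?thesis using nm by auto
qed

text \<open>Completeness of the invariant: both points are brought to normal form, and normal forms
  are determined by their step functions. Identities in the realization can then be checked without
  exhibiting a zigzag.\<close>

lemma cell_eq_iff:
  assumes "c \<in> W n" "t \<in> standard_simplex n" "d \<in> W m" "u \<in> standard_simplex m"
  shows "cell n c t = cell m d u \<longleftrightarrow> step_function c t = step_function d u"
proof
  assume eq: "step_function c t = step_function d u"
  obtain n' c' t' where 1: "c' \<in> reduced n'" "t' \<in> standard_simplex n'" "\<forall>i\<le>n'. 0 < t' i" "cell n c t = cell n' c' t'"
    using cell_reduce[OF assms(1,2)] by blast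
  obtain m' d' u' where 2: "d' \<in> reduced m'" "u' \<in> standard_simplex m'" "\<forall>i\<le>m'. 0 < u' i" "cell m d u = cell m' d' u'"
    using cell_reduce[OF assms(3,4)] by blast
  have "step_function c' t' = step_function d' u'"
    using step_function_cell[OF 1(4)] step_function_cell[OF 2(4)] eq by simp
  then have "(n', c', t') = (m', d', u')"
    by (rule reduced_unique[OF 1(1-3) 2(1-3)])
  then show "cell n c t = cell m d u" using 1(4) 2(4) by simp
qed (rule step_function_cell)

subsection \<open>The group action\<close>

definition wact :: "nat \<Rightarrow> 'g \<Rightarrow> (nat \<Rightarrow> 'p) \<Rightarrow> nat \<Rightarrow> 'p" where
  "wact n g c = restrict (\<lambda>i. act g (c i)) {..n}"

definition XE_act :: "'g \<Rightarrow> ((nat \<times> (nat \<Rightarrow> 'p)) \<times> (nat \<Rightarrow> real)) set \<Rightarrow> ((nat \<times> (nat \<Rightarrow> 'p)) \<times> (nat \<Rightarrow> real)) set" where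
  "XE_act g C = (case SOME p. p \<in> C of ((n, c), t) \<Rightarrow> cell n (wact n g c) t)"

lemma act_inv: "\<lbrakk>g \<in> carrier G; c \<in> P\<rbrakk> \<Longrightarrow> act (inv g) (act g c) = c"
  using act_mult[of "inv g" g c] act_one by simp

text \<open>Stabilizers are conjugated by translation, so translation preserves the preorder and
  acts on words.\<close>

lemma stab_act:
  assumes g: "g \<in> carrier G" and c: "c \<in> P" 
  shows "h \<in> stab (act g c) \<longleftrightarrow> h \<in> carrier G \<and> inv g \<otimes> h \<otimes> g \<in> stab c"
proof -
  have "act h (act g c) = act g c \<longleftrightarrow> act (inv g \<otimes> h \<otimes> g) c = c" if h: "h \<in> carrier G"
  proof -
    have "act (inv g \<otimes> h \<otimes> g) c = act (inv g) (act h (act g c))"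
      using g c h by (simp add: act_mult act_closed)
    moreover have "act g (act (inv g) (act h (act g c))) = act h (act g c)"
      using g c h act_inv[of "inv g"] by (simp add: act_closed)
    ultimately show ?thesis
      using act_inv[OF g c] by metis
  qed
  then show ?thesis using g by (auto simp: stab_def)
qed

lemma wact_in: "\<lbrakk>c \<in> W n; g \<in> carrier G\<rbrakk> \<Longrightarrow> wact n g c \<in> W n"
  using stab_act act_closed unfolding W_iff wact_def PiE_iff by (fastforce simp: subset_iff)

lemma wact_one: "c \<in> W n \<Longrightarrow> wact n \<one> c = c"
  by (auto simp: wact_def fun_eq_iff act_one W_iff PiE_iff extensional_def)

lemma wact_mult: "\<lbrakk>c \<in> W n; g \<in> carrier G; h \<in> carrier G\<rbrakk> \<Longrightarrow> wact n (g \<otimes> h) c = wact n g (wact n h c)"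
  by (auto simp: wact_def fun_eq_iff act_mult W_iff PiE_iff)

text \<open>Translating letters commutes with the reindexing by \<open>\<theta>\<close>, so the
  representative picked by \<open>SOME\<close> in \<open>XE_act\<close> does not matter.\<close>

lemma XE_act_cell: 
  assumes g: "g \<in> carrier G"
  shows "XE_act g (cell n c t) = cell n (wact n g c) t"
proof -
  let ?p = "SOME p. p \<in> cell n c t" and ?v = "\<lambda>((n, c), t). cell n (wact n g c) t"
  have "?p \<in> cell n c t"
    by (rule someI[of _ "((n, c), t)"]) (simp add: cell_def self_in_real_class)
  then have "real_class E ?p = real_class E ((n, c), t)"
    by (simp add: cell_def in_real_class_iff)
  then have "?v ?p = ?v ((n, c), t)"
  proof (rule real_class_invariant[rotated])
    fix m n \<theta> c t
    assume *: "\<theta> \<in> simplex_maps m n" "c \<in> W n" "t \<in> standard_simplex m"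
    have "wact m g (restrict (\<lambda>i. c (\<theta> i)) {..m}) = restrict (\<lambda>i. wact n g c (\<theta> i)) {..m}"
      using *(1) by (auto simp: wact_def fun_eq_iff simplex_maps_def)
    then show "?v ((m, Pull E m n \<theta> c), t) = ?v ((n, c), simplex_push m \<theta> t)"
      using cell_pull[OF *(1) wact_in[OF *(2) g] *(3)] by (simp add: Pull_E)
  qed
  then show ?thesis by (simp add: XE_act_def case_prod_unfold)
qed

lemma continuous_map_cell: "c \<in> W n \<Longrightarrow> continuous_map (simplex_top n) XE (cell n c)"
  unfolding cell_def by (rule continuous_map_real_class)

lemma cts_action_XE: "cts_action G XE XE_act"
  unfolding cts_action_def
proof (intro conjI ballI)
  fix g assume g: "g \<in> carrier G"
  show "continuous_map XE XE (XE_act g)"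
  proof (rule continuous_compose_quotient_map[OF quotient_map_real_class])
    show "continuous_map (simplex_sum E) XE (XE_act g \<circ> real_class E)"
      unfolding simplex_sum_alt
    proof (rule continuous_map_from_sum_topology)
      fix a assume "a \<in> (SIGMA n:UNIV. W n)"
      then obtain n c where a: "a = (n, c)" "c \<in> W n" by auto
      have "continuous_map (simplex_top n) XE (cell n (wact n g c))"
        using continuous_map_cell[OF wact_in[OF a(2) g]] .
      then show "continuous_map ((\<lambda>(n, \<sigma>). simplex_top n) a) XE (\<lambda>x. (XE_act g \<circ> real_class E) (a, x))"
        using XE_act_cell[OF g] a by (simp add: cell_def[abs_def])
    qed
  qed
qed (auto elim!: cell_cases simp: XE_act_cell wact_one wact_mult)

subsection \<open>Cell structure\<close>

text \<open>The realization tests \<open>V\<close> on all words, this only on reduced ones. A word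
  with a repetition is pulled back along \<open>merge\<close> from a shorter one. If
  \<open>V\<close> avoids the open cells, its trace on a reduced cell is a finite union of traces on
  faces, which the induction handles.\<close>

lemma closedin_cells:
  assumes V: "\<And>n. (\<forall>c\<in>reduced n. closedin (simplex_top n) {t \<in> standard_simplex n. cell n c t \<in> V}) \<or>
      (\<forall>c\<in>reduced n. \<forall>t\<in>standard_simplex n. (\<forall>i\<le>n. 0 < t i) \<longrightarrow> cell n c t \<notin> V)"
    and "V \<subseteq> topspace XE"
  shows "closedin XE V"
proof (rule closedin_geometric_realization[OF assms(2)])
  fix n c assume "c \<in> W n"
  then have "closedin (simplex_top n) {t \<in> standard_simplex n. cell n c t \<in> V}"
  proof (induction n arbitrary: c rule: less_induct)
    case (less n)
    show ?case
    proof (cases "c \<in> reduced n")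
      case False
      then obtain i where i: "i < n" "c i = c (Suc i)"
        using less.prems by (auto simp: reduced_def)
      obtain m where n: "n = Suc m"
        using i by (cases n) auto
      let ?d = "restrict (\<lambda>k. c (skip i k)) {..m}"
      have d: "?d \<in> W m"
        using Pull_in[OF skip_in, of i m c] less.prems i n by simp
      have IH: "closedin (simplex_top m) {t \<in> standard_simplex m. cell m ?d t \<in> V}"
        by (rule less.IH[OF _ d]) (simp add: n)
      have mi: "merge i \<in> simplex_maps (Suc m) m"
        using merge_in i n by simp
      have "closedin (simplex_top (Suc m)) {t \<in> topspace (simplex_top (Suc m)).
          simplex_push (Suc m) (merge i) t \<in> {t \<in> standard_simplex m. cell m ?d t \<in> V}}"
        by (rule closedin_continuous_map_preimage[OF continuous_map_simplex_push[OF mi] IH])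
      moreover have "{t \<in> topspace (simplex_top (Suc m)).
          simplex_push (Suc m) (merge i) t \<in> {t \<in> standard_simplex m. cell m ?d t \<in> V}} =
          {t \<in> standard_simplex n. cell n c t \<in> V}"
        using cell_merge[of c m _ i] simplex_push_in[OF mi] less.prems i n by auto
      ultimately show ?thesis using n by simp
    next
      case c: True
      show ?thesis
      proof (cases "\<forall>c\<in>reduced n. closedin (simplex_top n) {t \<in> standard_simplex n. cell n c t \<in> V}")
        case False
        then have int: "cell n c t \<notin> V" if "t \<in> standard_simplex n" "\<forall>i\<le>n. 0 < t i" for t
          using V[of n] c that by blast
        let ?F = "\<lambda>i. {t \<in> standard_simplex n. t i = 0 \<and> cell n c t \<in> V}"
        have "closedin (simplex_top n) (?F i)" if i: "i \<le> n" for i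
        proof (cases n)
          case 0
          have "?F i = {}"
            using i 0 standard_simplexD(3) by fastforce
          then show ?thesis by (simp only: closedin_empty)
        next
          case n: (Suc m)
          let ?d = "restrict (\<lambda>k. c (skip i k)) {..m}"
          let ?B = "{t \<in> standard_simplex n. t i = 0}"
          have d: "?d \<in> W m"
            using Pull_in[OF skip_in, of i m c] less.prems i n by simp
          have IH: "closedin (simplex_top m) {t \<in> standard_simplex m. cell m ?d t \<in> V}"
            by (rule less.IH[OF _ d]) (simp add: n)
          have "closedin (simplex_top n) {t \<in> topspace (simplex_top n). t i \<in> {0}}"
            by (rule closedin_continuous_map_preimage[OF continuous_map_simplex_component]) simp
          then have B: "closedin (simplex_top n) ?B" by simp
          have cs: "continuous_map (subtopology (simplex_top n) ?B) (simplex_top m) (\<lambda>t. t \<circ> skip i)"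
            unfolding continuous_map_into_simplex
          proof (intro conjI allI)
            show "continuous_map (subtopology (simplex_top n) ?B) euclideanreal (\<lambda>t. (t \<circ> skip i) j)" for j
              using continuous_map_from_subtopology[OF continuous_map_simplex_component, of n ?B "skip i j"]
              by (simp add: o_def)
            show "(\<lambda>t. t \<circ> skip i) ` topspace (subtopology (simplex_top n) ?B) \<subseteq> standard_simplex m"
              using skip_face(1)[of _ m i] i n by auto
          qed
          have "closedin (subtopology (simplex_top n) ?B) {t \<in> topspace (subtopology (simplex_top n) ?B).
              t \<circ> skip i \<in> {t \<in> standard_simplex m. cell m ?d t \<in> V}}"
            by (rule closedin_continuous_map_preimage[OF cs IH])
          then have "closedin (simplex_top n) {t \<in> topspace (subtopology (simplex_top n) ?B).
              t \<circ> skip i \<in> {t \<in> standard_simplex m. cell m ?d t \<in> V}}"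
            using B closedin_trans_full by blast
          moreover have "{t \<in> topspace (subtopology (simplex_top n) ?B).
              t \<circ> skip i \<in> {t \<in> standard_simplex m. cell m ?d t \<in> V}} = ?F i"
            using cell_skip[of c m _ i] skip_face(1)[of _ m i] less.prems i n by auto
          ultimately show ?thesis by simp
        qed
        then have "closedin (simplex_top n) (\<Union>i\<in>{..n}. ?F i)"
          by (intro closedin_Union) auto
        moreover have "(\<Union>i\<in>{..n}. ?F i) = {t \<in> standard_simplex n. cell n c t \<in> V}"
        proof -
          have "\<exists>i\<le>n. t i = 0" if "t \<in> standard_simplex n" "cell n c t \<in> V" for t
            using int[OF that(1)] that(2) standard_simplexD(1)[OF that(1)] by (metis less_eq_real_def)
          then show ?thesis by auto
        qed
        ultimately show ?thesis by simp
      qed (use c in blast)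
    qed
  qed
  then show "closedin (simplex_top n) {t \<in> standard_simplex n. real_class E ((n, c), t) \<in> V}"
    by (simp add: cell_def)
qed

lemma cellular_G_space_XE:
  "cellular_G_space G XE XE_act reduced wact simplex_top (\<lambda>n t. 1 - (real n + 1) * Min (t ` {..n}))
     (\<lambda>n t l i. if i \<le> n then 1 / (real n + 1) + (t i - 1 / (real n + 1)) / l else 0) cell"
proof (unfold_locales, unfold simplex_gauge_lt_1_iff topspace_standard_simplex)
  have rW: "c \<in> W n" if "c \<in> reduced n" for c n
    using that by (simp add: reduced_def)
  show "cts_action G XE XE_act" by (rule cts_action_XE)
  show "wact n g c \<in> reduced n" if "c \<in> reduced n" "g \<in> carrier G" for c n g
  proof -
    have "act g (c i) \<noteq> act g (c (Suc i))" if "i < n" for i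
    proof
      assume "act g (c i) = act g (c (Suc i))"
      moreover have "act (inv g) (act g (c j)) = c j" if "j \<le> n" for j
        by (rule act_inv) (use W_in[OF rW] that \<open>c \<in> reduced n\<close> \<open>g \<in> carrier G\<close> in auto)
      ultimately have "c i = c (Suc i)"
        using \<open>i < n\<close> by (metis Suc_leI less_imp_le)
      then show False using \<open>c \<in> reduced n\<close> that by (simp add: reduced_def)
    qed
    then show ?thesis
      using that wact_in by (auto simp: reduced_def wact_def)
  qed
  show "wact n \<one> c = c" if "c \<in> reduced n" for c n
    using wact_one rW that by blast
  show "wact n (g \<otimes> h) c = wact n g (wact n h c)" if "c \<in> reduced n" "g \<in> carrier G" "h \<in> carrier G" for c n g h
    using wact_mult rW that by blast
  show "gauged (simplex_top n) (\<lambda>t. 1 - (real n + 1) * Min (t ` {..n}))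
      (\<lambda>t l i. if i \<le> n then 1 / (real n + 1) + (t i - 1 / (real n + 1)) / l else 0)" for n
    by (rule gauged_simplex)
  show "continuous_map (simplex_top n) XE (cell n c)" if "c \<in> reduced n" for c n
    using continuous_map_cell rW that by blast
  show "cell n (wact n g c) t = XE_act g (cell n c t)"
    if "c \<in> reduced n" "g \<in> carrier G" "t \<in> standard_simplex n" for c n g t
    using XE_act_cell[OF that(2)] by simp
  show "\<exists>n. \<exists>c\<in>reduced n. \<exists>t\<in>standard_simplex n. (\<forall>i\<le>n. 0 < t i) \<and> p = cell n c t"
    if p: "p \<in> topspace XE" for p
  proof -
    obtain n c t where "c \<in> W n" "t \<in> standard_simplex n" "p = cell n c t"
      using cell_cases[OF p] .
    then show ?thesis using cell_reduce[of c n t] by blast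
  qed
  show "(n, c, t) = (m, d, u)"
    if "c \<in> reduced n" "t \<in> standard_simplex n" "\<forall>i\<le>n. 0 < t i"
      "d \<in> reduced m" "u \<in> standard_simplex m" "\<forall>i\<le>m. 0 < u i" "cell n c t = cell m d u" for n c t m d u
    using reduced_unique[OF that(1-6) step_function_cell[OF that(7)]] .
  show "\<exists>m<n. \<exists>d\<in>reduced m. \<exists>u\<in>standard_simplex m. (\<forall>i\<le>m. 0 < u i) \<and> cell n c t = cell m d u"
    if "c \<in> reduced n" "t \<in> standard_simplex n" "1 - (real n + 1) * Min (t ` {..n}) = 1" for c n t
  proof -
    have "\<not> (\<forall>i\<le>n. 0 < t i)"
      using simplex_gauge_lt_1_iff[of n t] that(3) by simp
    then show ?thesis
      using cell_reduce[OF rW[OF that(1)] that(2)] by blast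
  qed
  show "closedin XE V"
    if V: "V \<subseteq> (\<Union>m<n. \<Union>c\<in>reduced m. cell m c ` standard_simplex m)"
      and c: "\<And>m c. \<lbrakk>m < n; c \<in> reduced m\<rbrakk> \<Longrightarrow> closedin (simplex_top m) {t \<in> standard_simplex m. cell m c t \<in> V}" for V n
  proof (rule closedin_cells)
    show "V \<subseteq> topspace XE"
      using V cell_in_XE rW by blast
    show "(\<forall>c\<in>reduced k. closedin (simplex_top k) {t \<in> standard_simplex k. cell k c t \<in> V}) \<or>
      (\<forall>c\<in>reduced k. \<forall>t\<in>standard_simplex k. (\<forall>i\<le>k. 0 < t i) \<longrightarrow> cell k c t \<notin> V)" for k
    proof (cases "k < n")
      \<comment> \<open>Points of \<open>V\<close> lie on cells of dimension below \<open>n\<close>,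
        and so do their normal forms; by uniqueness none is interior to a reduced cell of dimension
        \<open>k \<ge> n\<close>.\<close>
      case False
      have "cell k c t \<notin> V" if ct: "c \<in> reduced k" "t \<in> standard_simplex k" "\<forall>i\<le>k. 0 < t i" for c t
      proof
        assume "cell k c t \<in> V"
        then obtain m d u where d: "m < n" "d \<in> reduced m" "u \<in> standard_simplex m" "cell k c t = cell m d u"
          using V by blast
        then obtain m' d' u' where d': "m' \<le> m" "d' \<in> reduced m'" "u' \<in> standard_simplex m'" "\<forall>i\<le>m'. 0 < u' i"
          "cell m d u = cell m' d' u'"
          using cell_reduce[OF rW[OF d(2)] d(3)] by blast
        then have "(k, c, t) = (m', d', u')"
          using reduced_unique[OF ct d'(2-4)] step_function_cell[of k c t m' d' u'] d(4) by simp
        then show False using False d d' by simp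
      qed
      then show ?thesis by blast
    qed (use c in blast)
  qed
  show "closedin XE V"
    if "V \<subseteq> topspace XE"
      and "\<And>m c. c \<in> reduced m \<Longrightarrow> closedin (simplex_top m) {t \<in> standard_simplex m. cell m c t \<in> V}" for V
    by (rule closedin_cells) (use that in blast)+
qed

end

subsection \<open>Fixed points\<close>

lemma step_index_lower:
  assumes "t \<in> standard_simplex n" "0 \<le> s" "s < 1"
  shows "sum t {..<step_index t s} \<le> s"
  using step_index(3)[OF assms(1,3), of "step_index t s - 1"] assms(2)
  by (cases "step_index t s") (auto simp: lessThan_Suc_atMost)

lemma step_index_mono_0:
  assumes t: "t \<in> standard_simplex n" and s: "0 \<le> s" "s < 1"
  shows "step_index t 0 \<le> step_index t s"
proof (rule ccontr)
  assume "\<not> step_index t 0 \<le> step_index t s"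
  then have "sum t {..step_index t s} \<le> 0"
    using step_index(3)[OF t, of 0] by simp
  then show False using step_index(1)[OF t s(2)] s(1) by simp
qed

text \<open>With \<open>step_index_0_le\<close>, this identifies \<open>step_index t 0\<close> as
  the first vertex of positive weight, the lowest letter that the point involves.\<close>

lemma step_index_0_pos:
  assumes t: "t \<in> standard_simplex n"
  shows "0 < t (step_index t 0)"
proof -
  have "sum t {..step_index t 0} = sum t {..<step_index t 0} + t (step_index t 0)"
    by (simp flip: lessThan_Suc_atMost)
  then show ?thesis
    using step_index(1)[OF t, of 0] step_index_lower[OF t, of 0] by simp
qed

lemma step_index_0_le:
  assumes t: "t \<in> standard_simplex n" and i: "0 < t i"
  shows "step_index t 0 \<le> i"
proof -
  have "0 < sum t {..i}"
    using standard_simplexD(1)[OF t] i by (intro sum_pos2[of _ i]) auto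
  then show ?thesis
    unfolding step_index_def by (rule Least_le)
qed

text \<open>Join coordinates: weight \<open>s\<close> on a new vertex placed in front, and the old
  weights scaled by \<open>1 - s\<close>. The new vertex comes first because the cone point lies
  below all fixed letters.\<close>

definition cone_coord :: "real \<Rightarrow> (nat \<Rightarrow> real) \<Rightarrow> nat \<Rightarrow> real" where
  "cone_coord s t = case_nat s (\<lambda>i. (1 - s) * t i)"

lemma sum_cone_coord_less: "sum (cone_coord s t) {..<Suc i} = s + (1 - s) * sum t {..<i}"
  by (simp add: cone_coord_def sum.lessThan_Suc_shift sum_distrib_left del: sum.lessThan_Suc)

lemma sum_cone_coord: "sum (cone_coord s t) {..Suc i} = s + (1 - s) * sum t {..i}"
  using sum_cone_coord_less[of s t "Suc i"] by (simp only: lessThan_Suc_atMost)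

lemma cone_coord_in:
  assumes t: "t \<in> standard_simplex n" and s: "s \<in> {0..1}"
  shows "cone_coord s t \<in> standard_simplex (Suc n)"
proof (rule standard_simplexI)
  show "0 \<le> cone_coord s t i" for i
    using standard_simplexD(1)[OF t] s by (auto simp: cone_coord_def split: nat.split)
  show "cone_coord s t i = 0" if "Suc n < i" for i
    using standard_simplexD(2)[OF t] that by (auto simp: cone_coord_def split: nat.split)
  show "sum (cone_coord s t) {..Suc n} = 1"
    using standard_simplexD(3)[OF t] by (simp only: sum_cone_coord) simp
qed

lemma continuous_map_cone_coord:
  "continuous_map (prod_topology (top_of_set {0..1}) (simplex_top n)) (simplex_top (Suc n))
     (\<lambda>(s, t). cone_coord s t)"
proof -
  let ?D = "prod_topology (top_of_set {0..1::real}) (simplex_top n)"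
  have f: "continuous_map ?D euclideanreal fst"
    using continuous_map_into_fulltopology[OF continuous_map_fst] .
  have s: "continuous_map ?D euclideanreal (\<lambda>w. snd w i)" for i
    using continuous_map_compose[OF continuous_map_snd continuous_map_simplex_component]
    by (simp add: o_def)
  have "continuous_map ?D euclideanreal (\<lambda>w. cone_coord (fst w) (snd w) i)" for i
    by (cases i) (simp_all add: cone_coord_def f s continuous_intros)
  then show ?thesis
    using cone_coord_in by (auto simp: continuous_map_into_simplex case_prod_unfold)
qed

context stabilizer_nerve
begin

text \<open>The value of the step function at \<open>0\<close> is the first letter with positive
  weight, which a fixing element must fix. Conversely, stabilizers grow along the word, so whatever
  fixes that letter fixes the whole step function.\<close>

lemma cell_fixed_iff:
  assumes c: "c \<in> W n" and t: "t \<in> standard_simplex n" and H: "H \<subseteq> carrier G"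
  shows "(\<forall>h\<in>H. XE_act h (cell n c t) = cell n c t) \<longleftrightarrow> H \<subseteq> stab (c (step_index t 0))"
proof
  assume fx: "\<forall>h\<in>H. XE_act h (cell n c t) = cell n c t"
  show "H \<subseteq> stab (c (step_index t 0))"
  proof
    fix h assume h: "h \<in> H"
    then have hG: "h \<in> carrier G" using H by blast
    have "cell n (wact n h c) t = XE_act h (cell n c t)"
      by (simp add: XE_act_cell[OF hG])
    also have "\<dots> = cell n c t"
      using fx h by (rule bspec)
    finally have "step_function (wact n h c) t 0 = step_function c t 0"
      using step_function_cell by metis
    then show "h \<in> stab (c (step_index t 0))"
      using hG step_index(2)[OF t, of 0] by (simp add: step_function_def wact_def stab_def)
  qed
next
  assume sub: "H \<subseteq> stab (c (step_index t 0))"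
  show "\<forall>h\<in>H. XE_act h (cell n c t) = cell n c t"
  proof
    fix h assume h: "h \<in> H"
    then have hG: "h \<in> carrier G" using H by blast
    have "wact n h c (step_index t s) = c (step_index t s)" if "0 \<le> s" "s < 1" for s
    proof -
      have "h \<in> stab (c (step_index t s))"
        using sub h W_mono[OF c step_index_mono_0[OF t that] step_index(2)[OF t that(2)]] by blast
      then show ?thesis
        using step_index(2)[OF t that(2)] by (simp add: wact_def stab_def)
    qed
    then have "step_function (wact n h c) t = step_function c t"
      by (auto simp: step_function_def)
    then show "XE_act h (cell n c t) = cell n c t"
      using cell_eq_iff[OF wact_in[OF c hG] t c t] XE_act_cell[OF hG] by simp
  qed
qed

context
  fixes c0 :: 'p
  assumes c0: "c0 \<in> P"
begin

text \<open>The entries of \<open>c\<close> not fixed by \<open>stab c0\<close> are overwritten by \<open>c0\<close>; at a fixed point they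
  carry weight \<open>0\<close>.\<close>

definition cone_word :: "nat \<Rightarrow> (nat \<Rightarrow> 'p) \<Rightarrow> nat \<Rightarrow> 'p" where
  "cone_word n c = restrict (case_nat c0 (\<lambda>i. if stab c0 \<subseteq> stab (c i) then c i else c0)) {..Suc n}"

lemma stab_cone_word: "k \<le> Suc n \<Longrightarrow> stab c0 \<subseteq> stab (cone_word n c k)"
  by (cases k) (auto simp: cone_word_def)

text \<open>The letters fixed by \<open>stab c0\<close> form a final segment of a monotone word.
  Hence only an initial segment is overwritten, and by a letter below everything that
  follows.\<close>

lemma cone_word_in:
  assumes c: "c \<in> W n"
  shows "cone_word n c \<in> W (Suc n)"
  unfolding W_iff
proof (intro conjI allI impI)
  show "cone_word n c \<in> {..Suc n} \<rightarrow>\<^sub>E P"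
    using W_in[OF c] c0 by (auto simp: cone_word_def split: nat.splits)
  fix i j assume ij: "i \<le> j \<and> j \<le> Suc n"
  show "stab (cone_word n c i) \<subseteq> stab (cone_word n c j)"
  proof (cases i)
    case 0
    then show ?thesis using stab_cone_word[of j] ij by (simp add: cone_word_def)
  next
    case (Suc i')
    then obtain j' where j: "j = Suc j'" using ij by (cases j) auto
    have "stab (c i') \<subseteq> stab (c j')"
      using W_mono[OF c, of i' j'] ij Suc j by simp
    then show ?thesis
      using Suc j ij by (auto simp: cone_word_def)
  qed
qed

abbreviation fixed_set :: "((nat \<times> (nat \<Rightarrow> 'p)) \<times> (nat \<Rightarrow> real)) set set" where
  "fixed_set \<equiv> fixed_points XE XE_act (stab c0)"

lemma cell_in_fixed_set:
  "\<lbrakk>c \<in> W n; t \<in> standard_simplex n\<rbrakk> \<Longrightarrow> cell n c t \<in> fixed_set \<longleftrightarrow> stab c0 \<subseteq> stab (c (step_index t 0))"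
  using cell_fixed_iff[of c n t "stab c0"] cell_in_XE by (auto simp: fixed_points_def stab_def)

text \<open>The right side depends on the word and weights only through their step function. This is
  what makes the cone construction well defined on points.\<close>

lemma step_function_cone:
  assumes c: "c \<in> W n" and t: "t \<in> standard_simplex n" and fx: "cell n c t \<in> fixed_set" and s: "s \<in> {0..1}"
    and r: "0 \<le> r" "r < 1"
  shows "step_function (cone_word n c) (cone_coord s t) r =
    (if r < s then c0 else step_function c t ((r - s) / (1 - s)))"
proof (cases "r < s")
  case True
  have "step_function (cone_word n c) (cone_coord s t) r = cone_word n c 0"
    by (rule step_function_value[OF cone_coord_in[OF t s]]) (use True r in \<open>auto simp: cone_coord_def\<close>)
  then show ?thesis using True by (simp add: cone_word_def)
next
  case False
  \<comment> \<open>From \<open>s \<le> r\<close> and \<open>r < 1\<close>; in particular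
    \<open>s = 1\<close> never reaches the division.\<close>
  then have s1: "0 < 1 - s" using r by simp
  let ?r = "(r - s) / (1 - s)"
  have r': "0 \<le> ?r" "?r < 1"
    using False s1 r by (auto simp: field_simps)
  let ?i = "step_index t ?r"
  have i: "?i \<le> n" "?r < sum t {..?i}" "sum t {..<?i} \<le> ?r"
    using step_index[OF t r'(2)] step_index_lower[OF t r'] by auto
  have fx': "stab c0 \<subseteq> stab (c ?i)"
    using fx cell_in_fixed_set[OF c t] W_mono[OF c step_index_mono_0[OF t r'] i(1)] by blast
  have eq: "r = s + (1 - s) * ?r" using s1 by simp
  have "step_function (cone_word n c) (cone_coord s t) r = cone_word n c (Suc ?i)"
  proof (rule step_function_value[OF cone_coord_in[OF t s]])
    have "sum (cone_coord s t) {..<Suc ?i} = s + (1 - s) * sum t {..<?i}"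
      by (rule sum_cone_coord_less)
    also have "\<dots> \<le> s + (1 - s) * ?r"
      using s1 i(3) by (intro add_left_mono mult_left_mono) auto
    finally show "sum (cone_coord s t) {..<Suc ?i} \<le> r" using eq by simp
    have "s + (1 - s) * ?r < s + (1 - s) * sum t {..?i}"
      using s1 i(2) by (intro add_strict_left_mono mult_strict_left_mono) auto
    then show "r < sum (cone_coord s t) {..Suc ?i}"
      using eq by (simp only: sum_cone_coord)
  qed (use r in auto)
  then show ?thesis
    using False fx' i(1) r' by (simp add: cone_word_def step_function_def)
qed

text \<open>On a simplex the condition says that all letters not fixed by \<open>stab c0\<close>
  have weight \<open>0\<close>, which is the vanishing of a continuous function. Closedness is
  needed to restrict the quotient map to the fixed set.\<close>

lemma closedin_fixed_set: "closedin XE fixed_set"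
proof (rule closedin_geometric_realization)
  show "fixed_set \<subseteq> topspace XE"
    by (auto simp: fixed_points_def)
  fix n c assume c: "c \<in> W n"
  let ?B = "{i. i \<le> n \<and> \<not> stab c0 \<subseteq> stab (c i)}"
  have "cell n c t \<in> fixed_set \<longleftrightarrow> (\<forall>i\<in>?B. t i = 0)" if t: "t \<in> standard_simplex n" for t
  proof
    assume fx: "cell n c t \<in> fixed_set"
    show "\<forall>i\<in>?B. t i = 0"
    proof (rule ballI, rule ccontr)
      fix i assume i: "i \<in> ?B" "t i \<noteq> 0"
      then have "0 < t i"
        using standard_simplexD(1)[OF t, of i] by simp
      then have "stab (c (step_index t 0)) \<subseteq> stab (c i)"
        using W_mono[OF c step_index_0_le[OF t]] i by blast
      then show False
        using fx cell_in_fixed_set[OF c t] i by blast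
    qed
  next
    assume "\<forall>i\<in>?B. t i = 0"
    then show "cell n c t \<in> fixed_set"
      using step_index_0_pos[OF t] step_index(2)[OF t, of 0] cell_in_fixed_set[OF c t] by force
  qed
  moreover have "(\<forall>i\<in>?B. t i = 0) \<longleftrightarrow> (\<Sum>i\<in>?B. t i) = 0" if "t \<in> standard_simplex n" for t
    using standard_simplexD(1)[OF that] by (subst sum_nonneg_eq_0_iff) auto
  ultimately have "{t \<in> standard_simplex n. real_class E ((n, c), t) \<in> fixed_set} =
      {t \<in> topspace (simplex_top n). (\<Sum>i\<in>?B. t i) \<in> {0}}"
    by (auto simp: cell_def)
  moreover have "closedin (simplex_top n) {t \<in> topspace (simplex_top n). (\<Sum>i\<in>?B. t i) \<in> {0}}"
    by (rule closedin_continuous_map_preimage[where Y = euclideanreal])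
      (auto intro: continuous_map_sum continuous_map_simplex_component)
  ultimately show "closedin (simplex_top n) {t \<in> standard_simplex n. real_class E ((n, c), t) \<in> fixed_set}"
    by simp
qed

lemma contractible_fixed_set: "fixed_set \<noteq> {} \<and> contractible_space (subtopology XE fixed_set)"
proof -
  let ?T = "top_of_set {0..1::real}"
  let ?A = "subtopology XE fixed_set"
  let ?U = "{x \<in> topspace (simplex_sum E). real_class E x \<in> fixed_set}"
  let ?S = "subtopology (simplex_sum E) ?U"
  \<comment> \<open>The homotopy on representatives. It is defined and continuous on the whole sum
    of simplices, while independence of the representative is established only over the fixed
    set.\<close>
  define k where "k = (\<lambda>(s, ((n, c), t)). cell (Suc n) (cone_word n c) (cone_coord s t))"
  \<comment> \<open>\<open>w\<close> and \<open>e\<close> describe the cone point: the word with the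
    single letter \<open>c0\<close>, of weight \<open>1\<close>.\<close>
  define e :: "nat \<Rightarrow> real" where "e = (\<lambda>j. if j = 0 then 1 else 0)"
  define w where "w = restrict (\<lambda>_. c0) {..0::nat}"
  have e: "e \<in> standard_simplex 0" by (simp add: e_def)
  have w: "w \<in> W 0" using c0 by (auto simp: w_def W_iff)
  have b: "cell 0 w e \<in> fixed_set"
    using cell_in_fixed_set[OF w e] step_index(2)[OF e, of 0] by (simp add: w_def)
  have sf_b: "step_function w e r = c0" if "0 \<le> r" "r < 1" for r
    using step_function_value[OF e, of 0 r w] that by (simp add: e_def w_def)
  have q: "quotient_map ?S ?A (real_class E)"
    by (rule quotient_map_restriction[OF quotient_map_real_class]) (auto simp: closedin_fixed_set)
  have A: "quotient_map (prod_topology ?T ?S) (prod_topology ?T ?A) (\<lambda>(s, x). (s, real_class E x))"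
    by (intro quotient_map_prod_right q compact_imp_locally_compact_space disjI1)
      (auto simp: compact_space_subtopology Hausdorff_space_subtopology)
  have "continuous_map (prod_topology ?T (simplex_sum E)) XE k"
    unfolding simplex_sum_alt
  proof (rule continuous_map_prod_sum_topology)
    fix a assume "a \<in> (SIGMA n:UNIV. W n)"
    then obtain n c where a: "a = (n, c)" "c \<in> W n" by auto
    have "continuous_map (prod_topology ?T (simplex_top n)) XE (cell (Suc n) (cone_word n c) \<circ> (\<lambda>(s, t). cone_coord s t))"
      by (rule continuous_map_compose[OF continuous_map_cone_coord continuous_map_cell[OF cone_word_in[OF a(2)]]])
    then show "continuous_map (prod_topology ?T ((\<lambda>(n, \<sigma>). simplex_top n) a)) XE (\<lambda>(s, t). k (s, a, t))"
      using a by (simp add: k_def o_def case_prod_unfold)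
  qed
  then have "continuous_map (prod_topology ?T ?S) XE k"
    unfolding prod_topology_subtopology by (rule continuous_map_from_subtopology)
  moreover have k_fix: "k (s, ((n, c), t)) \<in> fixed_set"
    if "s \<in> {0..1}" "c \<in> W n" "t \<in> standard_simplex n" for s n c t
    using cell_in_fixed_set[OF cone_word_in[OF that(2)] cone_coord_in[OF that(3,1)]]
      stab_cone_word step_index(2)[OF cone_coord_in[OF that(3,1)], of 0] by (simp add: k_def)
  ultimately have C: "continuous_map (prod_topology ?T ?S) ?A k"
    by (auto simp: continuous_map_in_subtopology topspace_simplex_sum)
  \<comment> \<open>Independence of representatives and both ends of the homotopy are instances of
    this comparison. For \<open>s = 0\<close> the step function is the given one; for
    \<open>s = 1\<close> it is constantly \<open>c0\<close>.\<close>
  have eq: "k (s, ((n, c), t)) = cell m d u"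
    if "s \<in> {0..1}" "c \<in> W n" "t \<in> standard_simplex n" "cell n c t \<in> fixed_set" "d \<in> W m" "u \<in> standard_simplex m"
      "\<And>r. \<lbrakk>0 \<le> r; r < 1\<rbrakk> \<Longrightarrow> step_function d u r = (if r < s then c0 else step_function c t ((r - s) / (1 - s)))"
    for s n c t m d u
  proof -
    have "step_function (cone_word n c) (cone_coord s t) r = step_function d u r" for r
    proof (cases "0 \<le> r \<and> r < 1")
      case True
      then show ?thesis using step_function_cone[OF that(2,3,4,1), of r] that(7) by simp
    qed (auto simp: step_function_def)
    then have "step_function (cone_word n c) (cone_coord s t) = step_function d u"
      by blast
    then show ?thesis
      using cell_eq_iff[OF cone_word_in[OF that(2)] cone_coord_in[OF that(3,1)] that(5,6)] by (simp add: k_def)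
  qed
  have D: "k x = k y"
    if xy: "x \<in> topspace (prod_topology ?T ?S)" "y \<in> topspace (prod_topology ?T ?S)"
      "(\<lambda>(s, x). (s, real_class E x)) x = (\<lambda>(s, x). (s, real_class E x)) y" for x y
  proof -
    obtain s n c t where x: "x = (s, ((n, c), t))" "s \<in> {0..1}" "c \<in> W n" "t \<in> standard_simplex n" "cell n c t \<in> fixed_set"
      using xy(1) by (auto simp: topspace_simplex_sum cell_def)
    obtain m d u where y: "y = (s, ((m, d), u))" "d \<in> W m" "u \<in> standard_simplex m" "cell m d u \<in> fixed_set"
      using xy(2,3) x by (auto simp: topspace_simplex_sum cell_def)
    have "cell n c t = cell m d u"
      using xy(3) x y by (simp add: cell_def)
    then have sf: "step_function c t = step_function d u"
      by (rule step_function_cell)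
    have "k x = cell (Suc m) (cone_word m d) (cone_coord s u)"
      unfolding x(1) using x y step_function_cone[OF y(2,3,4) x(2)] sf
      by (intro eq cone_word_in cone_coord_in) auto
    then show ?thesis using y(1) by (simp add: k_def)
  qed
  have k0: "k (0, x) = real_class E x" and k1: "k (1, x) = cell 0 w e" if "x \<in> ?U" for x
  proof -
    obtain n c t where x: "x = ((n, c), t)" "c \<in> W n" "t \<in> standard_simplex n" "cell n c t \<in> fixed_set"
      using \<open>x \<in> ?U\<close> by (auto simp: topspace_simplex_sum cell_def)
    show "k (0, x) = real_class E x"
      unfolding x(1) using eq[of 0 c n t c n t] x by (simp add: cell_def)
    show "k (1, x) = cell 0 w e"
      unfolding x(1) using eq[of 1 c n t w 0 e] x w e sf_b by simp
  qed
  have "\<exists>h. continuous_map (prod_topology ?T ?A) ?A h \<and>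
    (\<forall>x\<in>topspace (prod_topology ?T ?S). h ((\<lambda>(s, x). (s, real_class E x)) x) = k x)"
  proof (rule quotient_map_lift_exists[OF A C D])
    fix h
    assume 1: "continuous_map (prod_topology ?T ?A) ?A h"
      and 2: "\<And>x. x \<in> topspace (prod_topology ?T ?S) \<Longrightarrow> h ((\<lambda>(s, x). (s, real_class E x)) x) = k x"
    show ?thesis
      by (intro exI[of _ h] conjI ballI) (fact 1, rule 2)
  qed
  then obtain h where h: "continuous_map (prod_topology ?T ?A) ?A h"
    "\<forall>x\<in>topspace (prod_topology ?T ?S). h ((\<lambda>(s, x). (s, real_class E x)) x) = k x"
    by blast
  have "h (0, y) = y \<and> h (1, y) = cell 0 w e" if "y \<in> topspace ?A" for y
  proof -
    obtain x where x: "x \<in> topspace ?S" "y = real_class E x"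
      using quotient_imp_surjective_map[OF q] \<open>y \<in> topspace ?A\<close> by blast
    then have "x \<in> ?U" by simp
    moreover have "h (s, y) = k (s, x)" if "s \<in> {0..1}" for s
      using h(2)[rule_format, of "(s, x)"] x that by simp
    ultimately show ?thesis
      using k0 k1 x(2) by simp
  qed
  then have "homotopic_with (\<lambda>x. True) ?A ?A id (\<lambda>_. cell 0 w e)"
    using h(1) by (subst homotopic_with) auto
  then show ?thesis
    using b unfolding contractible_space_def by blast
qed

end

end

section \<open>Cosets of finite subgroups and the orbit category\<close>

text \<open>A left coset \<open>c\<close> determines its subgroup, as the set of all
  \<open>inv a \<otimes> b\<close> with \<open>a\<close> and \<open>b\<close> in \<open>c\<close>.
  The union is therefore disjoint: it is the coproduct of the objects of the orbit category as
  \<open>G\<close>-sets.\<close>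

definition finite_cosets :: "('g, 'b) monoid_scheme \<Rightarrow> 'g set set" where
  "finite_cosets G = (\<Union>H\<in>finite_subgroups G. lcosets\<^bsub>G\<^esub> H)"

lemma (in group) finite_cosets_subset: "c \<in> finite_cosets G \<Longrightarrow> c \<subseteq> carrier G"
proof -
  assume "c \<in> finite_cosets G"
  then obtain H a where "subgroup H G" "a \<in> carrier G" "c = a <# H"
    by (auto simp: finite_cosets_def finite_subgroups_def LCOSETS_def)
  then show "c \<subseteq> carrier G"
    using l_coset_subset_G[OF subgroup.subset] by simp
qed

lemma (in group) l_coset_in_lcosets:
  assumes "subgroup H G" "g \<in> carrier G" "c \<in> lcosets H"
  shows "g <# c \<in> lcosets H"
proof -
  obtain a where a: "a \<in> carrier G" "c = a <# H"
    using assms(3) by (auto simp: LCOSETS_def)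
  have "g <# c = (g \<otimes> a) <# H"
    using a assms(2) subgroup.subset[OF assms(1)] by (simp add: lcos_m_assoc)
  then show ?thesis using a assms(2) by (auto simp: LCOSETS_def)
qed

locale coset_nerve = group G for G :: "('g, 'b) monoid_scheme" (structure)

sublocale coset_nerve \<subseteq> stabilizer_nerve G "finite_cosets G" "l_coset G"
proof
  show "g <# c \<in> finite_cosets G" if "g \<in> carrier G" "c \<in> finite_cosets G" for g c
    using that l_coset_in_lcosets by (auto simp: finite_cosets_def finite_subgroups_def)
  show "\<one> <# c = c" if "c \<in> finite_cosets G" for c
    using lcos_mult_one[OF finite_cosets_subset[OF that]] .
  show "(g \<otimes> h) <# c = g <# (h <# c)" if "g \<in> carrier G" "h \<in> carrier G" "c \<in> finite_cosets G" for g h c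
    using lcos_m_assoc[OF finite_cosets_subset[OF that(3)] that(1,2)] by simp
qed

context coset_nerve
begin

lemma subgroup_in_finite_cosets:
  assumes "H \<in> finite_subgroups G"
  shows "H \<in> lcosets H" "H \<in> finite_cosets G"
proof -
  have "\<one> <# H = H"
    using assms by (intro lcos_mult_one subgroup.subset) (simp add: finite_subgroups_def)
  then show "H \<in> lcosets H"
    by (auto simp: LCOSETS_def)
  then show "H \<in> finite_cosets G"
    using assms by (auto simp: finite_cosets_def)
qed

lemma stab_subgroup:
  assumes "H \<in> finite_subgroups G"
  shows "stab H = H"
proof -
  have H: "subgroup H G" using assms by (simp add: finite_subgroups_def)
  show ?thesis
  proof
    show "stab H \<subseteq> H"
    proof
      fix g assume g: "g \<in> stab H"
      then have "g \<otimes> \<one> \<in> g <# H"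
        using subgroup.one_closed[OF H] by (auto simp: l_coset_def)
      then show "g \<in> H" using g by (simp add: stab_def)
    qed
    show "H \<subseteq> stab H"
    proof
      fix g assume g: "g \<in> H"
      then have gG: "g \<in> carrier G" using subgroup.mem_carrier[OF H] by blast
      have "h \<in> g <# H" if "h \<in> H" for h
      proof -
        have "h = g \<otimes> (inv g \<otimes> h)"
          using that subgroup.mem_carrier[OF H] gG by (simp add: m_assoc[symmetric])
        moreover have "inv g \<otimes> h \<in> H"
          using that g subgroup.m_inv_closed[OF H] subgroup.m_closed[OF H] by blast
        ultimately show ?thesis unfolding l_coset_def by blast
      qed
      moreover have "g <# H \<subseteq> H"
        using g subgroup.m_closed[OF H] by (auto simp: l_coset_def)
      ultimately have "g <# H = H" by blast
      then show "g \<in> stab H" using gG by (simp add: stab_def)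
    qed
  qed
qed

text \<open>The stabilizer of \<open>a <# H\<close> is a conjugate of \<open>H\<close>; conjugating
  back by \<open>a\<close> embeds it in \<open>H\<close>.\<close>

lemma finite_stab:
  assumes "c \<in> finite_cosets G"
  shows "finite (stab c)"
proof -
  obtain H a where H: "H \<in> finite_subgroups G" "a \<in> carrier G" "c = a <# H"
    using assms by (auto simp: finite_cosets_def LCOSETS_def)
  have "stab c = {h \<in> carrier G. inv a \<otimes> h \<otimes> a \<in> H}"
    using stab_act[OF H(2) subgroup_in_finite_cosets(2)[OF H(1)]] H(3) stab_subgroup[OF H(1)] by auto
  moreover have "inj_on (\<lambda>h. inv a \<otimes> h \<otimes> a) {h \<in> carrier G. inv a \<otimes> h \<otimes> a \<in> H}"
    using H(2) by (auto simp: inj_on_def)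
  moreover have "(\<lambda>h. inv a \<otimes> h \<otimes> a) ` {h \<in> carrier G. inv a \<otimes> h \<otimes> a \<in> H} \<subseteq> H"
    by auto
  moreover have "finite H"
    using H(1) by (simp add: finite_subgroups_def)
  ultimately show ?thesis
    using inj_on_finite[of "\<lambda>h. inv a \<otimes> h \<otimes> a" "stab c" H] by simp
qed

definition orb :: "'g set \<Rightarrow> 'g set set" where
  "orb c = (\<lambda>g. g <# c) ` carrier G"

lemma orb_lcosets:
  assumes H: "subgroup H G" and c: "c \<in> lcosets H"
  shows "orb c = lcosets H"
proof
  show "orb c \<subseteq> lcosets H"
    using l_coset_in_lcosets[OF H _ c] by (auto simp: orb_def)
  obtain a where a: "a \<in> carrier G" "c = a <# H"
    using c by (auto simp: LCOSETS_def)
  show "lcosets H \<subseteq> orb c"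
  proof
    fix d assume "d \<in> lcosets H"
    then obtain b where b: "b \<in> carrier G" "d = b <# H"
      by (auto simp: LCOSETS_def)
    have "(b \<otimes> inv a) <# c = (b \<otimes> inv a \<otimes> a) <# H"
      using a b(1) subgroup.subset[OF H] by (simp add: lcos_m_assoc)
    then have "d = (b \<otimes> inv a) <# c"
      using a b by (simp add: m_assoc)
    then show "d \<in> orb c"
      using a(1) b(1) by (auto simp: orb_def)
  qed
qed

lemma self_in_orb: "c \<in> finite_cosets G \<Longrightarrow> c \<in> orb c"
  unfolding orb_def by (rule image_eqI[of _ _ \<one>]) (simp_all add: act_one)

lemma orb_act:
  assumes c: "c \<in> finite_cosets G" and g: "g \<in> carrier G"
  shows "orb (g <# c) = orb c"
proof -
  have "h <# c \<in> orb (g <# c)" if h: "h \<in> carrier G" for h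
  proof -
    have "(h \<otimes> inv g) <# (g <# c) = (h \<otimes> inv g \<otimes> g) <# c"
      using act_mult[of "h \<otimes> inv g" g c] c g h by simp
    also have "\<dots> = h <# c"
      using g h by (simp add: m_assoc)
    finally have "h <# c = (h \<otimes> inv g) <# (g <# c)" ..
    moreover have "h \<otimes> inv g \<in> carrier G"
      using g h by simp
    ultimately show ?thesis
      unfolding orb_def by (rule image_eqI)
  qed
  moreover have "h <# (g <# c) \<in> orb c" if h: "h \<in> carrier G" for h
    unfolding orb_def by (rule image_eqI, rule act_mult[OF h g c, symmetric], rule m_closed[OF h g])
  ultimately show ?thesis
    by (auto simp: orb_def)
qed

section \<open>Morphisms of the orbit category from pairs of cosets\<close>

abbreviation OC :: "('g set set, 'g set set \<times> 'g set set \<times> ('g set \<Rightarrow> 'g set)) category" where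
  "OC \<equiv> orbit_category G (finite_subgroups G)"

lemma Obj_OC: "A \<in> Obj OC \<longleftrightarrow> (\<exists>c\<in>finite_cosets G. A = orb c)"
proof
  assume "A \<in> Obj OC"
  then obtain H where "H \<in> finite_subgroups G" "A = lcosets H"
    by (auto simp: orbit_category_def)
  then show "\<exists>c\<in>finite_cosets G. A = orb c"
    using subgroup_in_finite_cosets[of H] orb_lcosets[of H H] by (auto simp: finite_subgroups_def)
next
  assume "\<exists>c\<in>finite_cosets G. A = orb c"
  then show "A \<in> Obj OC"
    using orb_lcosets by (fastforce simp: orbit_category_def finite_cosets_def finite_subgroups_def)
qed

lemma Obj_OC_orb:
  assumes "A \<in> Obj OC" "c \<in> A"
  shows "c \<in> finite_cosets G" "orb c = A"
proof -
  obtain d where d: "d \<in> finite_cosets G" "A = orb d"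
    using assms(1) by (auto simp: Obj_OC)
  then obtain g where g: "g \<in> carrier G" "c = g <# d"
    using assms(2) by (auto simp: orb_def)
  show "c \<in> finite_cosets G" "orb c = A"
    using act_closed[OF g(1) d(1)] orb_act[OF d(1) g(1)] d g by auto
qed

text \<open>The unique \<open>G\<close>-map between the orbits of \<open>c\<close> and \<open>d\<close> that sends \<open>c\<close> to \<open>d\<close>; it exists if
  and only if \<open>stab c \<subseteq> stab d\<close>.\<close>

definition coset_map :: "'g set \<Rightarrow> 'g set \<Rightarrow> 'g set \<Rightarrow> 'g set" where
  "coset_map c d = restrict (\<lambda>y. (SOME g. g \<in> carrier G \<and> y = g <# c) <# d) (orb c)"

text \<open>Two group elements that carry \<open>c\<close> to the same coset differ by an element of
  \<open>stab c\<close>, which also fixes \<open>d\<close>; so the element picked by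
  \<open>SOME\<close> is immaterial.\<close>

lemma coset_map_act:
  assumes c: "c \<in> finite_cosets G" and d: "d \<in> finite_cosets G" and sub: "stab c \<subseteq> stab d"
    and g: "g \<in> carrier G"
  shows "coset_map c d (g <# c) = g <# d"
proof -
  let ?h = "SOME h. h \<in> carrier G \<and> g <# c = h <# c"
  have h: "?h \<in> carrier G \<and> g <# c = ?h <# c"
    by (rule someI[of _ g]) (use g in simp)
  then have hG: "?h \<in> carrier G" ..
  have "(inv ?h \<otimes> g) <# c = c"
    using act_mult[OF inv_closed[OF hG] g c] h act_inv[OF hG c] by simp
  then have "inv ?h \<otimes> g \<in> stab c"
    using g hG by (simp add: stab_def)
  then have "inv ?h \<otimes> g \<in> stab d"
    using sub by (rule subsetD[rotated])
  then have "(inv ?h \<otimes> g) <# d = d"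
    by (simp add: stab_def)
  then have "?h <# d = ?h <# ((inv ?h \<otimes> g) <# d)"
    by simp
  also have "\<dots> = (?h \<otimes> (inv ?h \<otimes> g)) <# d"
    using act_mult[of ?h "inv ?h \<otimes> g" d] g hG d by simp
  also have "?h \<otimes> (inv ?h \<otimes> g) = g"
    using g hG by (simp add: m_assoc[symmetric])
  finally have "?h <# d = g <# d" .
  moreover have "g <# c \<in> orb c"
    using g by (simp add: orb_def)
  ultimately show ?thesis
    by (simp add: coset_map_def)
qed

lemma coset_map_self:
  assumes "c \<in> finite_cosets G" "d \<in> finite_cosets G" "stab c \<subseteq> stab d"
  shows "coset_map c d c = d"
  using coset_map_act[OF assms one_closed] act_one assms(1,2) by simp

lemma coset_map_in:
  assumes c: "c \<in> finite_cosets G" and d: "d \<in> finite_cosets G" and sub: "stab c \<subseteq> stab d"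
  shows "coset_map c d \<in> coset_maps G (orb c) (orb d)"
proof -
  have "coset_map c d y \<in> orb d" if "y \<in> orb c" for y
    using that coset_map_act[OF assms] by (auto simp: orb_def)
  moreover have "coset_map c d (g <# y) = g <# coset_map c d y" if "g \<in> carrier G" "y \<in> orb c" for g y
  proof -
    obtain h where h: "h \<in> carrier G" "y = h <# c"
      using \<open>y \<in> orb c\<close> by (auto simp: orb_def)
    have "coset_map c d ((g \<otimes> h) <# c) = (g \<otimes> h) <# d"
      using coset_map_act[OF assms, of "g \<otimes> h"] that(1) h(1) by simp
    then show ?thesis
      using act_mult[OF that(1) h(1) c] act_mult[OF that(1) h(1) d] coset_map_act[OF assms h(1)] h(2) by simp
  qed
  ultimately show ?thesis
    by (auto simp: coset_maps_def coset_map_def)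
qed

text \<open>The source is a single orbit, so equivariance spreads the value at \<open>c\<close> over
  all of it; outside it both maps are \<open>undefined\<close>.\<close>

lemma coset_maps_unique:
  assumes c: "c \<in> finite_cosets G" and f: "f \<in> coset_maps G (orb c) B"
    and f': "f' \<in> coset_maps G (orb c) B'" and eq: "f c = f' c"
  shows "f = f'"
proof
  fix y
  show "f y = f' y"
  proof (cases "y \<in> orb c")
    case True
    then obtain g where "g \<in> carrier G" "y = g <# c"
      by (auto simp: orb_def)
    then show ?thesis
      using f f' eq self_in_orb[OF c] by (auto simp: coset_maps_def)
  next
    case False
    then show ?thesis
      using f f' by (auto simp: coset_maps_def PiE_iff extensional_def)
  qed
qed

definition mor :: "'g set \<Rightarrow> 'g set \<Rightarrow> 'g set set \<times> 'g set set \<times> ('g set \<Rightarrow> 'g set)" where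
  "mor c d = (orb c, orb d, coset_map c d)"

lemma mor_Ident: "c \<in> finite_cosets G \<Longrightarrow> mor c c = Ident OC (orb c)"
proof -
  assume c: "c \<in> finite_cosets G"
  have id: "restrict id (orb c) \<in> coset_maps G (orb c) (orb c)"
  proof -
    have "g <# y \<in> orb c" if g: "g \<in> carrier G" and y: "y \<in> orb c" for g y
    proof -
      obtain h where h: "h \<in> carrier G" "y = h <# c"
        using y by (auto simp: orb_def)
      show ?thesis
        unfolding orb_def h(2) by (rule image_eqI, rule act_mult[OF g h(1) c, symmetric], rule m_closed[OF g h(1)])
    qed
    then show ?thesis by (auto simp: coset_maps_def)
  qed
  have "coset_map c c = restrict id (orb c)"
    by (rule coset_maps_unique[OF c coset_map_in[OF c c order_refl] id])
      (use coset_map_self[OF c c] self_in_orb[OF c] in auto)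
  then show "mor c c = Ident OC (orb c)"
    by (simp add: mor_def orbit_category_def)
qed

lemma mor_Comp:
  assumes c: "c \<in> finite_cosets G" and d: "d \<in> finite_cosets G" and e: "e \<in> finite_cosets G"
    and sub: "stab c \<subseteq> stab d" "stab d \<subseteq> stab e"
  shows "mor c e = Comp OC (mor d e) (mor c d)"
proof -
  have sub': "stab c \<subseteq> stab e" using sub by blast
  have "coset_map c e y = compose (orb c) (coset_map d e) (coset_map c d) y" for y
  proof (cases "y \<in> orb c")
    case True
    then obtain g where "g \<in> carrier G" "y = g <# c"
      by (auto simp: orb_def)
    then show ?thesis
      using True coset_map_act[OF c e sub'] coset_map_act[OF c d sub(1)] coset_map_act[OF d e sub(2)]
      by (simp add: compose_def)
  qed (simp add: compose_def coset_map_def)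
  then show ?thesis
    by (auto simp: mor_def orbit_category_def)
qed

text \<open>Both maps send \<open>g <# c\<close> to \<open>g <# d\<close>. Changing the base points
  by a common translation is invisible in the orbit category.\<close>

lemma mor_act:
  assumes c: "c \<in> finite_cosets G" and d: "d \<in> finite_cosets G" and sub: "stab c \<subseteq> stab d" and g: "g \<in> carrier G"
  shows "mor (g <# c) (g <# d) = mor c d"
proof -
  have gc: "g <# c \<in> finite_cosets G" and gd: "g <# d \<in> finite_cosets G"
    using act_closed c d g by auto
  have "stab (g <# c) \<subseteq> stab (g <# d)"
    using sub stab_act[OF g c] stab_act[OF g d] by auto
  then have "coset_map (g <# c) (g <# d) = coset_map c d"
    using coset_map_in[OF gc gd] coset_map_in[OF c d sub] coset_map_self[OF gc gd] coset_map_act[OF c d sub g]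
      coset_maps_unique[OF gc] orb_act[OF c g] by metis
  then show ?thesis
    by (simp add: mor_def orb_act[OF c g] orb_act[OF d g])
qed

section \<open>Chains of the orbit category as orbits of words\<close>

abbreviation K :: "((nat \<Rightarrow> 'g set set) \<times> (nat \<times> nat \<Rightarrow> 'g set set \<times> 'g set set \<times> ('g set \<Rightarrow> 'g set))) simplicial_set"
  where "K \<equiv> nerve OC"

text \<open>Forgets the base points: each coset is replaced by its orbit, each comparison by the
  \<open>G\<close>-map it determines.\<close>

definition word_chain :: "nat \<Rightarrow> (nat \<Rightarrow> 'g set) \<Rightarrow>
    (nat \<Rightarrow> 'g set set) \<times> (nat \<times> nat \<Rightarrow> 'g set set \<times> 'g set set \<times> ('g set \<Rightarrow> 'g set))" where
  "word_chain n c = (restrict (\<lambda>i. orb (c i)) {..n}, restrict (\<lambda>(i, j). mor (c i) (c j)) (chain_arrows n))"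

lemma Simps_K: "(x, a) \<in> Simps K n \<longleftrightarrow>
   x \<in> {..n} \<rightarrow>\<^sub>E Obj OC \<and> a \<in> (\<Pi>\<^sub>E p \<in> chain_arrows n. Hom OC (x (fst p)) (x (snd p))) \<and>
        (\<forall>i\<le>n. a (i, i) = Ident OC (x i)) \<and>
        (\<forall>i j k. i \<le> j \<and> j \<le> k \<and> k \<le> n \<longrightarrow> a (i, k) = Comp OC (a (j, k)) (a (i, j)))"
  by (simp add: nerve_def)

lemma Hom_OC: "Hom OC A B = {(A, B, f) | f. f \<in> coset_maps G A B}"
  by (simp add: orbit_category_def)

lemma word_chain_in:
  assumes c: "c \<in> W n"
  shows "word_chain n c \<in> Simps K n"
  unfolding word_chain_def Simps_K
proof (intro conjI allI impI)
  show "restrict (\<lambda>i. orb (c i)) {..n} \<in> {..n} \<rightarrow>\<^sub>E Obj OC"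
  proof (rule restrict_PiE_iff[THEN iffD2], rule ballI)
    fix i assume "i \<in> {..n}"
    then show "orb (c i) \<in> Obj OC"
      using W_in[OF c, of i] unfolding Obj_OC by blast
  qed
  show "restrict (\<lambda>(i, j). mor (c i) (c j)) (chain_arrows n) \<in> (\<Pi>\<^sub>E p \<in> chain_arrows n.
      Hom OC (restrict (\<lambda>i. orb (c i)) {..n} (fst p)) (restrict (\<lambda>i. orb (c i)) {..n} (snd p)))"
    using W_in[OF c] W_mono[OF c] coset_map_in by (auto simp: chain_arrows_def Hom_OC mor_def)
  show "restrict (\<lambda>(i, j). mor (c i) (c j)) (chain_arrows n) (i, i) = Ident OC (restrict (\<lambda>i. orb (c i)) {..n} i)"
    if "i \<le> n" for i
    using mor_Ident[OF W_in[OF c that]] that by (simp add: chain_arrows_def)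
  show "restrict (\<lambda>(i, j). mor (c i) (c j)) (chain_arrows n) (i, k) =
      Comp OC (restrict (\<lambda>(i, j). mor (c i) (c j)) (chain_arrows n) (j, k))
        (restrict (\<lambda>(i, j). mor (c i) (c j)) (chain_arrows n) (i, j))"
    if "i \<le> j \<and> j \<le> k \<and> k \<le> n" for i j k
    using mor_Comp[of "c i" "c j" "c k"] W_in[OF c] W_mono[OF c] that by (simp add: chain_arrows_def)
qed

lemma word_chain_pull:
  assumes \<theta>: "\<theta> \<in> simplex_maps m n"
  shows "word_chain m (restrict (\<lambda>i. c (\<theta> i)) {..m}) = Pull K m n \<theta> (word_chain n c)"
proof -
  have "\<theta> i \<le> n" if "i \<le> m" for i
    using \<theta> that by (auto simp: simplex_maps_def)
  moreover have "\<theta> i \<le> \<theta> j" if "i \<le> j" "j \<le> m" for i j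
    using \<theta> that by (auto simp: simplex_maps_def intro: mono_onD)
  ultimately show ?thesis
    by (auto simp: nerve_def word_chain_def chain_arrows_def fun_eq_iff)
qed

text \<open>A base point in the first orbit is pushed forward along the arrows out of the vertex
  \<open>0\<close>; functoriality makes the resulting word compatible with all other arrows.\<close>

lemma word_chain_surj:
  assumes "\<sigma> \<in> Simps K n"
  obtains c where "c \<in> W n" "word_chain n c = \<sigma>"
proof -
  obtain x a where \<sigma>: "\<sigma> = (x, a)" by fastforce
  note xa = assms[unfolded \<sigma> Simps_K]
  have x: "x i \<in> Obj OC" if "i \<le> n" for i
    using xa that by auto
  have "\<exists>f. a (i, j) = (x i, x j, f) \<and> f \<in> coset_maps G (x i) (x j)" if "i \<le> j" "j \<le> n" for i j
    using xa that by (auto simp: PiE_iff chain_arrows_def Hom_OC)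
  then obtain f where f: "\<And>i j. \<lbrakk>i \<le> j; j \<le> n\<rbrakk> \<Longrightarrow> a (i, j) = (x i, x j, f i j) \<and> f i j \<in> coset_maps G (x i) (x j)"
    by metis
  have fin: "f i j y \<in> x j" if "i \<le> j" "j \<le> n" "y \<in> x i" for i j y
    using f[OF that(1,2)] that(3) by (auto simp: coset_maps_def)
  obtain b where b: "b \<in> x 0"
    using x[of 0] self_in_orb by (auto simp: Obj_OC)
  define c where "c = restrict (\<lambda>i. f 0 i b) {..n}"
  have cx: "c i \<in> x i" if "i \<le> n" for i
    using fin[of 0 i b] b that by (simp add: c_def)
  have cP: "c i \<in> finite_cosets G" and co: "orb (c i) = x i" if "i \<le> n" for i
    using Obj_OC_orb[OF x cx] that by auto
  have cc: "f i j (c i) = c j" if "i \<le> j" "j \<le> n" for i j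
  proof -
    have "a (0, j) = Comp OC (a (i, j)) (a (0, i))"
      using xa that by auto
    then have "f 0 j = compose (x 0) (f i j) (f 0 i)"
      using f[of 0 j] f[of i j] f[of 0 i] that by (simp add: orbit_category_def)
    then show ?thesis
      using b that by (simp add: c_def compose_def)
  qed
  \<comment> \<open>Whatever fixes a point fixes its image under an equivariant map, so the word is
    monotone.\<close>
  have st: "stab (c i) \<subseteq> stab (c j)" if "i \<le> j" "j \<le> n" for i j
  proof
    fix g assume "g \<in> stab (c i)"
    then have g: "g \<in> carrier G" "g <# c i = c i" by (auto simp: stab_def)
    have "f i j (g <# c i) = g <# f i j (c i)"
      using f[OF that] g(1) cx[of i] that by (auto simp: coset_maps_def)
    then show "g \<in> stab (c j)"
      using g cc[OF that] by (simp add: stab_def)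
  qed
  have c: "c \<in> W n"
    using cP st by (auto simp: W_iff c_def)
  have "mor (c i) (c j) = a (i, j)" if "i \<le> j" "j \<le> n" for i j
  proof -
    have "i \<le> n" using that by simp
    then have "coset_map (c i) (c j) = f i j"
      using f[OF that] coset_map_in[OF cP cP st[OF that]] coset_map_self[OF cP cP st[OF that]] cc[OF that] co that
      by (intro coset_maps_unique[OF cP[OF \<open>i \<le> n\<close>]]) auto
    then show ?thesis
      using f[OF that] co that by (simp add: mor_def)
  qed
  moreover have "a p = undefined" if "p \<notin> chain_arrows n" for p
  proof -
    have "a \<in> extensional (chain_arrows n)"
      using xa by (simp only: PiE_def Int_iff)
    then show ?thesis using that by (rule extensional_arb)
  qed
  ultimately have "restrict (\<lambda>(i, j). mor (c i) (c j)) (chain_arrows n) = a"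
    by (auto simp: fun_eq_iff chain_arrows_def)
  moreover have "restrict (\<lambda>i. orb (c i)) {..n} = x"
    using co xa by (auto simp: fun_eq_iff PiE_iff extensional_def)
  ultimately have "word_chain n c = \<sigma>"
    by (simp add: word_chain_def \<sigma>)
  then show ?thesis using that c by blast
qed

lemma word_chain_wact:
  assumes c: "c \<in> W n" and g: "g \<in> carrier G"
  shows "word_chain n (wact n g c) = word_chain n c"
proof -
  have "orb (g <# c i) = orb (c i)" if "i \<le> n" for i
    using orb_act[OF W_in[OF c that] g] .
  moreover have "mor (g <# c i) (g <# c j) = mor (c i) (c j)" if "i \<le> j" "j \<le> n" for i j
    using mor_act[OF W_in[OF c] W_in[OF c] W_mono[OF c] g] that by simp
  ultimately show ?thesis
    by (auto simp: word_chain_def wact_def fun_eq_iff chain_arrows_def)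
qed

text \<open>The first letters lie in one orbit, which provides \<open>g\<close>. The arrows out of
  the vertex \<open>0\<close> then force the same \<open>g\<close> at every other letter. With
  \<open>word_chain_wact\<close>, the fibres of \<open>word_chain\<close> over words are exactly the
  \<open>G\<close>-orbits.\<close>

lemma word_chain_eqD:
  assumes c: "c \<in> W n" and d: "d \<in> W n" and eq: "word_chain n c = word_chain n d"
  obtains g where "g \<in> carrier G" "d = wact n g c"
proof -
  have mor: "mor (c 0) (c i) = mor (d 0) (d i)" if "i \<le> n" for i
  proof -
    have "snd (word_chain n c) (0, i) = snd (word_chain n d) (0, i)"
      using eq by simp
    then show ?thesis using that by (simp add: word_chain_def chain_arrows_def)
  qed
  then have "orb (c 0) = orb (d 0)"
    using mor[of 0] by (simp add: mor_def)
  then obtain g where g: "g \<in> carrier G" "d 0 = g <# c 0"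
  proof -
    have "d 0 \<in> orb (c 0)"
      using self_in_orb[OF W_in[OF d, of 0]] \<open>orb (c 0) = orb (d 0)\<close> by simp
    then show ?thesis using that by (auto simp: orb_def)
  qed
  have "d i = g <# c i" if i: "i \<le> n" for i
  proof -
    have "d i = coset_map (d 0) (d i) (d 0)"
      using coset_map_self[OF W_in[OF d] W_in[OF d] W_mono[OF d]] i by simp
    also have "\<dots> = coset_map (c 0) (c i) (g <# c 0)"
      using mor[OF i] g(2) by (simp add: mor_def)
    also have "\<dots> = g <# c i"
      using coset_map_act[OF W_in[OF c] W_in[OF c] W_mono[OF c] g(1)] i by simp
    finally show ?thesis .
  qed
  then have "d = wact n g c"
    using d by (auto simp: wact_def fun_eq_iff W_iff PiE_iff extensional_def)
  then show ?thesis using that g(1) by blast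
qed

section \<open>The realized nerve of the orbit category as orbit space of \<open>|E|\<close>\<close>

definition orbit_proj where
  "orbit_proj C = (case SOME p. p \<in> C of ((n, c), t) \<Rightarrow> real_class K ((n, word_chain n c), t))"

lemma orbit_proj_cell: "orbit_proj (cell n c t) = real_class K ((n, word_chain n c), t)"
proof -
  let ?p = "SOME p. p \<in> cell n c t" and ?v = "\<lambda>((n, c), t). real_class K ((n, word_chain n c), t)"
  have "?p \<in> cell n c t"
    by (rule someI[of _ "((n, c), t)"]) (simp add: cell_def self_in_real_class)
  then have "real_class E ?p = real_class E ((n, c), t)"
    by (simp add: cell_def in_real_class_iff)
  then have "?v ?p = ?v ((n, c), t)"
  proof (rule real_class_invariant[rotated])
    fix m n \<theta> c t
    assume *: "\<theta> \<in> simplex_maps m n" "c \<in> W n" "t \<in> standard_simplex m"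
    show "?v ((m, Pull E m n \<theta> c), t) = ?v ((n, c), simplex_push m \<theta> t)"
      using real_class_pull[OF *(1) word_chain_in[OF *(2)] *(3)] by (simp add: Pull_E word_chain_pull[OF *(1)])
  qed
  then show ?thesis by (simp add: orbit_proj_def case_prod_unfold)
qed

text \<open>Equality in the realization of \<open>K\<close> comes from a zigzag that would have to
  be lifted step by step. Instead, each simplex with coordinates is assigned the set
  \<open>?v\<close> of all points of \<open>XE\<close> obtained from its lifts; lifts exist and
  differ by translations, so \<open>?v\<close> is unchanged along the zigzag.\<close>

lemma real_class_K_lift:
  assumes "real_class K ((n, word_chain n c), t) = real_class K ((m, word_chain m d), u)"
    and c: "c \<in> W n" and d: "d \<in> W m"
  obtains g where "g \<in> carrier G" "cell m d u = XE_act g (cell n c t)"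
proof -
  let ?v = "\<lambda>((n, \<sigma>), t). {cell n c t | c. c \<in> W n \<and> word_chain n c = \<sigma>}"
  have "?v ((n, word_chain n c), t) = ?v ((m, word_chain m d), u)"
  proof (rule real_class_invariant[OF _ assms(1)])
    fix m n \<theta> \<sigma> t
    assume \<theta>: "\<theta> \<in> simplex_maps m n" and \<sigma>: "\<sigma> \<in> Simps K n" and t: "t \<in> standard_simplex m"
    obtain b where b: "b \<in> W n" "word_chain n b = \<sigma>"
      using word_chain_surj[OF \<sigma>] .
    let ?b = "restrict (\<lambda>i. b (\<theta> i)) {..m}"
    have "\<exists>c. cell m c' t = cell n c (simplex_push m \<theta> t) \<and> c \<in> W n \<and> word_chain n c = \<sigma>"
      if c': "c' \<in> W m" "word_chain m c' = Pull K m n \<theta> \<sigma>" for c'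
    proof -
      have "word_chain m ?b = word_chain m c'"
        using word_chain_pull[OF \<theta>, of b] b c' by simp
      then obtain g where g: "g \<in> carrier G" "c' = wact m g ?b"
        using word_chain_eqD[OF Pull_in[OF \<theta> b(1)] c'(1)] by blast
      then have "c' = restrict (\<lambda>i. wact n g b (\<theta> i)) {..m}"
        using \<theta> by (auto simp: wact_def fun_eq_iff simplex_maps_def)
      then show ?thesis
        using cell_pull[OF \<theta> wact_in[OF b(1) g(1)] t] wact_in[OF b(1) g(1)] word_chain_wact[OF b(1) g(1)] b(2)
        by auto
    qed
    moreover have "\<exists>c'. cell n c (simplex_push m \<theta> t) = cell m c' t \<and> c' \<in> W m \<and> word_chain m c' = Pull K m n \<theta> \<sigma>"
      if "c \<in> W n" "word_chain n c = \<sigma>" for c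
      using cell_pull[OF \<theta> that(1) t] Pull_in[OF \<theta> that(1)] word_chain_pull[OF \<theta>, of c] that(2) by metis
    ultimately show "?v ((m, Pull K m n \<theta> \<sigma>), t) = ?v ((n, \<sigma>), simplex_push m \<theta> t)"
      by auto
  qed
  then have "cell m d u \<in> ?v ((n, word_chain n c), t)"
    using d by auto
  then obtain c' where c': "c' \<in> W n" "word_chain n c = word_chain n c'" "cell m d u = cell n c' t"
    by auto
  obtain g where "g \<in> carrier G" "c' = wact n g c"
    using word_chain_eqD[OF c c'(1,2)] .
  then show ?thesis
    using that c'(3) XE_act_cell by simp
qed

lemma orbit_map_orbit_proj: "orbit_map G XE XE_act (geometric_realization K) orbit_proj"
proof -
  have cont: "continuous_map XE (geometric_realization K) orbit_proj"
  proof (rule continuous_compose_quotient_map[OF quotient_map_real_class])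
    show "continuous_map (simplex_sum E) (geometric_realization K) (orbit_proj \<circ> real_class E)"
      unfolding simplex_sum_alt
    proof (rule continuous_map_from_sum_topology)
      fix a assume "a \<in> (SIGMA n:UNIV. W n)"
      then obtain n c where a: "a = (n, c)" "c \<in> W n" by auto
      show "continuous_map ((\<lambda>(n, \<sigma>). simplex_top n) a) (geometric_realization K) (\<lambda>x. (orbit_proj \<circ> real_class E) (a, x))"
        using continuous_map_real_class[OF word_chain_in[OF a(2)]] orbit_proj_cell a by (simp add: cell_def)
    qed
  qed
  have "quotient_map XE (geometric_realization K) orbit_proj"
    unfolding quotient_map_closedin
  proof (intro conjI allI impI iffI)
    show "orbit_proj ` topspace XE = topspace (geometric_realization K)"
    proof
      show "topspace (geometric_realization K) \<subseteq> orbit_proj ` topspace XE"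
      proof
        fix p assume "p \<in> topspace (geometric_realization K)"
        then obtain n \<sigma> t where p: "p = real_class K ((n, \<sigma>), t)" "\<sigma> \<in> Simps K n" "t \<in> standard_simplex n"
          by (auto simp: topspace_geometric_realization)
        obtain c where "c \<in> W n" "word_chain n c = \<sigma>"
          using word_chain_surj[OF p(2)] .
        then show "p \<in> orbit_proj ` topspace XE"
          using p orbit_proj_cell[of n c t] cell_in_XE by (intro image_eqI[of _ _ "cell n c t"]) auto
      qed
    qed (rule continuous_map_image_subset_topspace[OF cont])
  next
    fix V assume V: "V \<subseteq> topspace (geometric_realization K)" and cl: "closedin XE {x \<in> topspace XE. orbit_proj x \<in> V}"
    show "closedin (geometric_realization K) V"
    proof (rule closedin_geometric_realization[OF V])
      fix n \<sigma> assume "\<sigma> \<in> Simps K n"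
      \<comment> \<open>A lift keeps the coordinates, so the trace of \<open>V\<close> on the
        simplex \<open>\<sigma>\<close> equals the trace of its preimage on the cell of
        \<open>c\<close>.\<close>
      then obtain c where c: "c \<in> W n" "word_chain n c = \<sigma>"
        by (rule word_chain_surj)
      have "closedin (simplex_top n) {t \<in> topspace (simplex_top n). cell n c t \<in> {x \<in> topspace XE. orbit_proj x \<in> V}}"
        by (rule closedin_continuous_map_preimage[OF continuous_map_cell[OF c(1)] cl])
      moreover have "{t \<in> topspace (simplex_top n). cell n c t \<in> {x \<in> topspace XE. orbit_proj x \<in> V}} =
          {t \<in> standard_simplex n. real_class K ((n, \<sigma>), t) \<in> V}"
        using orbit_proj_cell[of n c] cell_in_XE[OF c(1)] c(2) by auto
      ultimately show "closedin (simplex_top n) {t \<in> standard_simplex n. real_class K ((n, \<sigma>), t) \<in> V}"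
        by simp
    qed
  qed (rule closedin_continuous_map_preimage[OF cont])
  moreover have "orbit_proj x = orbit_proj y \<longleftrightarrow> (\<exists>g\<in>carrier G. y = XE_act g x)"
    if x: "x \<in> topspace XE" and y: "y \<in> topspace XE" for x y
  proof -
    obtain n c t where c: "c \<in> W n" "t \<in> standard_simplex n" "x = cell n c t"
      using cell_cases[OF x] .
    obtain m d u where d: "d \<in> W m" "u \<in> standard_simplex m" "y = cell m d u"
      using cell_cases[OF y] .
    show ?thesis
    proof
      assume "orbit_proj x = orbit_proj y"
      then have "real_class K ((n, word_chain n c), t) = real_class K ((m, word_chain m d), u)"
        using orbit_proj_cell c(3) d(3) by simp
      then obtain g where "g \<in> carrier G" "cell m d u = XE_act g (cell n c t)"
        using real_class_K_lift[OF _ c(1) d(1)] by blast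
      then show "\<exists>g\<in>carrier G. y = XE_act g x"
        using c(3) d(3) by blast
    next
      assume "\<exists>g\<in>carrier G. y = XE_act g x"
      then show "orbit_proj x = orbit_proj y"
        using c XE_act_cell orbit_proj_cell word_chain_wact by auto
    qed
  qed
  ultimately show ?thesis
    by (simp add: orbit_map_def)
qed

text \<open>An element that fixes a word fixes its first letter, whose stabilizer is finite.\<close>

lemma reduced_stabilizer:
  assumes "c \<in> reduced n"
  shows "{g \<in> carrier G. wact n g c = c} \<in> finite_subgroups G"
proof -
  interpret XE: cellular_G_space G XE XE_act reduced wact simplex_top "\<lambda>n t. 1 - (real n + 1) * Min (t ` {..n})"
     "\<lambda>n t l i. if i \<le> n then 1 / (real n + 1) + (t i - 1 / (real n + 1)) / l else 0" cell
    by (rule cellular_G_space_XE)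
  have c: "c \<in> W n" using assms by (simp add: reduced_def)
  have "{g \<in> carrier G. wact n g c = c} \<subseteq> stab (c 0)"
  proof
    fix g assume "g \<in> {g \<in> carrier G. wact n g c = c}"
    then have "g \<in> carrier G" "wact n g c 0 = c 0" by auto
    then show "g \<in> stab (c 0)" by (simp add: wact_def stab_def)
  qed
  then have "finite {g \<in> carrier G. wact n g c = c}"
    using finite_stab[OF W_in[OF c, of 0]] finite_subset by blast
  then show ?thesis
    using XE.cell_stabilizer_subgroup[OF assms] by (simp add: finite_subgroups_def)
qed

end

section \<open>Comparison of the two orbit spaces\<close>

lemma orbit_map_orbit_space:
  assumes G: "group G" and Y: "cts_action G Y \<phi>"
  shows "orbit_map G Y \<phi> (orbit_space G Y \<phi>) (orbit G \<phi>)"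
proof -
  interpret group G by (rule G)
  note Y = cts_actionD[OF Y]
  have "orbit G \<phi> x = orbit G \<phi> y \<longleftrightarrow> (\<exists>g\<in>carrier G. y = \<phi> g x)"
    if x: "x \<in> topspace Y" and y: "y \<in> topspace Y" for x y
  proof
    assume "orbit G \<phi> x = orbit G \<phi> y"
    moreover have "y \<in> orbit G \<phi> y"
      using Y(3)[OF y] unfolding orbit_def by (metis (mono_tags, lifting) mem_Collect_eq one_closed)
    ultimately show "\<exists>g\<in>carrier G. y = \<phi> g x"
      by (auto simp: orbit_def)
  next
    assume "\<exists>g\<in>carrier G. y = \<phi> g x"
    then obtain g where g: "g \<in> carrier G" "y = \<phi> g x" by blast
    have "\<phi> h x = \<phi> (h \<otimes>\<^bsub>G\<^esub> inv\<^bsub>G\<^esub> g) y" if "h \<in> carrier G" for h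
    proof -
      have "\<phi> (h \<otimes>\<^bsub>G\<^esub> inv\<^bsub>G\<^esub> g) y = \<phi> (h \<otimes>\<^bsub>G\<^esub> inv\<^bsub>G\<^esub> g \<otimes>\<^bsub>G\<^esub> g) x"
        using Y(4)[of "h \<otimes>\<^bsub>G\<^esub> inv\<^bsub>G\<^esub> g" g x] g that x by simp
      then show ?thesis
        using g(1) that by (simp add: m_assoc)
    qed
    moreover have "\<phi> h y = \<phi> (h \<otimes>\<^bsub>G\<^esub> g) x" if "h \<in> carrier G" for h
      using Y(4)[OF that g(1) x] g(2) by simp
    ultimately show "orbit G \<phi> x = orbit G \<phi> y"
      unfolding orbit_def using g(1) by (blast intro: m_closed inv_closed)
  qed
  then show ?thesis
    by (simp add: orbit_map_def orbit_space_def quotient_map_quotient_topology)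
qed

theorem mainTheorem3:
  fixes G :: "('g, 'b) monoid_scheme"
    and Y :: "'y topology"
    and \<phi> :: "'g \<Rightarrow> 'y \<Rightarrow> 'y"
  assumes "group G"
    and "classifying_G_space G (finite_subgroups G) Y \<phi>"
  shows "geometric_realization (nerve (orbit_category G (finite_subgroups G)))
           homotopy_equivalent_space orbit_space G Y \<phi>"
proof -
  interpret coset_nerve G
    using assms(1) by (simp add: coset_nerve_def)
  have Y: "G_CW_complex G Y \<phi>"
    and stabY: "\<And>y. y \<in> topspace Y \<Longrightarrow> stabilizer G \<phi> y \<in> finite_subgroups G"
    and fixY: "\<And>H. H \<in> finite_subgroups G \<Longrightarrow> fixed_points Y \<phi> H \<noteq> {} \<and>
        contractible_space (subtopology Y (fixed_points Y \<phi> H))"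
    using assms(2) by (auto simp: classifying_G_space_def)
  obtain I :: "nat \<Rightarrow> ('y \<times> 'g set) set" and \<psi> q where
    cells: "cellular_G_space G Y \<phi> I \<psi> disc (\<lambda>n x. sqrt (\<Sum>i<n. x i ^ 2)) (\<lambda>_ x l i. x i / l) q"
    using cellular_G_space_of_G_CW_complex[OF assms(1) Y] .
  interpret Y: cellular_G_space G Y \<phi> I \<psi> disc "\<lambda>n x. sqrt (\<Sum>i<n. x i ^ 2)" "\<lambda>_ x l i. x i / l" q
    by (rule cells)
  have st: "{g \<in> carrier G. \<psi> n g i = i} \<in> finite_subgroups G" if i: "i \<in> I n" for n i
  proof -
    \<comment> \<open>The hypothesis on isotropy concerns points, so the stabilizer of a cell is
      compared with that of its centre; as a subgroup contained in a finite group it is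
      finite.\<close>
    have 0: "(\<lambda>_. 0) \<in> topspace (disc n)" by (simp add: topspace_disc)
    have "{g \<in> carrier G. \<psi> n g i = i} \<subseteq> stabilizer G \<phi> (q n i (\<lambda>_. 0))"
      using Y.cell_equivariant[OF i _ 0] by (fastforce simp: stabilizer_def)
    moreover have "finite (stabilizer G \<phi> (q n i (\<lambda>_. 0)))"
      using stabY[OF Y.cell_in[OF i 0]] by (simp add: finite_subgroups_def)
    ultimately show ?thesis
      using Y.cell_stabilizer_subgroup[OF i] finite_subset by (auto simp: finite_subgroups_def)
  qed
  show ?thesis
  proof (rule orbit_spaces_homotopy_equivalent[OF cellular_G_space_XE cells reduced_stabilizer st _ fixY
        orbit_map_orbit_proj orbit_map_orbit_space[OF assms(1) Y.action]])
    \<comment> \<open>The cone point is the coset \<open>H\<close> itself, whose stabilizer is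
      \<open>H\<close>.\<close>
    show "fixed_points XE XE_act H \<noteq> {} \<and> contractible_space (subtopology XE (fixed_points XE XE_act H))"
      if "H \<in> finite_subgroups G" for H
      using contractible_fixed_set[OF subgroup_in_finite_cosets(2)[OF that]] stab_subgroup[OF that] by simp
  qed
qed

end
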